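(* Let $k$ be a field and $m,n\geq 1$. There is an equivalence of categories $$\frac{\operatorname{rep}_k^{\mathsf e,\mathsf e}(\vec A_m\otimes\vec A_n)}{\mathbb C_{\mathsf e,\mathsf e}}\simeq\operatorname{rep}_k(\vec A_{m-1}\otimes\vec A_{n-1}),$$ where $\mathbb C_{\mathsf e,\mathsf e}$ is the full subcategory (closed under finite direct sums and summands) whose indecomposables are those of the form $k_{\{(x,y)\mid x<i\text{ or }y<j\}}$ with $1\leq i\leq m+1$, $1\leq j\leq n+1$, $(i,j)\neq(1,1)$.
   Context: $\vec A_n$ denotes the poset $\{1<2<\cdots<n\}$ viewed as a category ($\vec A_0$ is empty), and $\vec A_m\otimes\vec A_n$ is the product poset, i.e. the fully commutative grid with vertices $(x,y)$, $1\le x\le m$, $1\le y\le n$. $\operatorname{rep}_k(\vec A_m\otimes\vec A_n)$ is the category of functors from $\vec A_m\otimes\vec A_n$ to finite dimensional $k$-vector spaces (over the empty poset this is the zero category). $\operatorname{rep}_k^{\mathsf e,\mathsf e}(\vec A_m\otimes\vec A_n)$ is the full subcategory of those representations all of whose structure maps (horizontal and vertical) are epimorphisms. For an additive category $\mathcal E$ and a full subcategory $\mathcal X$ closed under finite direct sums, $\mathcal E/\mathcal X$ is the category with the same objects as $\mathcal E$ and $\operatorname{Hom}_{\mathcal E/\mathcal X}(E,E')=\operatorname{Hom}_{\mathcal E}(E,E')/\sim$, where $f\sim g$ iff $f-g$ factors through an object of $\mathcal X$. For a convex subset $C$ of a poset, $k_C$ is the representation with value $k$ at points of $C$, value $0$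 elsewhere, and structure map $\operatorname{id}_k$ whenever $x\leq y$ are both in $C$. *)

theory Defs
  imports Complex_Main "HOL-Library.FuncSet" "HOL-Library.Function_Algebras"
    "HOL-Library.Product_Order"
begin

section \<open>Categories, functors, equivalences\<close>

text \<open>
  Hom-sets belonging to different pairs of objects are not required to be disjoint. Therefore
  composition, and the action of a functor on morphisms, take the objects as arguments:
  \<open>Cmp C a b c g f\<close> is the composite of \<open>f : a \<rightarrow> b\<close> followed by \<open>g : b \<rightarrow> c\<close>.
\<close>

record ('o, 'm) cat =
  Obj :: "'o set"
  Hom :: "'o \<Rightarrow> 'o \<Rightarrow> 'm set"
  Ide :: "'o \<Rightarrow> 'm"
  Cmp :: "'o \<Rightarrow> 'o \<Rightarrow> 'o \<Rightarrow> 'm \<Rightarrow> 'm \<Rightarrow> 'm"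

locale category =
  fixes C :: "('o, 'm, 'x) cat_scheme"
  assumes Ide_in: "a \<in> Obj C \<Longrightarrow> Ide C a \<in> Hom C a a"
    and Cmp_in: "\<lbrakk>a \<in> Obj C; b \<in> Obj C; c \<in> Obj C; f \<in> Hom C a b; g \<in> Hom C b c\<rbrakk>
      \<Longrightarrow> Cmp C a b c g f \<in> Hom C a c"
    and Cmp_Ide_right: "\<lbrakk>a \<in> Obj C; b \<in> Obj C; f \<in> Hom C a b\<rbrakk> \<Longrightarrow> Cmp C a a b f (Ide C a) = f"
    and Cmp_Ide_left: "\<lbrakk>a \<in> Obj C; b \<in> Obj C; f \<in> Hom C a b\<rbrakk> \<Longrightarrow> Cmp C a b b (Ide C b) f = f"
    and Cmp_assoc: "\<lbrakk>a \<in> Obj C; b \<in> Obj C; c \<in> Obj C; d \<in> Obj C;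
        f \<in> Hom C a b; g \<in> Hom C b c; h \<in> Hom C c d\<rbrakk>
      \<Longrightarrow> Cmp C a c d h (Cmp C a b c g f) = Cmp C a b d (Cmp C b c d h g) f"

definition epi :: "('o, 'm, 'x) cat_scheme \<Rightarrow> 'o \<Rightarrow> 'o \<Rightarrow> 'm \<Rightarrow> bool" where
  "epi C a b f \<longleftrightarrow> f \<in> Hom C a b \<and>
    (\<forall>c\<in>Obj C. \<forall>g\<in>Hom C b c. \<forall>h\<in>Hom C b c. Cmp C a b c g f = Cmp C a b c h f \<longrightarrow> g = h)"

definition iso :: "('o, 'm, 'x) cat_scheme \<Rightarrow> 'o \<Rightarrow> 'o \<Rightarrow> 'm \<Rightarrow> bool" where
  "iso C a b f \<longleftrightarrow> f \<in> Hom C a b \<and>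
    (\<exists>g\<in>Hom C b a. Cmp C a b a g f = Ide C a \<and> Cmp C b a b f g = Ide C b)"

definition isomorphic :: "('o, 'm, 'x) cat_scheme \<Rightarrow> 'o \<Rightarrow> 'o \<Rightarrow> bool" where
  "isomorphic C a b \<longleftrightarrow> (\<exists>f. iso C a b f)"

record ('o1, 'm1, 'o2, 'm2) func =
  fobj :: "'o1 \<Rightarrow> 'o2"
  fmap :: "'o1 \<Rightarrow> 'o1 \<Rightarrow> 'm1 \<Rightarrow> 'm2"

definition is_functor ::
    "('o1, 'm1, 'x) cat_scheme \<Rightarrow> ('o2, 'm2, 'y) cat_scheme \<Rightarrow> ('o1, 'm1, 'o2, 'm2) func \<Rightarrow> bool" where
  "is_functor C D F \<longleftrightarrow>
    (\<forall>a\<in>Obj C. fobj F a \<in> Obj D) \<and>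
    (\<forall>a\<in>Obj C. \<forall>b\<in>Obj C. \<forall>f\<in>Hom C a b. fmap F a b f \<in> Hom D (fobj F a) (fobj F b)) \<and>
    (\<forall>a\<in>Obj C. fmap F a a (Ide C a) = Ide D (fobj F a)) \<and>
    (\<forall>a\<in>Obj C. \<forall>b\<in>Obj C. \<forall>c\<in>Obj C. \<forall>f\<in>Hom C a b. \<forall>g\<in>Hom C b c.
      fmap F a c (Cmp C a b c g f)
        = Cmp D (fobj F a) (fobj F b) (fobj F c) (fmap F b c g) (fmap F a b f))"

definition id_func :: "('o, 'm, 'o, 'm) func" where
  "id_func = \<lparr>fobj = (\<lambda>a. a), fmap = (\<lambda>a b f. f)\<rparr>"

definition comp_func ::
    "('o2, 'm2, 'o3, 'm3) func \<Rightarrow> ('o1, 'm1, 'o2, 'm2) func \<Rightarrow> ('o1, 'm1, 'o3, 'm3) func" where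
  "comp_func G F = \<lparr>fobj = (\<lambda>a. fobj G (fobj F a)),
    fmap = (\<lambda>a b f. fmap G (fobj F a) (fobj F b) (fmap F a b f))\<rparr>"

definition nat_trans ::
    "('o1, 'm1, 'x) cat_scheme \<Rightarrow> ('o2, 'm2, 'y) cat_scheme \<Rightarrow> ('o1, 'm1, 'o2, 'm2) func
      \<Rightarrow> ('o1, 'm1, 'o2, 'm2) func \<Rightarrow> ('o1 \<Rightarrow> 'm2) \<Rightarrow> bool" where
  "nat_trans C D F G \<eta> \<longleftrightarrow>
    (\<forall>a\<in>Obj C. \<eta> a \<in> Hom D (fobj F a) (fobj G a)) \<and>
    (\<forall>a\<in>Obj C. \<forall>b\<in>Obj C. \<forall>f\<in>Hom C a b.
      Cmp D (fobj F a) (fobj F b) (fobj G b) (\<eta> b) (fmap F a b f)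
        = Cmp D (fobj F a) (fobj G a) (fobj G b) (fmap G a b f) (\<eta> a))"

definition naturally_isomorphic ::
    "('o1, 'm1, 'x) cat_scheme \<Rightarrow> ('o2, 'm2, 'y) cat_scheme \<Rightarrow> ('o1, 'm1, 'o2, 'm2) func
      \<Rightarrow> ('o1, 'm1, 'o2, 'm2) func \<Rightarrow> bool" where
  "naturally_isomorphic C D F G \<longleftrightarrow>
    (\<exists>\<eta>. nat_trans C D F G \<eta> \<and> (\<forall>a\<in>Obj C. iso D (fobj F a) (fobj G a) (\<eta> a)))"

definition equivalent_categories ::
    "('o1, 'm1, 'x) cat_scheme \<Rightarrow> ('o2, 'm2, 'y) cat_scheme \<Rightarrow> bool" where
  "equivalent_categories C D \<longleftrightarrow> category C \<and> category D \<and>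
    (\<exists>F G. is_functor C D F \<and> is_functor D C G \<and>
      naturally_isomorphic C C (comp_func G F) id_func \<and>
      naturally_isomorphic D D (comp_func F G) id_func)"

definition full_subcategory :: "('o, 'm, 'x) cat_scheme \<Rightarrow> 'o set \<Rightarrow> ('o, 'm, 'x) cat_scheme" where
  "full_subcategory C S = C\<lparr>Obj := Obj C \<inter> S\<rparr>"

definition poset_cat :: "'a::order set \<Rightarrow> ('a, unit) cat" where
  "poset_cat P = \<lparr>Obj = P, Hom = (\<lambda>p q. if p \<le> q then {()} else {}),
    Ide = (\<lambda>p. ()), Cmp = (\<lambda>p q r g f. ())\<rparr>"


section \<open>Categories with addition on hom-sets\<close>

record ('o, 'm) preadd_cat = "('o, 'm) cat" +
  Add :: "'o \<Rightarrow> 'o \<Rightarrow> 'm \<Rightarrow> 'm \<Rightarrow> 'm"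
  Zero :: "'o \<Rightarrow> 'o \<Rightarrow> 'm"
  Neg :: "'o \<Rightarrow> 'o \<Rightarrow> 'm \<Rightarrow> 'm"

definition zero_object :: "('o, 'm, 'x) preadd_cat_scheme \<Rightarrow> 'o \<Rightarrow> bool" where
  "zero_object C z \<longleftrightarrow> z \<in> Obj C \<and>
    (\<forall>a\<in>Obj C. (\<exists>!f. f \<in> Hom C z a) \<and> (\<exists>!f. f \<in> Hom C a z))"

definition direct_sum :: "('o, 'm, 'x) preadd_cat_scheme \<Rightarrow> 'o \<Rightarrow> 'o \<Rightarrow> 'o \<Rightarrow> bool" where
  "direct_sum C s a b \<longleftrightarrow> s \<in> Obj C \<and> a \<in> Obj C \<and> b \<in> Obj C \<and>
    (\<exists>i\<in>Hom C a s. \<exists>j\<in>Hom C b s. \<exists>p\<in>Hom C s a. \<exists>q\<in>Hom C s b.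
      Cmp C a s a p i = Ide C a \<and> Cmp C b s b q j = Ide C b \<and>
      Cmp C b s a p j = Zero C b a \<and> Cmp C a s b q i = Zero C a b \<and>
      Add C s s (Cmp C s a s i p) (Cmp C s b s j q) = Ide C s)"

definition indecomposable :: "('o, 'm, 'x) preadd_cat_scheme \<Rightarrow> 'o \<Rightarrow> bool" where
  "indecomposable C e \<longleftrightarrow> e \<in> Obj C \<and> \<not> zero_object C e \<and>
    (\<forall>a b. direct_sum C e a b \<longrightarrow> zero_object C a \<or> zero_object C b)"

text \<open>The empty direct sum is a finite direct sum, hence the condition on zero objects.\<close>

definition closed_under_direct_sums :: "('o, 'm, 'x) preadd_cat_scheme \<Rightarrow> 'o set \<Rightarrow> bool" where
  "closed_under_direct_sums C X \<longleftrightarrow>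
    (\<forall>z. zero_object C z \<longrightarrow> z \<in> X) \<and>
    (\<forall>s. \<forall>a\<in>X. \<forall>b\<in>X. direct_sum C s a b \<longrightarrow> s \<in> X)"

definition closed_under_summands :: "('o, 'm, 'x) preadd_cat_scheme \<Rightarrow> 'o set \<Rightarrow> bool" where
  "closed_under_summands C X \<longleftrightarrow> (\<forall>s\<in>X. \<forall>a b. direct_sum C s a b \<longrightarrow> a \<in> X \<and> b \<in> X)"

text \<open>
  \<open>X\<close> is the object set of a full subcategory that is closed under finite direct sums and
  summands and whose indecomposables are, up to isomorphism, the objects in \<open>S\<close>.
\<close>

definition subcategory_with_indecomposables ::
    "('o, 'm, 'x) preadd_cat_scheme \<Rightarrow> 'o set \<Rightarrow> 'o set \<Rightarrow> bool" where
  "subcategory_with_indecomposables C S X \<longleftrightarrow> X \<subseteq> Obj C \<and>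
    closed_under_direct_sums C X \<and> closed_under_summands C X \<and>
    {e \<in> X. indecomposable C e} = {e \<in> Obj C. \<exists>s\<in>S. isomorphic C e s}"

definition factors_through ::
    "('o, 'm, 'x) cat_scheme \<Rightarrow> 'o set \<Rightarrow> 'o \<Rightarrow> 'o \<Rightarrow> 'm \<Rightarrow> bool" where
  "factors_through C X a b f \<longleftrightarrow>
    (\<exists>x\<in>X. \<exists>g\<in>Hom C a x. \<exists>h\<in>Hom C x b. f = Cmp C a x b h g)"

definition quotient_rel ::
    "('o, 'm, 'x) preadd_cat_scheme \<Rightarrow> 'o set \<Rightarrow> 'o \<Rightarrow> 'o \<Rightarrow> ('m \<times> 'm) set" where
  "quotient_rel C X a b = {(f, g). f \<in> Hom C a b \<and> g \<in> Hom C a b \<and>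
    factors_through C X a b (Add C a b f (Neg C a b g))}"

definition quotient_cat ::
    "('o, 'm, 'x) preadd_cat_scheme \<Rightarrow> 'o set \<Rightarrow> ('o, 'm set) cat" where
  "quotient_cat C X = \<lparr>Obj = Obj C,
    Hom = (\<lambda>a b. Hom C a b // quotient_rel C X a b),
    Ide = (\<lambda>a. quotient_rel C X a a `` {Ide C a}),
    Cmp = (\<lambda>a b c G F. \<Union>g\<in>G. \<Union>f\<in>F. quotient_rel C X a c `` {Cmp C a b c g f})\<rparr>"

text \<open>
  Functors and natural transformations are normalised to be \<^const>\<open>undefined\<close> outside their
  domain, so that distinct elements of the types represent distinct functors and transformations.
\<close>

definition functor_cat ::
    "('o1, 'm1, 'x) cat_scheme \<Rightarrow> ('o2, 'm2, 'y) preadd_cat_scheme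
      \<Rightarrow> (('o1, 'm1, 'o2, 'm2) func, 'o1 \<Rightarrow> 'm2) preadd_cat" where
  "functor_cat C D = \<lparr>
    Obj = {F. is_functor C D F \<and> fobj F \<in> extensional (Obj C) \<and>
      (\<forall>a b f. \<not> (a \<in> Obj C \<and> b \<in> Obj C \<and> f \<in> Hom C a b) \<longrightarrow> fmap F a b f = undefined)},
    Hom = (\<lambda>F G. {\<eta> \<in> extensional (Obj C). nat_trans C D F G \<eta>}),
    Ide = (\<lambda>F. \<lambda>a\<in>Obj C. Ide D (fobj F a)),
    Cmp = (\<lambda>F G H \<theta> \<eta>. \<lambda>a\<in>Obj C. Cmp D (fobj F a) (fobj G a) (fobj H a) (\<theta> a) (\<eta> a)),
    Add = (\<lambda>F G \<eta> \<theta>. \<lambda>a\<in>Obj C. Add D (fobj F a) (fobj G a) (\<eta> a) (\<theta> a)),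
    Zero = (\<lambda>F G. \<lambda>a\<in>Obj C. Zero D (fobj F a) (fobj G a)),
    Neg = (\<lambda>F G \<eta>. \<lambda>a\<in>Obj C. Neg D (fobj F a) (fobj G a) (\<eta> a))\<rparr>"


section \<open>Finite dimensional vector spaces\<close>

text \<open>
  The objects are the finite dimensional subspaces of the space of sequences over \<open>'k\<close>. This
  ambient space is infinite dimensional, so every finite dimensional vector space over \<open>'k\<close> is
  isomorphic to one of them. The morphisms are all linear maps.
\<close>

definition scale :: "'k::field \<Rightarrow> (nat \<Rightarrow> 'k) \<Rightarrow> (nat \<Rightarrow> 'k)" where
  "scale c v = (\<lambda>i. c * v i)"

interpretation seqs: vector_space "scale :: 'k::field \<Rightarrow> _"
  by unfold_locales (auto simp: scale_def fun_eq_iff algebra_simps)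

definition fdVect ::
    "'k::field itself \<Rightarrow> ((nat \<Rightarrow> 'k) set, (nat \<Rightarrow> 'k) \<Rightarrow> (nat \<Rightarrow> 'k)) preadd_cat" where
  "fdVect _ = \<lparr>
    Obj = {V. seqs.subspace V \<and> (\<exists>B. finite B \<and> V = seqs.span B)},
    Hom = (\<lambda>V W. {f \<in> V \<rightarrow>\<^sub>E W. (\<forall>u\<in>V. \<forall>v\<in>V. f (u + v) = f u + f v) \<and>
      (\<forall>c. \<forall>v\<in>V. f (scale c v) = scale c (f v))}),
    Ide = (\<lambda>V. \<lambda>v\<in>V. v),
    Cmp = (\<lambda>U V W g f. compose U g f),
    Add = (\<lambda>V W f g. \<lambda>v\<in>V. f v + g v),
    Zero = (\<lambda>V W. \<lambda>v\<in>V. 0),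
    Neg = (\<lambda>V W f. \<lambda>v\<in>V. - f v)\<rparr>"


section \<open>Representations of the commutative grid\<close>

text \<open>The order on pairs of natural numbers is the product order.\<close>

definition grid :: "nat \<Rightarrow> nat \<Rightarrow> (nat \<times> nat) set" where
  "grid m n = {1..m} \<times> {1..n}"

type_synonym 'k grid_rep =
  "(nat \<times> nat, unit, (nat \<Rightarrow> 'k) set, (nat \<Rightarrow> 'k) \<Rightarrow> (nat \<Rightarrow> 'k)) func"

type_synonym 'k grid_rep_cat =
  "('k grid_rep, nat \<times> nat \<Rightarrow> (nat \<Rightarrow> 'k) \<Rightarrow> (nat \<Rightarrow> 'k)) preadd_cat"

definition rep :: "'k::field itself \<Rightarrow> nat \<Rightarrow> nat \<Rightarrow> 'k grid_rep_cat" where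
  "rep k m n = functor_cat (poset_cat (grid m n)) (fdVect k)"

definition rep_ee :: "'k::field itself \<Rightarrow> nat \<Rightarrow> nat \<Rightarrow> 'k grid_rep_cat" where
  "rep_ee k m n = full_subcategory (rep k m n) {M.
    (\<forall>x x' y. (x, y) \<in> grid m n \<and> (x', y) \<in> grid m n \<and> x \<le> x' \<longrightarrow>
      epi (fdVect k) (fobj M (x, y)) (fobj M (x', y)) (fmap M (x, y) (x', y) ())) \<and>
    (\<forall>x y y'. (x, y) \<in> grid m n \<and> (x, y') \<in> grid m n \<and> y \<le> y' \<longrightarrow>
      epi (fdVect k) (fobj M (x, y)) (fobj M (x, y')) (fmap M (x, y) (x, y') ()))}"

text \<open>
  The field as a vector space over itself is realised as the line of sequences supported at index 0.
\<close>

definition line :: "(nat \<Rightarrow> 'k::field) set" where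
  "line = {v. \<forall>i>0. v i = 0}"

definition indicator_space :: "'a set \<Rightarrow> 'a \<Rightarrow> (nat \<Rightarrow> 'k::field) set" where
  "indicator_space S p = (if p \<in> S then line else {0})"

text \<open>
  This is the representation \<open>k\<^sub>S\<close>; it is a functor whenever \<open>S \<subseteq> grid m n\<close> is convex.
\<close>

definition indicator_rep ::
    "'k::field itself \<Rightarrow> nat \<Rightarrow> nat \<Rightarrow> (nat \<times> nat) set \<Rightarrow> 'k grid_rep" where
  "indicator_rep k m n S = \<lparr>
    fobj = (\<lambda>p\<in>grid m n. indicator_space S p),
    fmap = (\<lambda>p q u. if p \<in> grid m n \<and> q \<in> grid m n \<and> p \<le> q
      then if p \<in> S \<and> q \<in> S then (\<lambda>v\<in>line. v) else (\<lambda>v\<in>indicator_space S p. 0)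
      else undefined)\<rparr>"

definition ee_generators :: "'k::field itself \<Rightarrow> nat \<Rightarrow> nat \<Rightarrow> 'k grid_rep set" where
  "ee_generators k m n = {indicator_rep k m n {(x, y) \<in> grid m n. x < i \<or> y < j} | i j.
    1 \<le> i \<and> i \<le> m + 1 \<and> 1 \<le> j \<and> j \<le> n + 1 \<and> (i, j) \<noteq> (1, 1)}"

definition is_C_ee :: "'k::field itself \<Rightarrow> nat \<Rightarrow> nat \<Rightarrow> 'k grid_rep set \<Rightarrow> bool" where
  "is_C_ee k m n X \<longleftrightarrow>
    subcategory_with_indecomposables (rep_ee k m n) (ee_generators k m n) X"

end

theory Submission
  imports Defs "HOL-Library.Nat_Bijection"
begin

text \<open>
  A representation \<open>M\<close> with epimorphic structure maps is a vector space \<open>V = M (1, 1)\<close> with a monotone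
  family of subspaces, the kernels of \<open>V \<rightarrow> M p\<close>. The equivalence is induced by the functor that
  sends \<open>M\<close> to its core, the largest subrepresentation vanishing on the edges \<open>x = m\<close> and \<open>y = n\<close>.

  A map vanishing on the core factors through the quotient by the core, which is coreless; so a
  morphism is killed by the functor iff it factors through a coreless object. If \<open>M\<close> is coreless,
  the kernels are the intersections of two flags of \<open>V\<close>; a basis adapted to both flags splits \<open>M\<close> into
  the generators, so the coreless objects are exactly those of \<open>\<C>\<close>. An adapted basis also
  extends every map between cores, which gives fullness.
\<close>

section \<open>Linear algebra of sequence spaces\<close>

text \<open>The kernels of \<open>V \<rightarrow> M p\<close> can form any monotone family of
  subspaces starting at zero, and in general no basis of \<open>V\<close> is adapted to such a
  family: three distinct lines in a plane already exclude it. The preimage of the core in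
  \<open>V\<close> is tamer. For every object it is, at \<open>p\<close>, the intersection of the
  kernels at the ends of the row and of the column through \<open>p\<close>, so only two flags
  enter, and two flags always have a common adapted basis. A vector of that basis enters the first
  flag at some \<open>i\<close> and the second at some \<open>j\<close>, where
  \<open>i = m + 1\<close> or \<open>j = n + 1\<close> means never on the grid. These pairs are the
  indices of the generators; \<open>(1, 1)\<close> would mean a nonzero vector that is already zero
  in \<open>M (1, 1)\<close>. All objects are subspaces of one sequence space. Quotients are
  therefore realised as images of chosen projections (\<open>proj\<close>), and direct sums by
  splitting a sequence into countably many sequences (\<open>slot\<close>,
  \<open>fill\<close>).\<close>

interpretation seqs2: vector_space_pair
  "scale :: 'k::field \<Rightarrow> (nat \<Rightarrow> 'k) \<Rightarrow> _" "scale :: 'k::field \<Rightarrow> (nat \<Rightarrow> 'k) \<Rightarrow> _"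
  by unfold_locales

abbreviation lin :: "((nat \<Rightarrow> 'k::field) \<Rightarrow> (nat \<Rightarrow> 'k)) \<Rightarrow> bool" where
  "lin \<equiv> Vector_Spaces.linear scale scale"

lemmas lin_add = seqs2.linear_add and lin_scale = seqs2.linear_scale
  and lin_0 = seqs2.linear_0 and lin_diff = seqs2.linear_diff

lemma linI:
  assumes "\<And>u v. f (u + v) = f u + f v" "\<And>c v. f (scale c v) = scale c (f v)"
  shows "lin f"
  by unfold_locales (rule assms)+

text \<open>Morphisms of \<open>fdVect\<close> are \<open>undefined\<close> off their domain, hence
  in general not linear on the whole sequence space. This predicate separates linearity on
  \<open>V\<close> from that normalisation, so it applies to restricted and unrestricted maps
  alike.\<close>

definition lin_on :: "(nat \<Rightarrow> 'k::field) set \<Rightarrow> (nat \<Rightarrow> 'k) set \<Rightarrow> ((nat \<Rightarrow> 'k) \<Rightarrow> (nat \<Rightarrow> 'k)) \<Rightarrow> bool"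
  where "lin_on V W f \<longleftrightarrow> (\<forall>v\<in>V. f v \<in> W) \<and> (\<forall>u\<in>V. \<forall>v\<in>V. f (u + v) = f u + f v) \<and>
    (\<forall>c. \<forall>v\<in>V. f (scale c v) = scale c (f v))"

definition fd :: "(nat \<Rightarrow> 'k::field) set \<Rightarrow> bool" where
  "fd V \<longleftrightarrow> seqs.subspace V \<and> (\<exists>B. finite B \<and> V = seqs.span B)"

lemma lin_onI:
  assumes "\<And>v. v \<in> V \<Longrightarrow> f v \<in> W" "\<And>u v. u \<in> V \<Longrightarrow> v \<in> V \<Longrightarrow> f (u + v) = f u + f v"
    "\<And>c v. v \<in> V \<Longrightarrow> f (scale c v) = scale c (f v)"
  shows "lin_on V W f"
  using assms by (auto simp: lin_on_def)

lemma lin_on_in: "lin_on V W f \<Longrightarrow> v \<in> V \<Longrightarrow> f v \<in> W"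
  and lin_on_add: "lin_on V W f \<Longrightarrow> u \<in> V \<Longrightarrow> v \<in> V \<Longrightarrow> f (u + v) = f u + f v"
  and lin_on_scale: "lin_on V W f \<Longrightarrow> v \<in> V \<Longrightarrow> f (scale c v) = scale c (f v)"
  by (auto simp: lin_on_def)

lemma fd_subspace: "fd V \<Longrightarrow> seqs.subspace V"
  by (simp add: fd_def)

lemma scale_minus_one: "scale (-1) v = - v"
  by (simp add: scale_def fun_eq_iff)

lemma lin_on_minus:
  assumes "lin_on V W f" "v \<in> V" shows "f (- v) = - f v"
  using lin_on_scale[OF assms, of "-1"] by (simp only: scale_minus_one)

lemma lin_on_diff:
  assumes "lin_on V W f" "seqs.subspace V" "u \<in> V" "v \<in> V" shows "f (u - v) = f u - f v"
  using lin_on_add[OF assms(1,3), of "- v"] lin_on_minus[OF assms(1,4)] seqs.subspace_neg[OF assms(2,4)]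
  by simp

lemma lin_on_0:
  assumes "lin_on V W f" "seqs.subspace V" shows "f 0 = 0"
  using lin_on_diff[OF assms, of 0 0] seqs.subspace_0[OF assms(2)] by simp

lemma lin_on_sum:
  assumes "lin_on V W f" "seqs.subspace V" "\<And>i. i \<in> I \<Longrightarrow> g i \<in> V"
  shows "f (sum g I) = (\<Sum>i\<in>I. f (g i))"
  using assms(3)
proof (induction I rule: infinite_finite_induct)
  case (insert x F)
  have "f (sum g (insert x F)) = f (g x + sum g F)" by (simp only: sum.insert[OF insert.hyps])
  also have "\<dots> = f (g x) + f (sum g F)"
    using insert.prems by (intro lin_on_add[OF assms(1)] seqs.subspace_sum[OF assms(2)]) auto
  also have "\<dots> = (\<Sum>i\<in>insert x F. f (g i))"
    using insert by (simp only: sum.insert[OF insert.hyps] insertI2)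
  finally show ?case .
qed (use lin_on_0[OF assms(1,2)] in auto)

lemma lin_on_cong: "(\<And>v. v \<in> V \<Longrightarrow> f v = g v) \<Longrightarrow> seqs.subspace V \<Longrightarrow> lin_on V W f = lin_on V W g"
  unfolding lin_on_def by (auto simp: seqs.subspace_add seqs.subspace_scale)

lemma lin_lin_on: "lin f \<Longrightarrow> (\<And>v. v \<in> V \<Longrightarrow> f v \<in> W) \<Longrightarrow> lin_on V W f"
  by (intro lin_onI lin_add lin_scale)

lemma lin_on_subset:
  "lin_on V W f \<Longrightarrow> U \<subseteq> V \<Longrightarrow> (\<And>v. v \<in> U \<Longrightarrow> f v \<in> T) \<Longrightarrow> lin_on U T f"
  unfolding lin_on_def by blast

lemma lin_on_comp: "lin_on U V f \<Longrightarrow> lin_on V W g \<Longrightarrow> lin_on U W (\<lambda>v. g (f v))"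
  unfolding lin_on_def by (simp add: Ball_def)

lemma lin_on_kernel:
  assumes "lin_on V W f" "seqs.subspace V" shows "seqs.subspace {v\<in>V. f v = 0}"
  using assms lin_on_0[OF assms]
  by (intro seqs.subspaceI) (auto simp: lin_on_add lin_on_scale seqs.subspace_0 seqs.subspace_add seqs.subspace_scale)

lemma lin_on_equalizer:
  assumes "lin_on V W f" "lin_on V W g" "seqs.subspace V" shows "seqs.subspace {v\<in>V. f v = g v}"
  using assms lin_on_0[OF assms(1,3)] lin_on_0[OF assms(2,3)]
  by (intro seqs.subspaceI) (auto simp: lin_on_add lin_on_scale seqs.subspace_0 seqs.subspace_add seqs.subspace_scale)

lemma lin_on_image_subspace:
  assumes "lin_on V W f" "seqs.subspace V" shows "seqs.subspace (f ` V)"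
proof (rule seqs.subspaceI)
  show "0 \<in> f ` V" using lin_on_0[OF assms] seqs.subspace_0[OF assms(2)] by (metis imageI)
  show "x + y \<in> f ` V" if xy: "x \<in> f ` V" "y \<in> f ` V" for x y
  proof -
    obtain u v where "u \<in> V" "v \<in> V" "x = f u" "y = f v" using xy by auto
    then have "x + y = f (u + v)" "u + v \<in> V"
      by (simp_all add: lin_on_add[OF assms(1)] seqs.subspace_add[OF assms(2)])
    then show ?thesis by blast
  qed
  show "scale c x \<in> f ` V" if x: "x \<in> f ` V" for c x
  proof -
    obtain u where "u \<in> V" "x = f u" using x by auto
    then have "scale c x = f (scale c u)" "scale c u \<in> V"
      by (simp_all add: lin_on_scale[OF assms(1)] seqs.subspace_scale[OF assms(2)])
    then show ?thesis by blast
  qed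
qed

text \<open>A basis of \<open>V\<close> stays independent in the whole space, so its prescribed
  values extend globally; the equalizer of both maps is a subspace containing the basis. The library
  facts on globally linear maps thus become available for maps defined on \<open>V\<close>.\<close>

lemma lin_on_extend:
  assumes "lin_on V W f" "seqs.subspace V"
  obtains g where "lin g" "\<And>v. v \<in> V \<Longrightarrow> g v = f v"
proof -
  obtain B where B: "B \<subseteq> V" "seqs.independent B" "V \<subseteq> seqs.span B"
    by (rule seqs.maximal_independent_subset)
  obtain g where g: "lin g" "\<forall>x\<in>B. g x = f x"
    using seqs2.linear_independent_extend[OF B(2)] by blast
  have "lin_on V UNIV g" "lin_on V UNIV f"
    using assms(1) by (auto simp: lin_on_def lin_add[OF g(1)] lin_scale[OF g(1)])
  then have "seqs.subspace {v\<in>V. g v = f v}" by (rule lin_on_equalizer[OF _ _ assms(2)])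
  then have "seqs.span B \<subseteq> {v\<in>V. g v = f v}"
    by (rule seqs.span_minimal[rotated]) (use g B in auto)
  then show ?thesis using that g B by blast
qed

text \<open>Extend a basis \<open>B\<close> of \<open>U\<close> to a basis \<open>C\<close> of the
  whole space, kill \<open>B\<close> and fix the rest of \<open>C\<close>. The condition
  \<open>v - g v \<in> U\<close> defines a subspace and holds on \<open>C\<close>.\<close>

lemma ex_projection_along:
  assumes "seqs.subspace U"
  shows "\<exists>\<pi>. lin \<pi> \<and> (\<forall>v. v - \<pi> v \<in> U) \<and> (\<forall>u\<in>U. \<pi> u = 0)"
proof -
  obtain B where B: "B \<subseteq> U" "seqs.independent B" "U \<subseteq> seqs.span B"
    by (rule seqs.maximal_independent_subset)
  obtain C where C: "B \<subseteq> C" "seqs.independent C" "UNIV \<subseteq> seqs.span C"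
    using seqs.maximal_independent_subset_extend[OF subset_UNIV B(2)] by metis
  obtain g where g: "lin g" "\<forall>x\<in>C. g x = (if x \<in> B then 0 else x)"
    using seqs2.linear_independent_extend[OF C(2), of "\<lambda>x. if x \<in> B then 0 else x"] by blast
  have s1: "seqs.subspace {v. v - g v \<in> U}"
  proof (rule seqs.subspaceI)
    show "x + y \<in> {v. v - g v \<in> U}" if "x \<in> {v. v - g v \<in> U}" "y \<in> {v. v - g v \<in> U}" for x y
      using seqs.subspace_add[OF assms, of "x - g x" "y - g y"] that
      by (simp add: lin_add[OF g(1)] algebra_simps)
    show "scale c x \<in> {v. v - g v \<in> U}" if "x \<in> {v. v - g v \<in> U}" for c x
      using seqs.subspace_scale[OF assms, of "x - g x" c] that
      by (simp add: lin_scale[OF g(1)] seqs.scale_right_diff_distrib)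
  qed (simp add: lin_0[OF g(1)] seqs.subspace_0[OF assms])
  have "C \<subseteq> {v. v - g v \<in> U}" using g(2) B(1) seqs.subspace_0[OF assms] by auto
  then have "seqs.span C \<subseteq> {v. v - g v \<in> U}" using s1 by (rule seqs.span_minimal)
  moreover have "g u = 0" if "u \<in> U" for u
  proof -
    have "u \<in> seqs.span B" using B that by auto
    then show ?thesis by (rule seqs2.linear_eq_0_on_span[OF g(1), rotated]) (use g C in auto)
  qed
  ultimately show ?thesis using g C by (intro exI[of _ g]) auto
qed

text \<open>A fixed projection with kernel \<open>U\<close>. For \<open>U \<subseteq> V\<close> its
  image of \<open>V\<close> is a complement of \<open>U\<close> in \<open>V\<close>, which serves as
  the quotient \<open>V / U\<close> inside the same sequence space.\<close>

definition proj :: "(nat \<Rightarrow> 'k::field) set \<Rightarrow> (nat \<Rightarrow> 'k) \<Rightarrow> (nat \<Rightarrow> 'k)" where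
  "proj U = (SOME \<pi>. lin \<pi> \<and> (\<forall>v. v - \<pi> v \<in> U) \<and> (\<forall>u\<in>U. \<pi> u = 0))"

lemma proj:
  assumes "seqs.subspace U"
  shows lin_proj: "lin (proj U)" and proj_diff: "v - proj U v \<in> U"
    and proj_zero: "u \<in> U \<Longrightarrow> proj U u = 0"
  using someI_ex[OF ex_projection_along[OF assms]] unfolding proj_def by auto

lemma proj_zero_iff:
  assumes "seqs.subspace U" shows "proj U v = 0 \<longleftrightarrow> v \<in> U"
  using proj[OF assms] by (metis diff_zero)

text \<open>The complements for \<open>U\<close> and \<open>T\<close> are chosen independently, but
  \<open>v - proj U v\<close> lies in \<open>U \<subseteq> T\<close> and is killed by
  \<open>proj T\<close>. This makes the maps \<open>V / U \<rightarrow> V / T\<close> compose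
  strictly.\<close>

lemma proj_proj:
  assumes "seqs.subspace U" "seqs.subspace T" "U \<subseteq> T"
  shows "proj T (proj U v) = proj T v"
proof -
  have "proj T (v - proj U v) = 0"
    using proj_diff[OF assms(1), of v] assms(3) by (intro proj_zero[OF assms(2)]) auto
  then show ?thesis by (simp add: lin_diff[OF lin_proj[OF assms(2)]])
qed

lemma proj_in:
  assumes "seqs.subspace U" "seqs.subspace V" "U \<subseteq> V" "v \<in> V"
  shows "proj U v \<in> V"
proof -
  have "v - (v - proj U v) \<in> V"
    by (intro seqs.subspace_diff assms subsetD[OF assms(3) proj_diff[OF assms(1)]])
  then show ?thesis by (simp only: diff_diff_eq2 add_diff_cancel_left')
qed

text \<open>A basis of \<open>U\<close> stays independent when \<open>v\<close> is adjoined; fix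
  \<open>v\<close> and kill the rest. The extension is chosen with range spanned by the prescribed
  values, which keeps it inside the line of \<open>v\<close>.\<close>

lemma ex_projection_onto_line:
  assumes "seqs.subspace U" "v \<notin> U"
  obtains g where "lin g" "g v = v" "\<And>u. u \<in> U \<Longrightarrow> g u = 0" "\<And>w. \<exists>c. g w = scale c v"
proof -
  obtain B where B: "B \<subseteq> U" "seqs.independent B" "U \<subseteq> seqs.span B"
    by (rule seqs.maximal_independent_subset)
  have "seqs.span B \<subseteq> U" using B(1) assms(1) by (rule seqs.span_minimal)
  then have v: "v \<notin> seqs.span B" using assms by auto
  then have i: "seqs.independent (insert v B)" using B by (simp add: seqs.independent_insertI)
  obtain g where g: "lin g" "\<forall>x\<in>insert v B. g x = (if x = v then v else 0)"
    "range g = seqs.span ((\<lambda>x. if x = v then v else 0) ` insert v B)"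
    using seqs2.linear_independent_extend_subspace[OF i, of "\<lambda>x. if x = v then v else 0"] by blast
  have "range g \<subseteq> seqs.span {v}"
    unfolding g(3) by (intro seqs.span_minimal) (auto intro: seqs.span_base seqs.span_zero)
  then have "\<exists>c. g w = scale c v" for w by (auto simp: seqs.span_singleton)
  moreover have "g u = 0" if "u \<in> U" for u
  proof -
    have "u \<in> seqs.span B" using B that by auto
    then show ?thesis
      by (rule seqs2.linear_eq_0_on_span[OF g(1), rotated]) (use g assms B in auto)
  qed
  ultimately show ?thesis using that g by auto
qed

section \<open>Dimension bounds through independent sets\<close>

definition rank_le :: "(nat \<Rightarrow> 'k::field) set \<Rightarrow> nat \<Rightarrow> bool" where
  "rank_le V d \<longleftrightarrow> (\<forall>T\<subseteq>V. seqs.independent T \<longrightarrow> finite T \<and> card T \<le> d)"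

lemma fd_rank_le: "fd V \<Longrightarrow> \<exists>d. rank_le V d"
proof -
  assume "fd V"
  then obtain B where "finite B" "V = seqs.span B" by (auto simp: fd_def)
  then have "rank_le V (card B)"
    unfolding rank_le_def using seqs.independent_span_bound[of B] by simp
  then show ?thesis ..
qed

lemma rank_le_fd:
  assumes "seqs.subspace V" "rank_le V d" shows "fd V"
proof -
  obtain B where "B \<subseteq> V" "seqs.independent B" "V \<subseteq> seqs.span B"
    by (rule seqs.maximal_independent_subset)
  then show ?thesis using assms seqs.span_minimal[of B V] unfolding fd_def rank_le_def by blast
qed

lemma fd_subset: "fd V \<Longrightarrow> seqs.subspace U \<Longrightarrow> U \<subseteq> V \<Longrightarrow> fd U"
  by (meson fd_rank_le rank_le_fd rank_le_def subset_trans)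

lemma fd_lin_image:
  assumes "lin f" "fd V" shows "fd (f ` V)"
proof -
  obtain B where B: "finite B" "V = seqs.span B" using assms(2) by (auto simp: fd_def)
  have "f ` V = seqs.span (f ` B)" using seqs2.linear_span_image[OF assms(1)] B by simp
  then show ?thesis using B unfolding fd_def by (metis finite_imageI seqs.subspace_span)
qed

lemma rank_le_0: "rank_le V 0 \<Longrightarrow> V \<subseteq> {0}"
proof
  fix v assume "rank_le V 0" "v \<in> V"
  then have "seqs.independent {v} \<longrightarrow> finite {v} \<and> card {v} \<le> 0"
    unfolding rank_le_def by blast
  then show "v \<in> {0}" by simp
qed

text \<open>An independent subset of \<open>H\<close> stays independent when \<open>v\<close> is
  added, so it has at least one element fewer than the bound for \<open>V\<close>.\<close>

lemma rank_le_drop: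
  assumes "seqs.subspace H" "H \<subseteq> V" "v \<in> V" "v \<notin> H" "rank_le V (Suc d)"
  shows "rank_le H d"
  unfolding rank_le_def
proof (intro allI impI)
  fix T assume T: "T \<subseteq> H" "seqs.independent T"
  have "seqs.span T \<subseteq> H" using T(1) assms(1) by (rule seqs.span_minimal)
  then have "seqs.independent (insert v T)" using T assms by (intro seqs.independent_insertI) auto
  moreover have "insert v T \<subseteq> V" "v \<notin> T" using T assms by auto
  ultimately show "finite T \<and> card T \<le> d"
    using assms(5) unfolding rank_le_def by (metis Suc_le_mono card_insert_disjoint finite_insert)
qed

lemma rank_le_inj:
  assumes "lin_on U V f" "seqs.subspace U" "\<And>u. u \<in> U \<Longrightarrow> f u = 0 \<Longrightarrow> u = 0" "rank_le V d"
  shows "rank_le U d"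
  unfolding rank_le_def
proof (intro allI impI)
  fix T assume T: "T \<subseteq> U" "seqs.independent T"
  obtain g where g: "lin g" "\<And>v. v \<in> U \<Longrightarrow> g v = f v"
    using lin_on_extend[OF assms(1,2)] by blast
  have sp: "seqs.span T \<subseteq> U" using T(1) assms(2) by (rule seqs.span_minimal)
  have "inj_on g (seqs.span T)"
  proof (rule inj_onI)
    fix x y assume xy: "x \<in> seqs.span T" "y \<in> seqs.span T" "g x = g y"
    then have "x - y \<in> U" "g (x - y) = 0"
      using sp seqs.subspace_diff[OF assms(2)] by (auto simp: lin_diff[OF g(1)])
    then show "x = y" using assms(3)[of "x - y"] g(2) by auto
  qed
  then have "seqs.independent (g ` T)" "inj_on g T"
    using seqs2.linear_independent_injective_image[OF g(1) T(2)]
    by (auto intro: inj_on_subset[OF _ seqs.span_superset])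
  moreover have "g ` T \<subseteq> V" using T g lin_on_in[OF assms(1)] by fastforce
  ultimately show "finite T \<and> card T \<le> d"
    using assms(4) unfolding rank_le_def by (metis card_image finite_imageD)
qed

text \<open>Induction on the dimension: split off a vector \<open>v\<close> by a projection
  \<open>g\<close> onto its line that maps every member of both flags into itself. Each intersection
  is then the sum of its trace on the line and its trace on the kernel of \<open>g\<close>, where
  the induction hypothesis applies.\<close>

lemma two_flags_adapted_basis:
  fixes A B :: "nat \<Rightarrow> (nat \<Rightarrow> 'k::field) set"
  assumes "seqs.subspace V" "rank_le V d"
    and "\<And>x. seqs.subspace (A x)" "\<And>x. A x \<subseteq> V" "mono A" "\<exists>x. A x = V"
    and "\<And>y. seqs.subspace (B y)" "\<And>y. B y \<subseteq> V" "mono B" "\<exists>y. B y = V"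
  shows "\<exists>E. finite E \<and> E \<subseteq> V \<and> seqs.independent E \<and>
    (\<forall>x y. A x \<inter> B y \<subseteq> seqs.span (E \<inter> A x \<inter> B y))"
  using assms
proof (induction d arbitrary: V A B)
  case 0
  then have "V \<subseteq> {0}" by (intro rank_le_0)
  then have "A x \<inter> B y \<subseteq> seqs.span {}" for x y using 0 by auto
  then show ?case by (intro exI[of _ "{}"]) (auto simp: seqs.independent_empty)
next
  case (Suc d)
  note sA = Suc.prems(3) and sB = Suc.prems(7) and mA = Suc.prems(5) and mB = Suc.prems(9)
  show ?case
  proof (cases "V = {0}")
    case True
    then have "A x \<inter> B y \<subseteq> seqs.span {}" for x y using Suc.prems by auto
    then show ?thesis by (intro exI[of _ "{}"]) (auto simp: seqs.independent_empty)
  next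
    case False
    \<comment> \<open>The vector to be split off is taken from the first nonzero intersection:
      \<open>A i\<close> is the first nonzero member of \<open>A\<close>, and \<open>B j\<close> the
      first member of \<open>B\<close> that meets it nontrivially.\<close>
    define i where "i = (LEAST x. A x \<noteq> {0})"
    define j where "j = (LEAST y. A i \<inter> B y \<noteq> {0})"
    have "\<exists>x. A x \<noteq> {0}" using Suc.prems(6) False by metis
    then have i: "A i \<noteq> {0}" unfolding i_def by (rule LeastI_ex)
    have i_least: "A x = {0}" if "x < i" for x using that not_less_Least unfolding i_def by blast
    have "\<exists>y. A i \<inter> B y \<noteq> {0}" using Suc.prems(4,10) i by (metis inf.absorb_iff1)
    then have j: "A i \<inter> B j \<noteq> {0}" unfolding j_def by (rule LeastI_ex)
    have j_least: "A i \<inter> B y = {0}" if "y < j" for y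
      using that not_less_Least unfolding j_def by blast
    have "0 \<in> A i \<inter> B j" using sA sB by (auto simp: seqs.subspace_0)
    then obtain v where v: "v \<in> A i" "v \<in> B j" "v \<noteq> 0" using j by auto
    \<comment> \<open>The member of \<open>B\<close> just before \<open>j\<close>, or zero if there
      is none. By minimality of \<open>j\<close> it meets \<open>A i\<close> only in zero, so
      \<open>v\<close> lies outside it and a projection onto the line of \<open>v\<close> may kill
      it.\<close>
    define U where "U = (if j = 0 then {0} else B (j - 1))"
    have U: "seqs.subspace U" "v \<notin> U"
      using sB j_least[of "j - 1"] v by (auto simp: U_def)
    obtain g where g: "lin g" "g v = v" "\<And>u. u \<in> U \<Longrightarrow> g u = 0" "\<And>w. \<exists>c. g w = scale c v"
      using ex_projection_onto_line[OF U] by blast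
    have gg: "g (g w) = g w" for w using g(2) g(4)[of w] lin_scale[OF g(1)] by auto
    \<comment> \<open>Members of \<open>A\<close> before \<open>i\<close> are zero, and all others
      contain \<open>v\<close> and hence the range of \<open>g\<close>. For \<open>B\<close> below,
      members before \<open>j\<close> lie in \<open>U\<close> and are killed; the others again
      contain \<open>v\<close>.\<close>
    have gA: "g w \<in> A x" if "w \<in> A x" for w x
    proof (cases "x < i")
      case True
      then show ?thesis using that i_least lin_0[OF g(1)] by auto
    next
      case False
      then have "v \<in> A x" using v monoD[OF mA, of i x] by auto
      then show ?thesis using g(4)[of w] sA by (auto simp: seqs.subspace_scale)
    qed
    have gB: "g w \<in> B y" if "w \<in> B y" for w y
    proof (cases "y < j")
      case True
      then have "y \<le> j - 1" by simp
      then have "w \<in> U" using True that monoD[OF mB, of y "j - 1"] by (auto simp: U_def)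
      then show ?thesis using g(3) sB by (auto simp: seqs.subspace_0)
    next
      case False
      then have "v \<in> B y" using v monoD[OF mB, of j y] by auto
      then show ?thesis using g(4)[of w] sB by (auto simp: seqs.subspace_scale)
    qed
    define N where "N = {w. g w = 0}"
    have N: "seqs.subspace N"
      unfolding N_def by (intro seqs.subspaceI) (auto simp: lin_0[OF g(1)] lin_add[OF g(1)] lin_scale[OF g(1)])
    define H where "H = V \<inter> N"
    have H: "seqs.subspace H" "H \<subseteq> V" using Suc.prems(1) N by (auto simp: H_def seqs.subspace_inter)
    have vV: "v \<in> V" "v \<notin> H" using v g Suc.prems(4)[of i] by (auto simp: H_def N_def)
    \<comment> \<open>The induction hypothesis is used for the traces of both flags on the kernel of
      \<open>g\<close>; they still end in the full space, which is now \<open>H\<close>.\<close>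
    have "\<exists>E. finite E \<and> E \<subseteq> H \<and> seqs.independent E \<and>
      (\<forall>x y. (A x \<inter> N) \<inter> (B y \<inter> N) \<subseteq> seqs.span (E \<inter> (A x \<inter> N) \<inter> (B y \<inter> N)))"
    proof (rule Suc.IH[of H "\<lambda>x. A x \<inter> N" "\<lambda>x. B x \<inter> N"])
      show "rank_le H d" using rank_le_drop[OF H vV Suc.prems(2)] .
      show "mono (\<lambda>x. A x \<inter> N)" "mono (\<lambda>x. B x \<inter> N)"
        by (intro monoI Int_mono monoD[OF mA] monoD[OF mB] order_refl; assumption)+
      show "\<exists>x. A x \<inter> N = H" using Suc.prems(6) by (auto simp: H_def)
      show "\<exists>x. B x \<inter> N = H" using Suc.prems(10) by (auto simp: H_def)
      show "A x \<inter> N \<subseteq> H" for x using Suc.prems(4)[of x] by (auto simp: H_def)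
      show "B x \<inter> N \<subseteq> H" for x using Suc.prems(8)[of x] by (auto simp: H_def)
    qed (intro H sA sB N seqs.subspace_inter)+
    then obtain E where E: "finite E" "E \<subseteq> H" "seqs.independent E"
      "\<And>x y. (A x \<inter> N) \<inter> (B y \<inter> N) \<subseteq> seqs.span (E \<inter> (A x \<inter> N) \<inter> (B y \<inter> N))" by blast
    have "seqs.span E \<subseteq> H" using E(2) H(1) by (rule seqs.span_minimal)
    then have ind: "seqs.independent (insert v E)"
      using E vV by (intro seqs.independent_insertI) auto
    have "w \<in> seqs.span (insert v E \<inter> A x \<inter> B y)" if w: "w \<in> A x" "w \<in> B y" for w x y
    proof -
      have "w - g w \<in> (A x \<inter> N) \<inter> (B y \<inter> N)"
        using w gA gB sA sB by (auto simp: N_def lin_diff[OF g(1)] gg intro!: seqs.subspace_diff)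
      then have "w - g w \<in> seqs.span (E \<inter> (A x \<inter> N) \<inter> (B y \<inter> N))" using E(4) by blast
      then have 1: "w - g w \<in> seqs.span (insert v E \<inter> A x \<inter> B y)"
        by (rule rev_subsetD) (intro seqs.span_mono, auto)
      obtain c where c: "g w = scale c v" using g(4) by blast
      have 2: "g w \<in> seqs.span (insert v E \<inter> A x \<inter> B y)"
      proof (cases "c = 0")
        case True
        then show ?thesis using c by (simp add: seqs.span_zero)
      next
        case False
        \<comment> \<open>Since \<open>g\<close> preserves the intersection, a nonzero component of
          \<open>w\<close> along \<open>v\<close> puts \<open>v\<close> itself into the
          intersection.\<close>
        then have "v = scale (inverse c) (g w)" by (simp add: c)
        then have "v \<in> A x \<inter> B y" using gA gB w sA sB by (metis IntI seqs.subspace_scale)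
        then show ?thesis unfolding c by (intro seqs.span_scale seqs.span_base) auto
      qed
      show ?thesis using seqs.span_add[OF 1 2] by simp
    qed
    then show ?thesis
      using ind E H vV by (intro exI[of _ "insert v E"]) auto
  qed
qed


section \<open>Equivalences with a quotient category\<close>

text \<open>By \<open>rel\<close>, the classes of morphisms are the fibres of \<open>F\<close>, and
  by fullness no fibre is empty. So hom-sets of the quotient are in bijection with those of
  \<open>D\<close>, and the category laws of the quotient are inherited from \<open>D\<close>;
  density then supplies a quasi-inverse by choice.\<close>

lemma category_quotient_equiv:
  fixes C :: "('o1, 'm1, 'x) preadd_cat_scheme" and D :: "('o2, 'm2, 'y) cat_scheme"
  assumes C: "category C" and D: "category D" and F: "is_functor C D F"
    and full: "\<And>a b g. \<lbrakk>a \<in> Obj C; b \<in> Obj C; g \<in> Hom D (fobj F a) (fobj F b)\<rbrakk>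
      \<Longrightarrow> \<exists>f\<in>Hom C a b. fmap F a b f = g"
    and dense: "\<And>d. d \<in> Obj D \<Longrightarrow> \<exists>c\<in>Obj C. isomorphic D (fobj F c) d"
    and rel: "\<And>a b. \<lbrakk>a \<in> Obj C; b \<in> Obj C\<rbrakk> \<Longrightarrow> quotient_rel C X a b =
      {(f, g). f \<in> Hom C a b \<and> g \<in> Hom C a b \<and> fmap F a b f = fmap F a b g}"
  shows "equivalent_categories (quotient_cat C X) D"
proof -
  interpret C: category C by fact
  interpret D: category D by fact
  let ?Q = "quotient_cat C X"
  have Fo: "\<And>a. a \<in> Obj C \<Longrightarrow> fobj F a \<in> Obj D"
    and Fm: "\<And>a b f. \<lbrakk>a \<in> Obj C; b \<in> Obj C; f \<in> Hom C a b\<rbrakk>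
      \<Longrightarrow> fmap F a b f \<in> Hom D (fobj F a) (fobj F b)"
    and Fi: "\<And>a. a \<in> Obj C \<Longrightarrow> fmap F a a (Ide C a) = Ide D (fobj F a)"
    and Fc: "\<And>a b c f g. \<lbrakk>a \<in> Obj C; b \<in> Obj C; c \<in> Obj C; f \<in> Hom C a b; g \<in> Hom C b c\<rbrakk>
      \<Longrightarrow> fmap F a c (Cmp C a b c g f)
        = Cmp D (fobj F a) (fobj F b) (fobj F c) (fmap F b c g) (fmap F a b f)"
    using F unfolding is_functor_def by blast+
  \<comment> \<open>The fibre of \<open>F\<close> over \<open>u\<close>. All operations of the
    quotient category are rewritten through \<open>cl\<close> into operations of
    \<open>D\<close>.\<close>
  define cl where "cl a b u = {f \<in> Hom C a b. fmap F a b f = u}" for a b u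
  have rel_image: "quotient_rel C X a b `` {f} = cl a b (fmap F a b f)"
    if "a \<in> Obj C" "b \<in> Obj C" "f \<in> Hom C a b" for a b f
    using that by (auto simp: rel cl_def)
  have Obj: "Obj ?Q = Obj C" by (simp add: quotient_cat_def)
  have Hom: "Hom ?Q a b = cl a b ` Hom D (fobj F a) (fobj F b)"
    if ab: "a \<in> Obj C" "b \<in> Obj C" for a b
  proof -
    have "Hom ?Q a b = (\<lambda>f. quotient_rel C X a b `` {f}) ` Hom C a b"
      by (auto simp: quotient_cat_def quotient_def)
    also have "\<dots> = (\<lambda>f. cl a b (fmap F a b f)) ` Hom C a b"
      by (rule image_cong) (simp_all add: rel_image ab)
    also have "\<dots> = cl a b ` fmap F a b ` Hom C a b" by (simp add: image_image)
    also have "fmap F a b ` Hom C a b = Hom D (fobj F a) (fobj F b)"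
      using full[OF ab] Fm[OF ab] by force
    finally show ?thesis .
  qed
  have Ide: "Ide ?Q a = cl a a (Ide D (fobj F a))" if "a \<in> Obj C" for a
    using that by (simp add: quotient_cat_def rel_image C.Ide_in Fi)
  have cl_ne: "\<exists>f. f \<in> cl a b u" if "a \<in> Obj C" "b \<in> Obj C" "u \<in> Hom D (fobj F a) (fobj F b)" for a b u
    using full[OF that] by (auto simp: cl_def)
  have Cmp: "Cmp ?Q a b c (cl b c v) (cl a b u) = cl a c (Cmp D (fobj F a) (fobj F b) (fobj F c) v u)"
    if abc: "a \<in> Obj C" "b \<in> Obj C" "c \<in> Obj C" and
      uv: "u \<in> Hom D (fobj F a) (fobj F b)" "v \<in> Hom D (fobj F b) (fobj F c)" for a b c u v
  proof -
    have "quotient_rel C X a c `` {Cmp C a b c g f} = cl a c (Cmp D (fobj F a) (fobj F b) (fobj F c) v u)"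
      if "g \<in> cl b c v" "f \<in> cl a b u" for f g
      using that abc by (simp add: cl_def rel_image C.Cmp_in Fc)
    then show ?thesis
      using cl_ne[OF abc(1,2) uv(1)] cl_ne[OF abc(2,3) uv(2)] by (auto simp: quotient_cat_def)
  qed
  have Qcat: "category ?Q"
  proof (unfold_locales, unfold Obj)
    show "Ide ?Q a \<in> Hom ?Q a a" if "a \<in> Obj C" for a
      using that by (auto simp: Ide Hom Fo D.Ide_in)
    show "Cmp ?Q a b c f g \<in> Hom ?Q a c"
      if "a \<in> Obj C" "b \<in> Obj C" "c \<in> Obj C" "g \<in> Hom ?Q a b" "f \<in> Hom ?Q b c" for a b c f g
      using that by (auto simp: Hom Cmp Fo D.Cmp_in)
    show "Cmp ?Q a a b f (Ide ?Q a) = f" if "a \<in> Obj C" "b \<in> Obj C" "f \<in> Hom ?Q a b" for a b f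
      using that by (auto simp: Hom Ide Cmp Fo D.Ide_in D.Cmp_Ide_right)
    show "Cmp ?Q a b b (Ide ?Q b) f = f" if "a \<in> Obj C" "b \<in> Obj C" "f \<in> Hom ?Q a b" for a b f
      using that by (auto simp: Hom Ide Cmp Fo D.Ide_in D.Cmp_Ide_left)
    show "Cmp ?Q a c d h (Cmp ?Q a b c g f) = Cmp ?Q a b d (Cmp ?Q b c d h g) f"
      if "a \<in> Obj C" "b \<in> Obj C" "c \<in> Obj C" "d \<in> Obj C"
        "f \<in> Hom ?Q a b" "g \<in> Hom ?Q b c" "h \<in> Hom ?Q c d" for a b c d f g h
      using that by (auto simp: Hom Cmp Fo D.Cmp_in D.Cmp_assoc)
  qed

  \<comment> \<open>The inverse of \<open>cl\<close>: the common image under \<open>F\<close> of all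
    members of a class. It is the action on morphisms of the functor \<open>P\<close> induced by
    \<open>F\<close>.\<close>
  define rep where "rep a b U = fmap F a b (SOME f. f \<in> U)" for a b U
  have rep: "rep a b (cl a b u) = u"
    if "a \<in> Obj C" "b \<in> Obj C" "u \<in> Hom D (fobj F a) (fobj F b)" for a b u
    using someI_ex[OF cl_ne[OF that]] by (simp add: rep_def cl_def)
  define P :: "('o1, 'm1 set, 'o2, 'm2) func" where "P = \<lparr>fobj = fobj F, fmap = rep\<rparr>"
  have P: "is_functor ?Q D P"
    unfolding is_functor_def Obj
    by (auto simp: P_def Fo Hom rep Ide Cmp D.Ide_in D.Cmp_in)

  have "\<forall>d\<in>Obj D. \<exists>c f g. c \<in> Obj C \<and> f \<in> Hom D (fobj F c) d \<and> g \<in> Hom D d (fobj F c) \<and>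
      Cmp D (fobj F c) d (fobj F c) g f = Ide D (fobj F c) \<and> Cmp D d (fobj F c) d f g = Ide D d"
    using dense unfolding isomorphic_def iso_def by blast
  then obtain w e h where w: "\<And>d. d \<in> Obj D \<Longrightarrow> w d \<in> Obj C"
    and e: "\<And>d. d \<in> Obj D \<Longrightarrow> e d \<in> Hom D (fobj F (w d)) d"
    and h: "\<And>d. d \<in> Obj D \<Longrightarrow> h d \<in> Hom D d (fobj F (w d))"
    and he: "\<And>d. d \<in> Obj D \<Longrightarrow> Cmp D (fobj F (w d)) d (fobj F (w d)) (h d) (e d) = Ide D (fobj F (w d))"
    and eh: "\<And>d. d \<in> Obj D \<Longrightarrow> Cmp D d (fobj F (w d)) d (e d) (h d) = Ide D d"
    by metis
  \<comment> \<open>Each object \<open>d\<close> of \<open>D\<close> gets a chosen preimage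
    \<open>w d\<close> with inverse isomorphisms \<open>e d\<close> and \<open>h d\<close>;
    \<open>tr\<close> conjugates a morphism by them, so that \<open>e\<close> becomes natural by
    construction.\<close>
  define tr where "tr a b u = Cmp D (fobj F (w a)) b (fobj F (w b)) (h b)
    (Cmp D (fobj F (w a)) a b u (e a))" for a b u
  have tr_in: "tr a b u \<in> Hom D (fobj F (w a)) (fobj F (w b))"
    if "a \<in> Obj D" "b \<in> Obj D" "u \<in> Hom D a b" for a b u
    using that by (auto simp: tr_def intro!: D.Cmp_in Fo w e h)
  have e_tr: "Cmp D (fobj F (w a)) (fobj F (w b)) b (e b) (tr a b u) = Cmp D (fobj F (w a)) a b u (e a)"
    if "a \<in> Obj D" "b \<in> Obj D" "u \<in> Hom D a b" for a b u
    using that unfolding tr_def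
    by (subst D.Cmp_assoc) (auto simp: eh intro!: Fo w e h D.Cmp_in D.Cmp_Ide_left)
  \<comment> \<open>The split monomorphism \<open>e b\<close> can be cancelled on the left. This
    reduces compatibility of \<open>tr\<close> with composition to the naturality equation
    \<open>e_tr\<close>.\<close>
  have e_cancel: "u = v"
    if "a \<in> Obj D" "b \<in> Obj D" "u \<in> Hom D a (fobj F (w b))" "v \<in> Hom D a (fobj F (w b))"
      "Cmp D a (fobj F (w b)) b (e b) u = Cmp D a (fobj F (w b)) b (e b) v" for a b u v
  proof -
    have "Cmp D a (fobj F (w b)) (fobj F (w b)) (Cmp D (fobj F (w b)) b (fobj F (w b)) (h b) (e b)) u
      = Cmp D a (fobj F (w b)) (fobj F (w b)) (Cmp D (fobj F (w b)) b (fobj F (w b)) (h b) (e b)) v"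
      using that by (simp add: D.Cmp_assoc[symmetric] Fo w e h)
    then show ?thesis using that by (simp add: he D.Cmp_Ide_left Fo w)
  qed
  have tr_Ide: "tr a a (Ide D a) = Ide D (fobj F (w a))" if "a \<in> Obj D" for a
    using that by (simp add: tr_def D.Cmp_Ide_left Fo w e he)
  have tr_Cmp: "tr a c (Cmp D a b c v u) = Cmp D (fobj F (w a)) (fobj F (w b)) (fobj F (w c)) (tr b c v) (tr a b u)"
    if abc: "a \<in> Obj D" "b \<in> Obj D" "c \<in> Obj D" and uv: "u \<in> Hom D a b" "v \<in> Hom D b c" for a b c u v
  proof (rule e_cancel)
    show "fobj F (w a) \<in> Obj D" "c \<in> Obj D" using abc by (auto intro: Fo w)
    show "tr a c (Cmp D a b c v u) \<in> Hom D (fobj F (w a)) (fobj F (w c))"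
      using abc uv by (intro tr_in D.Cmp_in) auto
    show "Cmp D (fobj F (w a)) (fobj F (w b)) (fobj F (w c)) (tr b c v) (tr a b u) \<in> Hom D (fobj F (w a)) (fobj F (w c))"
      using abc uv by (intro D.Cmp_in Fo w tr_in) auto
    have "Cmp D (fobj F (w a)) (fobj F (w c)) c (e c)
        (Cmp D (fobj F (w a)) (fobj F (w b)) (fobj F (w c)) (tr b c v) (tr a b u))
      = Cmp D (fobj F (w a)) (fobj F (w b)) c
          (Cmp D (fobj F (w b)) (fobj F (w c)) c (e c) (tr b c v)) (tr a b u)"
      using abc uv by (intro D.Cmp_assoc Fo w e tr_in) auto
    also have "\<dots> = Cmp D (fobj F (w a)) (fobj F (w b)) c (Cmp D (fobj F (w b)) b c v (e b)) (tr a b u)"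
      using abc uv by (simp add: e_tr)
    also have "\<dots> = Cmp D (fobj F (w a)) b c v (Cmp D (fobj F (w a)) (fobj F (w b)) b (e b) (tr a b u))"
      using abc uv by (intro D.Cmp_assoc[symmetric] Fo w e tr_in) auto
    also have "\<dots> = Cmp D (fobj F (w a)) b c v (Cmp D (fobj F (w a)) a b u (e a))"
      using abc uv by (simp add: e_tr)
    also have "\<dots> = Cmp D (fobj F (w a)) a c (Cmp D a b c v u) (e a)"
      using abc uv by (intro D.Cmp_assoc Fo w e) auto
    also have "\<dots> = Cmp D (fobj F (w a)) (fobj F (w c)) c (e c) (tr a c (Cmp D a b c v u))"
      using abc uv by (intro e_tr[symmetric] D.Cmp_in) auto
    finally show "Cmp D (fobj F (w a)) (fobj F (w c)) c (e c) (tr a c (Cmp D a b c v u)) =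
      Cmp D (fobj F (w a)) (fobj F (w c)) c (e c)
        (Cmp D (fobj F (w a)) (fobj F (w b)) (fobj F (w c)) (tr b c v) (tr a b u))" by simp
  qed
  define G :: "('o2, 'm2, 'o1, 'm1 set) func"
    where "G = \<lparr>fobj = w, fmap = (\<lambda>a b u. cl (w a) (w b) (tr a b u))\<rparr>"
  have G: "is_functor D ?Q G"
    unfolding is_functor_def Obj
    by (auto simp: G_def w Hom tr_in tr_Ide tr_Cmp Ide Cmp)
  have "nat_trans D D (comp_func P G) id_func e"
    unfolding nat_trans_def
    by (auto simp: comp_func_def id_func_def P_def G_def rep e e_tr w tr_in)
  moreover have "iso D (fobj (comp_func P G) d) (fobj id_func d) (e d)" if "d \<in> Obj D" for d
    using e[OF that] h[OF that] he[OF that] eh[OF that]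
    by (auto simp: comp_func_def id_func_def P_def G_def iso_def)
  ultimately have PG: "naturally_isomorphic D D (comp_func P G) id_func"
    unfolding naturally_isomorphic_def by blast
  \<comment> \<open>The same isomorphisms, lifted through the bijections \<open>cl\<close> to the
    quotient category.\<close>
  define \<eta> where "\<eta> a = cl (w (fobj F a)) a (e (fobj F a))" for a
  have \<eta>_nat: "nat_trans ?Q ?Q (comp_func G P) id_func \<eta>"
    unfolding nat_trans_def Obj
    by (auto simp: comp_func_def id_func_def P_def G_def rep \<eta>_def Hom w Fo e Cmp tr_in e_tr)
  have "iso ?Q (fobj (comp_func G P) a) (fobj id_func a) (\<eta> a)" if a: "a \<in> Obj C" for a
  proof -
    let ?g = "cl a (w (fobj F a)) (h (fobj F a))"
    have 1: "?g \<in> Hom ?Q a (w (fobj F a))" using a by (simp add: Hom w Fo h)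
    have 2: "Cmp ?Q (w (fobj F a)) a (w (fobj F a)) ?g (\<eta> a) = Ide ?Q (w (fobj F a))"
      using a by (simp add: \<eta>_def Cmp w Fo e h he Ide)
    have 3: "Cmp ?Q a (w (fobj F a)) a (\<eta> a) ?g = Ide ?Q a"
      using a by (simp add: \<eta>_def Cmp w Fo e h eh Ide)
    have "\<eta> a \<in> Hom ?Q (w (fobj F a)) a" using a by (simp add: \<eta>_def Hom w Fo e)
    then show ?thesis
      using 1 2 3 by (auto simp: iso_def comp_func_def id_func_def P_def G_def)
  qed
  with \<eta>_nat have "naturally_isomorphic ?Q ?Q (comp_func G P) id_func"
    unfolding naturally_isomorphic_def Obj by blast
  then show ?thesis
    unfolding equivalent_categories_def using Qcat D P G PG by blast
qed

lemma category_functor_cat: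
  fixes C :: "('o1, 'm1, 'x) cat_scheme" and D :: "('o2, 'm2, 'y) preadd_cat_scheme"
  assumes "category D" shows "category (functor_cat C D)"
proof -
  interpret D: category D by fact
  have fo: "fobj F a \<in> Obj D" if "F \<in> Obj (functor_cat C D)" "a \<in> Obj C" for F a
    using that by (auto simp: functor_cat_def is_functor_def)
  have fm: "fmap F a b f \<in> Hom D (fobj F a) (fobj F b)"
    if "F \<in> Obj (functor_cat C D)" "a \<in> Obj C" "b \<in> Obj C" "f \<in> Hom C a b" for F a b f
    using that by (auto simp: functor_cat_def is_functor_def)
  have hc: "\<eta> a \<in> Hom D (fobj F a) (fobj G a)" if "\<eta> \<in> Hom (functor_cat C D) F G" "a \<in> Obj C" for F G \<eta> a
    using that by (auto simp: functor_cat_def nat_trans_def)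
  have hn: "Cmp D (fobj F a) (fobj F b) (fobj G b) (\<eta> b) (fmap F a b f)
        = Cmp D (fobj F a) (fobj G a) (fobj G b) (fmap G a b f) (\<eta> a)"
    if "\<eta> \<in> Hom (functor_cat C D) F G" "a \<in> Obj C" "b \<in> Obj C" "f \<in> Hom C a b" for F G \<eta> a b f
    using that by (auto simp: functor_cat_def nat_trans_def)
  have he: "\<eta> \<in> extensional (Obj C)" if "\<eta> \<in> Hom (functor_cat C D) F G" for F G \<eta>
    using that by (auto simp: functor_cat_def)
  have Ide: "Ide (functor_cat C D) F = (\<lambda>a\<in>Obj C. Ide D (fobj F a))" for F
    by (simp add: functor_cat_def)
  have Cmp: "Cmp (functor_cat C D) F G H \<theta> \<eta> = (\<lambda>a\<in>Obj C. Cmp D (fobj F a) (fobj G a) (fobj H a) (\<theta> a) (\<eta> a))"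
    for F G H \<theta> \<eta> by (simp add: functor_cat_def)
  have HomI: "\<eta> \<in> Hom (functor_cat C D) F G" if "\<eta> \<in> extensional (Obj C)" "nat_trans C D F G \<eta>" for F G \<eta>
    using that by (simp add: functor_cat_def)
  show ?thesis
  proof
    fix F assume F: "F \<in> Obj (functor_cat C D)"
    show "Ide (functor_cat C D) F \<in> Hom (functor_cat C D) F F"
      unfolding Ide by (rule HomI) (auto simp: nat_trans_def D.Ide_in fo[OF F] fm[OF F] D.Cmp_Ide_left D.Cmp_Ide_right)
  next
    fix F G H f g
    assume F: "F \<in> Obj (functor_cat C D)" "G \<in> Obj (functor_cat C D)" "H \<in> Obj (functor_cat C D)"
      and fg: "f \<in> Hom (functor_cat C D) F G" "g \<in> Hom (functor_cat C D) G H"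
    note * = fo[OF F(1)] fo[OF F(2)] fo[OF F(3)] fm[OF F(1)] fm[OF F(2)] fm[OF F(3)] hc[OF fg(1)] hc[OF fg(2)]
    show "Cmp (functor_cat C D) F G H g f \<in> Hom (functor_cat C D) F H"
      unfolding Cmp
    proof (rule HomI)
      show "nat_trans C D F H (\<lambda>a\<in>Obj C. Cmp D (fobj F a) (fobj G a) (fobj H a) (g a) (f a))"
        unfolding nat_trans_def
      proof (intro conjI ballI)
        fix a b m assume ab: "a \<in> Obj C" "b \<in> Obj C" "m \<in> Hom C a b"
        have "Cmp D (fobj F a) (fobj F b) (fobj H b) (Cmp D (fobj F b) (fobj G b) (fobj H b) (g b) (f b)) (fmap F a b m)
          = Cmp D (fobj F a) (fobj G b) (fobj H b) (g b) (Cmp D (fobj F a) (fobj F b) (fobj G b) (f b) (fmap F a b m))"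
          using ab by (intro D.Cmp_assoc[symmetric] *)
        also have "\<dots> = Cmp D (fobj F a) (fobj G b) (fobj H b) (g b) (Cmp D (fobj F a) (fobj G a) (fobj G b) (fmap G a b m) (f a))"
          using ab by (simp add: hn[OF fg(1)])
        also have "\<dots> = Cmp D (fobj F a) (fobj G a) (fobj H b) (Cmp D (fobj G a) (fobj G b) (fobj H b) (g b) (fmap G a b m)) (f a)"
          using ab by (intro D.Cmp_assoc *)
        also have "\<dots> = Cmp D (fobj F a) (fobj G a) (fobj H b) (Cmp D (fobj G a) (fobj H a) (fobj H b) (fmap H a b m) (g a)) (f a)"
          using ab by (simp add: hn[OF fg(2)])
        also have "\<dots> = Cmp D (fobj F a) (fobj H a) (fobj H b) (fmap H a b m) (Cmp D (fobj F a) (fobj G a) (fobj H a) (g a) (f a))"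
          using ab by (intro D.Cmp_assoc[symmetric] *)
        finally show "Cmp D (fobj F a) (fobj F b) (fobj H b) ((\<lambda>a\<in>Obj C. Cmp D (fobj F a) (fobj G a) (fobj H a) (g a) (f a)) b) (fmap F a b m)
          = Cmp D (fobj F a) (fobj H a) (fobj H b) (fmap H a b m) ((\<lambda>a\<in>Obj C. Cmp D (fobj F a) (fobj G a) (fobj H a) (g a) (f a)) a)"
          using ab by simp
      qed (auto intro: D.Cmp_in *)
    qed simp
  next
    fix F G f assume F: "F \<in> Obj (functor_cat C D)" "G \<in> Obj (functor_cat C D)"
      and f: "f \<in> Hom (functor_cat C D) F G"
    show "Cmp (functor_cat C D) F F G f (Ide (functor_cat C D) F) = f"
      unfolding Cmp Ide using F f
      by (intro extensionalityI[OF restrict_extensional he[OF f]]) (simp add: fo hc[OF f] D.Cmp_Ide_right)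
    show "Cmp (functor_cat C D) F G G (Ide (functor_cat C D) G) f = f"
      unfolding Cmp Ide using F f
      by (intro extensionalityI[OF restrict_extensional he[OF f]]) (simp add: fo hc[OF f] D.Cmp_Ide_left)
  next
    fix F G H K f g h
    assume "F \<in> Obj (functor_cat C D)" "G \<in> Obj (functor_cat C D)" "H \<in> Obj (functor_cat C D)"
      "K \<in> Obj (functor_cat C D)" "f \<in> Hom (functor_cat C D) F G" "g \<in> Hom (functor_cat C D) G H"
      "h \<in> Hom (functor_cat C D) H K"
    then show "Cmp (functor_cat C D) F H K h (Cmp (functor_cat C D) F G H g f)
      = Cmp (functor_cat C D) F G K (Cmp (functor_cat C D) G H K h g) f"
      unfolding Cmp by (auto intro!: restrict_ext D.Cmp_assoc fo hc)
  qed
qed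

lemma category_full_subcategory: "category C \<Longrightarrow> category (full_subcategory C S)"
  by (auto simp: category_def full_subcategory_def)


section \<open>Grid representations in terms of linear maps\<close>

lemma fdVect_Obj: "V \<in> Obj (fdVect TYPE('k::field)) \<longleftrightarrow> fd V"
  by (simp add: fdVect_def fd_def)

lemma fdVect_Hom: "f \<in> Hom (fdVect TYPE('k::field)) V W \<longleftrightarrow> f \<in> extensional V \<and> lin_on V W f"
  by (auto simp: fdVect_def lin_on_def PiE_def)

lemma fdVect_Ide: "Ide (fdVect TYPE('k::field)) V = (\<lambda>v\<in>V. v)"
  and fdVect_Cmp: "Cmp (fdVect TYPE('k::field)) U V W g f = compose U g f"
  by (simp_all add: fdVect_def)

lemma lin_on_restrict: "seqs.subspace V \<Longrightarrow> lin_on V W (restrict f V) = lin_on V W f"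
  by (rule lin_on_cong) auto

lemma category_fdVect: "category (fdVect TYPE('k::field))"
proof
  fix U V W :: "(nat \<Rightarrow> 'k) set" and f g
  assume "U \<in> Obj (fdVect TYPE('k))"
  then have U: "seqs.subspace U" by (simp add: fdVect_Obj fd_subspace)
  then have "lin_on U U (\<lambda>v. v)" by (simp add: lin_on_def)
  then show "Ide (fdVect TYPE('k)) U \<in> Hom (fdVect TYPE('k)) U U"
    by (simp add: fdVect_Ide fdVect_Hom lin_on_restrict U)
  assume "f \<in> Hom (fdVect TYPE('k)) U V"
  then have f: "f \<in> extensional U" "lin_on U V f" by (auto simp: fdVect_Hom)
  show "Cmp (fdVect TYPE('k)) U U V f (Ide (fdVect TYPE('k)) U) = f"
    using f by (auto simp: fdVect_Cmp fdVect_Ide fun_eq_iff compose_def extensional_def)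
  show "Cmp (fdVect TYPE('k)) U V V (Ide (fdVect TYPE('k)) V) f = f"
    using f lin_on_in[OF f(2)] by (auto simp: fdVect_Cmp fdVect_Ide fun_eq_iff compose_def extensional_def)
  assume "g \<in> Hom (fdVect TYPE('k)) V W"
  then have "lin_on V W g" by (auto simp: fdVect_Hom)
  then have "lin_on U W (\<lambda>v. g (f v))" using f(2) by (rule lin_on_comp[rotated])
  then show "Cmp (fdVect TYPE('k)) U V W g f \<in> Hom (fdVect TYPE('k)) U W"
    by (simp add: fdVect_Cmp fdVect_Hom compose_def lin_on_restrict U)
next
  fix U V W X :: "(nat \<Rightarrow> 'k) set" and f g h
  assume "f \<in> Hom (fdVect TYPE('k)) U V" "g \<in> Hom (fdVect TYPE('k)) V W"
  then show "Cmp (fdVect TYPE('k)) U W X h (Cmp (fdVect TYPE('k)) U V W g f)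
    = Cmp (fdVect TYPE('k)) U V X (Cmp (fdVect TYPE('k)) V W X h g) f"
    by (auto simp: fdVect_Cmp fdVect_Hom compose_def fun_eq_iff lin_on_in)
qed

text \<open>If some \<open>w\<close> is missed by \<open>f\<close>, a projection onto the line of
  \<open>w\<close> that kills the image of \<open>f\<close> and the zero map agree after
  \<open>f\<close> but differ at \<open>w\<close>.\<close>

lemma epi_fdVect_iff:
  assumes "fd V" "fd W"
  shows "epi (fdVect TYPE('k::field)) V W f \<longleftrightarrow>
    f \<in> extensional V \<and> lin_on V W f \<and> f ` V = W"
proof
  assume e: "epi (fdVect TYPE('k)) V W f"
  then have f: "f \<in> extensional V" "lin_on V W f" by (auto simp: epi_def fdVect_Hom)
  have "w \<in> f ` V" if w: "w \<in> W" for w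
  proof (rule ccontr)
    assume "w \<notin> f ` V"
    then obtain g where g: "lin g" "g w = w" "\<And>u. u \<in> f ` V \<Longrightarrow> g u = 0" "\<And>x. \<exists>c. g x = scale c w"
      using ex_projection_onto_line[OF lin_on_image_subspace[OF f(2) fd_subspace[OF assms(1)]]] by blast
    have W: "seqs.subspace W" using assms(2) by (rule fd_subspace)
    have "lin_on W W g"
      using g(1)
    proof (rule lin_lin_on)
      fix v show "g v \<in> W" using g(4)[of v] w W by (auto simp: seqs.subspace_scale)
    qed
    then have 1: "restrict g W \<in> Hom (fdVect TYPE('k)) W W" by (simp add: fdVect_Hom lin_on_restrict W)
    have "lin_on W W (\<lambda>v. 0)" using W by (auto simp: lin_on_def seqs.subspace_0)
    then have 2: "restrict (\<lambda>v. 0) W \<in> Hom (fdVect TYPE('k)) W W" by (simp add: fdVect_Hom lin_on_restrict W)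
    have "compose V (restrict g W) f = compose V (restrict (\<lambda>v. 0) W) f"
      using lin_on_in[OF f(2)] g(3) by (auto simp: compose_def fun_eq_iff)
    then have "restrict g W = restrict (\<lambda>v. 0) W"
      using e assms(2) 1 2 unfolding epi_def by (auto simp: fdVect_Cmp fdVect_Obj)
    then have "g w = 0" using w by (metis restrict_apply')
    then have "w = 0" using g(2) by simp
    moreover have "0 \<in> f ` V" by (rule seqs.subspace_0[OF lin_on_image_subspace[OF f(2) fd_subspace[OF assms(1)]]])
    ultimately show False using \<open>w \<notin> f ` V\<close> by simp
  qed
  then show "f \<in> extensional V \<and> lin_on V W f \<and> f ` V = W"
    using f lin_on_in[OF f(2)] by auto
next
  assume f: "f \<in> extensional V \<and> lin_on V W f \<and> f ` V = W"
  have "g = h" if "g \<in> extensional W" "h \<in> extensional W" "compose V g f = compose V h f" for g h :: "(nat \<Rightarrow> 'k) \<Rightarrow> (nat \<Rightarrow> 'k)"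
  proof (rule extensionalityI[OF that(1,2)])
    fix w assume "w \<in> W"
    then obtain v where "v \<in> V" "w = f v" using f by auto
    then show "g w = h w" using fun_cong[OF that(3), of v] by (simp add: compose_def)
  qed
  then show "epi (fdVect TYPE('k)) V W f"
    using f unfolding epi_def by (auto simp: fdVect_Hom fdVect_Cmp)
qed

abbreviation st :: "'k grid_rep \<Rightarrow> nat \<times> nat \<Rightarrow> nat \<times> nat \<Rightarrow> (nat \<Rightarrow> 'k) \<Rightarrow> (nat \<Rightarrow> 'k)" where
  "st M p q \<equiv> fmap M p q ()"

lemma rep_Obj_iff:
  fixes M :: "'k::field grid_rep"
  shows "M \<in> Obj (rep TYPE('k) m n) \<longleftrightarrow> fobj M \<in> extensional (grid m n) \<and>
    (\<forall>p q. \<not> (p \<in> grid m n \<and> q \<in> grid m n \<and> p \<le> q) \<longrightarrow> st M p q = undefined) \<and>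
    (\<forall>p\<in>grid m n. fd (fobj M p)) \<and>
    (\<forall>p\<in>grid m n. \<forall>q\<in>grid m n. p \<le> q \<longrightarrow>
      st M p q \<in> extensional (fobj M p) \<and> lin_on (fobj M p) (fobj M q) (st M p q)) \<and>
    (\<forall>p\<in>grid m n. \<forall>v\<in>fobj M p. st M p p v = v) \<and>
    (\<forall>p\<in>grid m n. \<forall>q\<in>grid m n. \<forall>r\<in>grid m n. p \<le> q \<longrightarrow> q \<le> r \<longrightarrow>
      (\<forall>v\<in>fobj M p. st M q r (st M p q v) = st M p r v))" (is "?L \<longleftrightarrow> ?R")
proof
  assume ?L
  then have F: "is_functor (poset_cat (grid m n)) (fdVect TYPE('k)) M"
    and e1: "fobj M \<in> extensional (grid m n)"
    and e2: "\<forall>p q. \<not> (p \<in> grid m n \<and> q \<in> grid m n \<and> () \<in> Hom (poset_cat (grid m n)) p q)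
      \<longrightarrow> st M p q = undefined"
    by (simp_all add: rep_def functor_cat_def poset_cat_def)
  have e: "\<forall>p q. \<not> (p \<in> grid m n \<and> q \<in> grid m n \<and> p \<le> q) \<longrightarrow> st M p q = undefined"
  proof (intro allI impI)
    fix p q assume "\<not> (p \<in> grid m n \<and> q \<in> grid m n \<and> p \<le> q)"
    then have "\<not> (p \<in> grid m n \<and> q \<in> grid m n \<and> () \<in> Hom (poset_cat (grid m n)) p q)"
      by (cases "p \<le> q") (auto simp: poset_cat_def)
    then show "st M p q = undefined" using e2 by blast
  qed
  have Fo: "\<And>p. p \<in> grid m n \<Longrightarrow> fobj M p \<in> Obj (fdVect TYPE('k))"
    and Fm: "\<And>p q u. p \<in> grid m n \<Longrightarrow> q \<in> grid m n \<Longrightarrow> u \<in> (if p \<le> q then {()} else {})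
      \<Longrightarrow> fmap M p q u \<in> Hom (fdVect TYPE('k)) (fobj M p) (fobj M q)"
    and Fi: "\<And>p. p \<in> grid m n \<Longrightarrow> st M p p = Ide (fdVect TYPE('k)) (fobj M p)"
    and Fc: "\<And>p q r u w. p \<in> grid m n \<Longrightarrow> q \<in> grid m n \<Longrightarrow> r \<in> grid m n
      \<Longrightarrow> u \<in> (if p \<le> q then {()} else {}) \<Longrightarrow> w \<in> (if q \<le> r then {()} else {})
      \<Longrightarrow> st M p r = Cmp (fdVect TYPE('k)) (fobj M p) (fobj M q) (fobj M r) (fmap M q r w) (fmap M p q u)"
    using F unfolding is_functor_def poset_cat_def cat.select_convs by blast+
  have o: "\<forall>p\<in>grid m n. fd (fobj M p)"
    using Fo by (simp add: fdVect_Obj)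
  have h: "st M p q \<in> extensional (fobj M p) \<and> lin_on (fobj M p) (fobj M q) (st M p q)"
    if "p \<in> grid m n" "q \<in> grid m n" "p \<le> q" for p q
  proof -
    have "st M p q \<in> Hom (fdVect TYPE('k)) (fobj M p) (fobj M q)" by (rule Fm) (simp_all add: that)
    then show ?thesis by (simp add: fdVect_Hom)
  qed
  have i: "st M p p = (\<lambda>v\<in>fobj M p. v)" if "p \<in> grid m n" for p
  proof -
    have "st M p p = Ide (fdVect TYPE('k)) (fobj M p)" by (rule Fi) (rule that)
    then show ?thesis by (simp add: fdVect_Ide)
  qed
  have c: "st M p r = compose (fobj M p) (st M q r) (st M p q)"
    if "p \<in> grid m n" "q \<in> grid m n" "r \<in> grid m n" "p \<le> q" "q \<le> r" for p q r
  proof -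
    have "st M p r = Cmp (fdVect TYPE('k)) (fobj M p) (fobj M q) (fobj M r) (st M q r) (st M p q)"
      by (rule Fc) (simp_all add: that)
    then show ?thesis by (simp add: fdVect_Cmp)
  qed
  have "st M q r (st M p q v) = st M p r v"
    if "p \<in> grid m n" "q \<in> grid m n" "r \<in> grid m n" "p \<le> q" "q \<le> r" "v \<in> fobj M p" for p q r v
    using c[OF that(1-5)] that(6) by (simp add: compose_def)
  then show ?R using e1 e o h by (simp add: i)
next
  assume R: ?R
  have c: "st M p r = compose (fobj M p) (st M q r) (st M p q)"
    if "p \<in> grid m n" "q \<in> grid m n" "r \<in> grid m n" "p \<le> q" "q \<le> r" for p q r
  proof -
    have "p \<le> r" using that by (meson order_trans)
    then have "st M p r \<in> extensional (fobj M p)" using R that by blast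
    then show ?thesis
      by (rule extensionalityI[OF _ compose_extensional]) (use R that in \<open>simp add: compose_def\<close>)
  qed
  have i: "st M p p = (\<lambda>v\<in>fobj M p. v)" if "p \<in> grid m n" for p
    by (rule extensionalityI[OF _ restrict_extensional]) (use R that in auto)
  have "is_functor (poset_cat (grid m n)) (fdVect TYPE('k)) M"
    unfolding is_functor_def poset_cat_def cat.select_convs
  proof (intro conjI ballI)
    fix p assume p: "p \<in> grid m n"
    then show "fobj M p \<in> Obj (fdVect TYPE('k))" using R by (simp add: fdVect_Obj)
    show "st M p p = Ide (fdVect TYPE('k)) (fobj M p)" using i[OF p] by (simp add: fdVect_Ide)
  next
    fix p q and u :: unit
    assume "p \<in> grid m n" "q \<in> grid m n" "u \<in> (if p \<le> q then {()} else {})"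
    then show "fmap M p q u \<in> Hom (fdVect TYPE('k)) (fobj M p) (fobj M q)"
      using R by (simp add: fdVect_Hom split: if_splits)
  next
    fix p q r and u w :: unit
    assume *: "p \<in> grid m n" "q \<in> grid m n" "r \<in> grid m n" "u \<in> (if p \<le> q then {()} else {})"
      "w \<in> (if q \<le> r then {()} else {})"
    then have "p \<le> q" "q \<le> r" by (auto split: if_splits)
    then show "st M p r = Cmp (fdVect TYPE('k)) (fobj M p) (fobj M q) (fobj M r) (fmap M q r w) (fmap M p q u)"
      using c[of p q r] * by (simp add: fdVect_Cmp)
  qed
  moreover have "fmap M p q u = undefined"
    if "\<not> (p \<in> grid m n \<and> q \<in> grid m n \<and> u \<in> Hom (poset_cat (grid m n)) p q)" for p q u
  proof -
    have "\<not> (p \<in> grid m n \<and> q \<in> grid m n \<and> p \<le> q)"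
      using that by (cases "p \<le> q") (auto simp: poset_cat_def)
    moreover have "\<forall>p q. \<not> (p \<in> grid m n \<and> q \<in> grid m n \<and> p \<le> q) \<longrightarrow> st M p q = undefined"
      using R by (elim conjE)
    ultimately have "st M p q = undefined" by blast
    then show ?thesis by simp
  qed
  ultimately show ?L
    using R by (simp add: rep_def functor_cat_def) (simp add: poset_cat_def)
qed

lemma rep_fd: "M \<in> Obj (rep TYPE('k::field) m n) \<Longrightarrow> p \<in> grid m n \<Longrightarrow> fd (fobj M p)"
  by (auto simp: rep_Obj_iff)

lemma rep_subspace: "M \<in> Obj (rep TYPE('k::field) m n) \<Longrightarrow> p \<in> grid m n \<Longrightarrow> seqs.subspace (fobj M p)"
  by (simp add: rep_fd fd_subspace)

lemma rep_st_lin: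
  "M \<in> Obj (rep TYPE('k::field) m n) \<Longrightarrow> p \<in> grid m n \<Longrightarrow> q \<in> grid m n \<Longrightarrow> p \<le> q
    \<Longrightarrow> lin_on (fobj M p) (fobj M q) (st M p q)"
  by (auto simp: rep_Obj_iff)

lemma rep_st_id: "M \<in> Obj (rep TYPE('k::field) m n) \<Longrightarrow> p \<in> grid m n \<Longrightarrow> v \<in> fobj M p \<Longrightarrow> st M p p v = v"
  by (auto simp: rep_Obj_iff)

lemma rep_st_st:
  "M \<in> Obj (rep TYPE('k::field) m n) \<Longrightarrow> p \<in> grid m n \<Longrightarrow> q \<in> grid m n \<Longrightarrow> r \<in> grid m n
    \<Longrightarrow> p \<le> q \<Longrightarrow> q \<le> r \<Longrightarrow> v \<in> fobj M p \<Longrightarrow> st M q r (st M p q v) = st M p r v"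
  by (auto simp: rep_Obj_iff)

text \<open>Adds the normalisation required of objects in the functor category, so that spaces and
  structure maps may be given by arbitrary total functions.\<close>

definition mk_rep :: "nat \<Rightarrow> nat \<Rightarrow> (nat \<times> nat \<Rightarrow> (nat \<Rightarrow> 'k::field) set)
    \<Rightarrow> (nat \<times> nat \<Rightarrow> nat \<times> nat \<Rightarrow> (nat \<Rightarrow> 'k) \<Rightarrow> (nat \<Rightarrow> 'k)) \<Rightarrow> 'k grid_rep" where
  "mk_rep m n S t = \<lparr>fobj = (\<lambda>p\<in>grid m n. S p),
    fmap = (\<lambda>p q u. if p \<in> grid m n \<and> q \<in> grid m n \<and> p \<le> q then restrict (t p q) (S p) else undefined)\<rparr>"

lemma fobj_mk_rep: "p \<in> grid m n \<Longrightarrow> fobj (mk_rep m n S t) p = S p"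
  by (simp add: mk_rep_def)

lemma st_mk_rep:
  "p \<in> grid m n \<Longrightarrow> q \<in> grid m n \<Longrightarrow> p \<le> q \<Longrightarrow> v \<in> S p \<Longrightarrow> st (mk_rep m n S t) p q v = t p q v"
  by (simp add: mk_rep_def)

lemma mk_rep_Obj:
  assumes "\<And>p. p \<in> grid m n \<Longrightarrow> fd (S p)"
    and "\<And>p q. p \<in> grid m n \<Longrightarrow> q \<in> grid m n \<Longrightarrow> p \<le> q \<Longrightarrow> lin_on (S p) (S q) (t p q)"
    and "\<And>p v. p \<in> grid m n \<Longrightarrow> v \<in> S p \<Longrightarrow> t p p v = v"
    and "\<And>p q r v. p \<in> grid m n \<Longrightarrow> q \<in> grid m n \<Longrightarrow> r \<in> grid m n \<Longrightarrow> p \<le> q \<Longrightarrow> q \<le> r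
      \<Longrightarrow> v \<in> S p \<Longrightarrow> t q r (t p q v) = t p r v"
  shows "mk_rep m n S t \<in> Obj (rep TYPE('k::field) m n)"
proof -
  have "t p q v \<in> S q" if "p \<in> grid m n" "q \<in> grid m n" "p \<le> q" "v \<in> S p" for p q v
    using assms(2)[OF that(1-3)] that(4) by (rule lin_on_in)
  moreover have "p \<le> r" if "p \<le> q" "q \<le> r" for p q r :: "nat \<times> nat"
    using that by (rule order_trans)
  ultimately show ?thesis
    unfolding rep_Obj_iff
    by (auto simp: mk_rep_def assms lin_on_restrict fd_subspace)
qed

lemma rep_Hom_iff:
  fixes M N :: "'k::field grid_rep"
  shows "\<eta> \<in> Hom (rep TYPE('k) m n) M N \<longleftrightarrow> \<eta> \<in> extensional (grid m n) \<and>
    (\<forall>p\<in>grid m n. \<eta> p \<in> extensional (fobj M p) \<and> lin_on (fobj M p) (fobj N p) (\<eta> p)) \<and>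
    (\<forall>p\<in>grid m n. \<forall>q\<in>grid m n. p \<le> q \<longrightarrow> (\<forall>v\<in>fobj M p. \<eta> q (st M p q v) = st N p q (\<eta> p v)))"
proof -
  have "compose (fobj M p) (\<eta> q) (st M p q) = compose (fobj M p) (st N p q) (\<eta> p) \<longleftrightarrow>
    (\<forall>v\<in>fobj M p. \<eta> q (st M p q v) = st N p q (\<eta> p v))" for p q
    by (auto simp: compose_def fun_eq_iff)
  then show ?thesis
    by (auto simp: rep_def functor_cat_def poset_cat_def nat_trans_def fdVect_Cmp fdVect_Hom)
qed

lemma hom_lin: "\<eta> \<in> Hom (rep TYPE('k::field) m n) M N \<Longrightarrow> p \<in> grid m n \<Longrightarrow> lin_on (fobj M p) (fobj N p) (\<eta> p)"
  by (simp add: rep_Hom_iff)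

lemma hom_natural:
  "\<eta> \<in> Hom (rep TYPE('k::field) m n) M N \<Longrightarrow> p \<in> grid m n \<Longrightarrow> q \<in> grid m n \<Longrightarrow> p \<le> q
    \<Longrightarrow> v \<in> fobj M p \<Longrightarrow> \<eta> q (st M p q v) = st N p q (\<eta> p v)"
  by (simp add: rep_Hom_iff)

lemma hom_eqI:
  assumes "\<eta> \<in> Hom (rep TYPE('k::field) m n) M N" "\<theta> \<in> Hom (rep TYPE('k::field) m n) M N'"
    and "\<And>p v. p \<in> grid m n \<Longrightarrow> v \<in> fobj M p \<Longrightarrow> \<eta> p v = \<theta> p v"
  shows "\<eta> = \<theta>"
proof (rule extensionalityI[of _ "grid m n"])
  fix p assume p: "p \<in> grid m n"
  show "\<eta> p = \<theta> p"
    by (rule extensionalityI[of _ "fobj M p"]) (use assms p in \<open>auto simp: rep_Hom_iff\<close>)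
qed (use assms in \<open>auto simp: rep_Hom_iff\<close>)

definition mk_hom :: "nat \<Rightarrow> nat \<Rightarrow> 'k grid_rep \<Rightarrow> (nat \<times> nat \<Rightarrow> (nat \<Rightarrow> 'k) \<Rightarrow> (nat \<Rightarrow> 'k))
    \<Rightarrow> nat \<times> nat \<Rightarrow> (nat \<Rightarrow> 'k::field) \<Rightarrow> (nat \<Rightarrow> 'k)" where
  "mk_hom m n M h = (\<lambda>p\<in>grid m n. restrict (h p) (fobj M p))"

lemma mk_hom_apply: "p \<in> grid m n \<Longrightarrow> v \<in> fobj M p \<Longrightarrow> mk_hom m n M h p v = h p v"
  by (simp add: mk_hom_def)

lemma mk_hom_Hom:
  assumes M: "M \<in> Obj (rep TYPE('k::field) m n)"
    and "\<And>p. p \<in> grid m n \<Longrightarrow> lin_on (fobj M p) (fobj N p) (h p)"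
    and "\<And>p q v. p \<in> grid m n \<Longrightarrow> q \<in> grid m n \<Longrightarrow> p \<le> q \<Longrightarrow> v \<in> fobj M p
      \<Longrightarrow> h q (st M p q v) = st N p q (h p v)"
  shows "mk_hom m n M h \<in> Hom (rep TYPE('k) m n) M N"
  using assms(2,3) lin_on_in[OF rep_st_lin[OF M]]
  by (auto simp: rep_Hom_iff mk_hom_def lin_on_restrict rep_subspace[OF M])

lemma rep_Ide: "Ide (rep TYPE('k::field) m n) M = mk_hom m n M (\<lambda>p v. v)"
  and rep_Cmp: "Cmp (rep TYPE('k::field) m n) M N L \<theta> \<eta> = mk_hom m n M (\<lambda>p v. \<theta> p (\<eta> p v))"
  and rep_Add: "Add (rep TYPE('k::field) m n) M N \<eta> \<theta> = mk_hom m n M (\<lambda>p v. \<eta> p v + \<theta> p v)"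
  and rep_Zero: "Zero (rep TYPE('k::field) m n) M N = mk_hom m n M (\<lambda>p v. 0)"
  and rep_Neg: "Neg (rep TYPE('k::field) m n) M N \<eta> = mk_hom m n M (\<lambda>p v. - \<eta> p v)"
  by (simp_all add: mk_hom_def rep_def functor_cat_def poset_cat_def fdVect_def compose_def)

lemma category_rep: "category (rep TYPE('k::field) m n)"
  unfolding rep_def by (intro category_functor_cat category_fdVect)

text \<open>The pointwise inverse is automatically linear and natural: apply the injective map
  \<open>\<eta> p\<close> to both sides of each equation.\<close>

lemma isomorphic_rep:
  assumes M: "M \<in> Obj (rep TYPE('k::field) m n)" and N: "N \<in> Obj (rep TYPE('k::field) m n)"
    and \<eta>: "\<eta> \<in> Hom (rep TYPE('k) m n) M N"
    and bij: "\<And>p. p \<in> grid m n \<Longrightarrow> bij_betw (\<eta> p) (fobj M p) (fobj N p)"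
  shows "isomorphic (rep TYPE('k) m n) M N"
proof -
  define h where "h p = inv_into (fobj M p) (\<eta> p)" for p
  have h: "h p w \<in> fobj M p" "\<eta> p (h p w) = w" if "p \<in> grid m n" "w \<in> fobj N p" for p w
    using bij[OF that(1)] that(2) unfolding h_def
    by (auto simp: bij_betw_def inv_into_into f_inv_into_f)
  have h': "h p (\<eta> p v) = v" if "p \<in> grid m n" "v \<in> fobj M p" for p v
    using bij[OF that(1)] that(2) unfolding h_def by (simp add: bij_betw_def)
  have inj: "u = v" if "p \<in> grid m n" "u \<in> fobj M p" "v \<in> fobj M p" "\<eta> p u = \<eta> p v" for p u v
    using bij[OF that(1)] that(2-) by (auto simp: bij_betw_def dest: inj_onD)
  have hH: "mk_hom m n N h \<in> Hom (rep TYPE('k) m n) N M"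
  proof (rule mk_hom_Hom[OF N])
    fix p assume p: "p \<in> grid m n"
    note l = hom_lin[OF \<eta> p] and sM = rep_subspace[OF M p] and sN = rep_subspace[OF N p]
    show "lin_on (fobj N p) (fobj M p) (h p)"
    proof (rule lin_onI)
      fix u v assume uv: "u \<in> fobj N p" "v \<in> fobj N p"
      show "h p (u + v) = h p u + h p v"
        by (rule inj[OF p]) (simp_all only: lin_on_add[OF l] h p uv seqs.subspace_add[OF sM] seqs.subspace_add[OF sN])
    next
      fix c v assume v: "v \<in> fobj N p"
      show "h p (scale c v) = scale c (h p v)"
        by (rule inj[OF p]) (simp_all only: lin_on_scale[OF l] h p v seqs.subspace_scale[OF sM] seqs.subspace_scale[OF sN])
    qed (simp add: h p)
  next
    fix p q v assume pq: "p \<in> grid m n" "q \<in> grid m n" "p \<le> q" and v: "v \<in> fobj N p"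
    have 1: "st N p q v \<in> fobj N q" using lin_on_in[OF rep_st_lin[OF N pq] v] .
    have 2: "st M p q (h p v) \<in> fobj M q" using lin_on_in[OF rep_st_lin[OF M pq]] h v pq by auto
    have "\<eta> q (st M p q (h p v)) = st N p q v"
      using hom_natural[OF \<eta> pq] h pq v by auto
    then show "h q (st N p q v) = st M p q (h p v)"
      using h'[OF pq(2) 2] by simp
  qed
  have "mk_hom m n M (\<lambda>p v. mk_hom m n N h p (\<eta> p v)) = mk_hom m n M (\<lambda>p v. v)"
    using lin_on_in[OF hom_lin[OF \<eta>]]
    by (auto simp: mk_hom_def fun_eq_iff restrict_def h')
  moreover have "mk_hom m n N (\<lambda>p v. \<eta> p (mk_hom m n N h p v)) = mk_hom m n N (\<lambda>p v. v)"
    by (auto simp: mk_hom_def fun_eq_iff restrict_def h)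
  ultimately show ?thesis
    unfolding isomorphic_def iso_def using \<eta> hH by (auto simp: rep_Cmp rep_Ide)
qed

lemma rep_ee_simps:
  "Hom (rep_ee k m n) = Hom (rep k m n)" "Ide (rep_ee k m n) = Ide (rep k m n)"
  "Cmp (rep_ee k m n) = Cmp (rep k m n)" "Add (rep_ee k m n) = Add (rep k m n)"
  "Zero (rep_ee k m n) = Zero (rep k m n)" "Neg (rep_ee k m n) = Neg (rep k m n)"
  by (simp_all add: rep_ee_def full_subcategory_def)

lemma category_rep_ee: "category (rep_ee TYPE('k::field) m n)"
  unfolding rep_ee_def by (intro category_full_subcategory category_rep)

text \<open>The definition asks for epimorphisms along rows and columns only. A general step from
  \<open>(x, y)\<close> to \<open>(x', y')\<close> is the composite of a row step to
  \<open>(x', y)\<close> and a column step.\<close>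

lemma rep_ee_Obj_iff:
  fixes M :: "'k::field grid_rep"
  shows "M \<in> Obj (rep_ee TYPE('k) m n) \<longleftrightarrow> M \<in> Obj (rep TYPE('k) m n) \<and>
    (\<forall>p\<in>grid m n. \<forall>q\<in>grid m n. p \<le> q \<longrightarrow> st M p q ` fobj M p = fobj M q)"
proof (cases "M \<in> Obj (rep TYPE('k) m n)")
  case M: True
  have e: "epi (fdVect TYPE('k)) (fobj M p) (fobj M q) (st M p q) \<longleftrightarrow> st M p q ` fobj M p = fobj M q"
    if "p \<in> grid m n" "q \<in> grid m n" "p \<le> q" for p q
    using M that by (subst epi_fdVect_iff) (auto simp: rep_Obj_iff)
  have two_steps: "st M (x, y) (x', y') ` fobj M (x, y) = fobj M (x', y')"
    if r: "\<And>x x' y. \<lbrakk>(x, y) \<in> grid m n; (x', y) \<in> grid m n; x \<le> x'\<rbrakk>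
        \<Longrightarrow> st M (x, y) (x', y) ` fobj M (x, y) = fobj M (x', y)"
      "\<And>x y y'. \<lbrakk>(x, y) \<in> grid m n; (x, y') \<in> grid m n; y \<le> y'\<rbrakk>
        \<Longrightarrow> st M (x, y) (x, y') ` fobj M (x, y) = fobj M (x, y')"
      and g: "(x, y) \<in> grid m n" "(x', y') \<in> grid m n" "(x, y) \<le> (x', y')" for x y x' y'
  proof -
    have g': "(x', y) \<in> grid m n" "x \<le> x'" "y \<le> y'" using g by (auto simp: grid_def)
    have "fobj M (x', y') = st M (x', y) (x', y') ` st M (x, y) (x', y) ` fobj M (x, y)"
      using r g g' by simp
    also have "\<dots> = st M (x, y) (x', y') ` fobj M (x, y)"
      unfolding image_image using rep_st_st[OF M g(1) g'(1) g(2)] g' by simp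
    finally show ?thesis by simp
  qed
  have "st M (x, y) (x', y') ` fobj M (x, y) = fobj M (x', y')"
    if E: "M \<in> Obj (rep_ee TYPE('k) m n)"
      and g: "(x, y) \<in> grid m n" "(x', y') \<in> grid m n" "(x, y) \<le> (x', y')" for x y x' y'
  proof (rule two_steps[OF _ _ g])
    fix x x' y assume "(x, y) \<in> grid m n" "(x', y) \<in> grid m n" "x \<le> x'"
    moreover from this have "epi (fdVect TYPE('k)) (fobj M (x, y)) (fobj M (x', y)) (st M (x, y) (x', y))"
      using E by (simp only: rep_ee_def full_subcategory_def) simp
    ultimately show "st M (x, y) (x', y) ` fobj M (x, y) = fobj M (x', y)" using e by simp
  next
    fix x y y' assume "(x, y) \<in> grid m n" "(x, y') \<in> grid m n" "y \<le> y'"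
    moreover from this have "epi (fdVect TYPE('k)) (fobj M (x, y)) (fobj M (x, y')) (st M (x, y) (x, y'))"
      using E by (simp only: rep_ee_def full_subcategory_def) simp
    ultimately show "st M (x, y) (x, y') ` fobj M (x, y) = fobj M (x, y')" using e by simp
  qed
  moreover have "M \<in> Obj (rep_ee TYPE('k) m n)"
    if s: "\<forall>p\<in>grid m n. \<forall>q\<in>grid m n. p \<le> q \<longrightarrow> st M p q ` fobj M p = fobj M q"
  proof -
    have "epi (fdVect TYPE('k)) (fobj M p) (fobj M q) (st M p q)"
      if "p \<in> grid m n" "q \<in> grid m n" "p \<le> q" for p q
      unfolding e[OF that] using s that by blast
    then show ?thesis using M by (simp add: rep_ee_def full_subcategory_def)
  qed
  ultimately show ?thesis using M by (metis surj_pair)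
qed (simp add: rep_ee_def full_subcategory_def)


section \<open>Cores and filtrations\<close>

definition corner :: "nat \<times> nat" where "corner = (1, 1)"

lemma corner_le: "p \<in> grid m n \<Longrightarrow> corner \<le> p"
  by (auto simp: corner_def grid_def)

definition ker :: "'k grid_rep \<Rightarrow> nat \<times> nat \<Rightarrow> (nat \<Rightarrow> 'k::field) set" where
  "ker M p = {v \<in> fobj M corner. st M corner p v = 0}"

definition core :: "nat \<Rightarrow> nat \<Rightarrow> 'k grid_rep \<Rightarrow> nat \<times> nat \<Rightarrow> (nat \<Rightarrow> 'k::field) set" where
  "core m n M p = {v \<in> fobj M p. st M p (m, snd p) v = 0 \<and> st M p (fst p, n) v = 0}"

lemma rep_ee_rep: "M \<in> Obj (rep_ee TYPE('k::field) m n) \<Longrightarrow> M \<in> Obj (rep TYPE('k) m n)"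
  by (simp add: rep_ee_Obj_iff)

lemma rep_ee_surj:
  "M \<in> Obj (rep_ee TYPE('k::field) m n) \<Longrightarrow> p \<in> grid m n \<Longrightarrow> q \<in> grid m n \<Longrightarrow> p \<le> q
    \<Longrightarrow> st M p q ` fobj M p = fobj M q"
  by (simp add: rep_ee_Obj_iff)

lemma edge_grid:
  assumes "p \<in> grid m n"
  shows "(m, snd p) \<in> grid m n" "(fst p, n) \<in> grid m n" "p \<le> (m, snd p)" "p \<le> (fst p, n)"
  using assms by (auto simp: grid_def less_eq_prod_def)

lemma core_subset: "core m n M p \<subseteq> fobj M p"
  by (auto simp: core_def)

lemma core_subspace:
  assumes "M \<in> Obj (rep TYPE('k::field) m n)" "p \<in> grid m n"
  shows "seqs.subspace (core m n M p)"
proof -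
  have "core m n M p = {v \<in> fobj M p. st M p (m, snd p) v = 0} \<inter> {v \<in> fobj M p. st M p (fst p, n) v = 0}"
    by (auto simp: core_def)
  then show ?thesis
    using lin_on_kernel[OF rep_st_lin[OF assms(1,2)] rep_subspace[OF assms]] edge_grid[OF assms(2)]
    by (simp add: seqs.subspace_inter)
qed

text \<open>The map from \<open>p\<close> to the end of the row through \<open>q\<close> also
  factors through the end of the row through \<open>p\<close>, where an element of the core has
  already died; likewise for columns.\<close>

lemma core_st:
  assumes M: "M \<in> Obj (rep TYPE('k::field) m n)" and pq: "p \<in> grid m n" "q \<in> grid m n" "p \<le> q"
    and v: "v \<in> core m n M p"
  shows "st M p q v \<in> core m n M q"
proof -
  have v': "v \<in> fobj M p" "st M p (m, snd p) v = 0" "st M p (fst p, n) v = 0"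
    using v by (auto simp: core_def)
  have le: "(m, snd p) \<le> (m, snd q)" "(fst p, n) \<le> (fst q, n)"
    using pq(3) by (auto simp: less_eq_prod_def)
  note ep = edge_grid[OF pq(1)] and eq = edge_grid[OF pq(2)]
  have "st M q (m, snd q) (st M p q v) = st M p (m, snd q) v"
    by (rule rep_st_st[OF M pq(1,2) eq(1) pq(3) eq(3) v'(1)])
  also have "\<dots> = st M (m, snd p) (m, snd q) (st M p (m, snd p) v)"
    by (rule rep_st_st[OF M pq(1) ep(1) eq(1) ep(3) le(1) v'(1), symmetric])
  also have "\<dots> = 0"
    unfolding v' by (rule lin_on_0[OF rep_st_lin[OF M ep(1) eq(1) le(1)] rep_subspace[OF M ep(1)]])
  finally have 1: "st M q (m, snd q) (st M p q v) = 0" .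
  have "st M q (fst q, n) (st M p q v) = st M p (fst q, n) v"
    by (rule rep_st_st[OF M pq(1,2) eq(2) pq(3) eq(4) v'(1)])
  also have "\<dots> = st M (fst p, n) (fst q, n) (st M p (fst p, n) v)"
    by (rule rep_st_st[OF M pq(1) ep(2) eq(2) ep(4) le(2) v'(1), symmetric])
  also have "\<dots> = 0"
    unfolding v' by (rule lin_on_0[OF rep_st_lin[OF M ep(2) eq(2) le(2)] rep_subspace[OF M ep(2)]])
  finally have 2: "st M q (fst q, n) (st M p q v) = 0" .
  show ?thesis using 1 2 lin_on_in[OF rep_st_lin[OF M pq] v'(1)] by (simp add: core_def)
qed

text \<open>On an edge, one of the two maps that must kill a core element is the identity.\<close>

lemma core_edge:
  assumes M: "M \<in> Obj (rep TYPE('k::field) m n)" and p: "p \<in> grid m n" "fst p = m \<or> snd p = n"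
  shows "core m n M p = {0}"
proof -
  have "p = (m, snd p) \<or> p = (fst p, n)" using p(2) by (metis prod.collapse)
  then have "v = 0" if "v \<in> core m n M p" for v
    using that rep_st_id[OF M p(1)] by (auto simp: core_def)
  then show ?thesis using seqs.subspace_0[OF core_subspace[OF M p(1)]] by blast
qed

lemma core_hom:
  assumes M: "M \<in> Obj (rep TYPE('k::field) m n)" and N: "N \<in> Obj (rep TYPE('k) m n)"
    and \<eta>: "\<eta> \<in> Hom (rep TYPE('k) m n) M N"
    and p: "p \<in> grid m n" and v: "v \<in> core m n M p"
  shows "\<eta> p v \<in> core m n N p"
proof -
  note e = edge_grid[OF p]
  have v': "v \<in> fobj M p" "st M p (m, snd p) v = 0" "st M p (fst p, n) v = 0"
    using v by (auto simp: core_def)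
  have "\<eta> q 0 = 0" if "q \<in> grid m n" for q
    by (rule lin_on_0[OF hom_lin[OF \<eta> that] rep_subspace[OF M that]])
  then show ?thesis
    using hom_natural[OF \<eta> p e(1,3) v'(1)] hom_natural[OF \<eta> p e(2,4) v'(1)] v' e
      lin_on_in[OF hom_lin[OF \<eta> p] v'(1)] by (simp add: core_def)
qed

text \<open>The smaller grid sits in the larger one without a shift of coordinates, as the points
  off the edges \<open>x = m\<close> and \<open>y = n\<close>. Forgetting the edges loses nothing,
  since the core is zero there.\<close>

definition core_func :: "nat \<Rightarrow> nat \<Rightarrow> ('k grid_rep, nat \<times> nat \<Rightarrow> (nat \<Rightarrow> 'k) \<Rightarrow> (nat \<Rightarrow> 'k),
    'k grid_rep, nat \<times> nat \<Rightarrow> (nat \<Rightarrow> 'k) \<Rightarrow> (nat \<Rightarrow> 'k::field)) func" where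
  "core_func m n = \<lparr>fobj = (\<lambda>M. mk_rep (m - 1) (n - 1) (core m n M) (\<lambda>p q. st M p q)),
    fmap = (\<lambda>M N \<eta>. mk_hom (m - 1) (n - 1) (mk_rep (m - 1) (n - 1) (core m n M) (\<lambda>p q. st M p q)) \<eta>)\<rparr>"

lemma inner_grid_iff:
  "p \<in> grid (m - 1) (n - 1) \<longleftrightarrow> p \<in> grid m n \<and> fst p \<noteq> m \<and> snd p \<noteq> n"
  by (cases p) (auto simp: grid_def)

lemma inner_grid: "p \<in> grid (m - 1) (n - 1) \<Longrightarrow> p \<in> grid m n"
  by (simp only: inner_grid_iff)

lemma fobj_core_func: "p \<in> grid (m - 1) (n - 1) \<Longrightarrow> fobj (fobj (core_func m n) M) p = core m n M p"
  by (simp only: core_func_def func.select_convs fobj_mk_rep)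

lemma st_core_func:
  "p \<in> grid (m - 1) (n - 1) \<Longrightarrow> q \<in> grid (m - 1) (n - 1) \<Longrightarrow> p \<le> q \<Longrightarrow> v \<in> core m n M p
    \<Longrightarrow> st (fobj (core_func m n) M) p q v = st M p q v"
  unfolding core_func_def func.select_convs by (rule st_mk_rep)

lemma fmap_core_func:
  "p \<in> grid (m - 1) (n - 1) \<Longrightarrow> v \<in> core m n M p \<Longrightarrow> fmap (core_func m n) M N \<eta> p v = \<eta> p v"
  unfolding core_func_def func.select_convs by (rule mk_hom_apply) (simp_all only: fobj_mk_rep)

lemma core_func_Obj:
  assumes M: "M \<in> Obj (rep TYPE('k::field) m n)"
  shows "fobj (core_func m n) M \<in> Obj (rep TYPE('k) (m - 1) (n - 1))"
  unfolding core_func_def func.select_convs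
proof (rule mk_rep_Obj)
  show "fd (core m n M p)" if "p \<in> grid (m - 1) (n - 1)" for p
    by (rule fd_subset[OF rep_fd[OF M inner_grid[OF that]] core_subspace[OF M inner_grid[OF that]] core_subset])
  show "lin_on (core m n M p) (core m n M q) (st M p q)"
    if "p \<in> grid (m - 1) (n - 1)" "q \<in> grid (m - 1) (n - 1)" "p \<le> q" for p q
    using core_st[OF M inner_grid[OF that(1)] inner_grid[OF that(2)] that(3)]
    by (rule lin_on_subset[OF rep_st_lin[OF M inner_grid[OF that(1)] inner_grid[OF that(2)] that(3)] core_subset])
  show "st M p p v = v" if "p \<in> grid (m - 1) (n - 1)" "v \<in> core m n M p" for p v
    using rep_st_id[OF M inner_grid[OF that(1)]] that(2) core_subset by blast
  show "st M q r (st M p q v) = st M p r v"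
    if "p \<in> grid (m - 1) (n - 1)" "q \<in> grid (m - 1) (n - 1)" "r \<in> grid (m - 1) (n - 1)"
      "p \<le> q" "q \<le> r" "v \<in> core m n M p" for p q r v
    using rep_st_st[OF M inner_grid[OF that(1)] inner_grid[OF that(2)] inner_grid[OF that(3)] that(4,5)]
      that(6) core_subset by blast
qed

lemma core_func_Hom:
  assumes M: "M \<in> Obj (rep TYPE('k::field) m n)" and N: "N \<in> Obj (rep TYPE('k) m n)"
    and \<eta>: "\<eta> \<in> Hom (rep TYPE('k) m n) M N"
  shows "fmap (core_func m n) M N \<eta> \<in> Hom (rep TYPE('k) (m - 1) (n - 1))
    (fobj (core_func m n) M) (fobj (core_func m n) N)"
proof -
  have "mk_hom (m - 1) (n - 1) (fobj (core_func m n) M) \<eta> \<in> Hom (rep TYPE('k) (m - 1) (n - 1))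
    (fobj (core_func m n) M) (fobj (core_func m n) N)"
  proof (rule mk_hom_Hom[OF core_func_Obj[OF M]])
    fix p assume p: "p \<in> grid (m - 1) (n - 1)"
    show "lin_on (fobj (fobj (core_func m n) M) p) (fobj (fobj (core_func m n) N) p) (\<eta> p)"
      unfolding fobj_core_func[OF p]
      by (rule lin_on_subset[OF hom_lin[OF \<eta> inner_grid[OF p]] core_subset core_hom[OF M N \<eta> inner_grid[OF p]]])
  next
    fix p q v assume pq: "p \<in> grid (m - 1) (n - 1)" "q \<in> grid (m - 1) (n - 1)" "p \<le> q"
      and v: "v \<in> fobj (fobj (core_func m n) M) p"
    note pq' = inner_grid[OF pq(1)] inner_grid[OF pq(2)]
    have v': "v \<in> core m n M p" "v \<in> fobj M p" using v core_subset unfolding fobj_core_func[OF pq(1)] by blast+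
    show "\<eta> q (st (fobj (core_func m n) M) p q v) = st (fobj (core_func m n) N) p q (\<eta> p v)"
      unfolding st_core_func[OF pq v'(1)] st_core_func[OF pq core_hom[OF M N \<eta> pq'(1) v'(1)]]
      by (rule hom_natural[OF \<eta> pq' pq(3) v'(2)])
  qed
  then show ?thesis by (simp add: core_func_def)
qed

lemma is_functor_core_func:
  "is_functor (rep_ee TYPE('k::field) m n) (rep TYPE('k) (m - 1) (n - 1)) (core_func m n)"
  unfolding is_functor_def rep_ee_simps
proof (intro conjI ballI)
  fix M assume M: "M \<in> Obj (rep_ee TYPE('k) m n)"
  note M' = rep_ee_rep[OF M]
  show o: "fobj (core_func m n) M \<in> Obj (rep TYPE('k) (m - 1) (n - 1))"
    by (rule core_func_Obj[OF M'])
  show "fmap (core_func m n) M M (Ide (rep TYPE('k) m n) M) =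
      Ide (rep TYPE('k) (m - 1) (n - 1)) (fobj (core_func m n) M)"
  proof (rule hom_eqI)
    have "Ide (rep TYPE('k) m n) M \<in> Hom (rep TYPE('k) m n) M M"
      by (rule category.Ide_in[OF category_rep M'])
    then show "fmap (core_func m n) M M (Ide (rep TYPE('k) m n) M) \<in> Hom (rep TYPE('k) (m - 1) (n - 1))
        (fobj (core_func m n) M) (fobj (core_func m n) M)"
      by (rule core_func_Hom[OF M' M'])
    show "Ide (rep TYPE('k) (m - 1) (n - 1)) (fobj (core_func m n) M) \<in> Hom (rep TYPE('k) (m - 1) (n - 1))
        (fobj (core_func m n) M) (fobj (core_func m n) M)"
      by (rule category.Ide_in[OF category_rep o])
    fix p v assume p: "p \<in> grid (m - 1) (n - 1)" and v: "v \<in> fobj (fobj (core_func m n) M) p"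
    have v': "v \<in> core m n M p" "v \<in> fobj M p" using v core_subset unfolding fobj_core_func[OF p] by blast+
    show "fmap (core_func m n) M M (Ide (rep TYPE('k) m n) M) p v =
        Ide (rep TYPE('k) (m - 1) (n - 1)) (fobj (core_func m n) M) p v"
      unfolding fmap_core_func[OF p v'(1)] unfolding rep_Ide mk_hom_apply[OF p v] mk_hom_apply[OF inner_grid[OF p] v'(2)] ..
  qed
next
  fix M N \<eta> assume "M \<in> Obj (rep_ee TYPE('k) m n)" "N \<in> Obj (rep_ee TYPE('k) m n)"
    and "\<eta> \<in> Hom (rep TYPE('k) m n) M N"
  then show "fmap (core_func m n) M N \<eta> \<in> Hom (rep TYPE('k) (m - 1) (n - 1))
    (fobj (core_func m n) M) (fobj (core_func m n) N)"
    by (intro core_func_Hom rep_ee_rep)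
next
  fix M N L \<eta> \<theta>
  assume MNL: "M \<in> Obj (rep_ee TYPE('k) m n)" "N \<in> Obj (rep_ee TYPE('k) m n)" "L \<in> Obj (rep_ee TYPE('k) m n)"
    and \<eta>: "\<eta> \<in> Hom (rep TYPE('k) m n) M N" and \<theta>: "\<theta> \<in> Hom (rep TYPE('k) m n) N L"
  note M = rep_ee_rep[OF MNL(1)] and N = rep_ee_rep[OF MNL(2)] and L = rep_ee_rep[OF MNL(3)]
  note C = core_func_Hom[OF M N \<eta>] core_func_Hom[OF N L \<theta>]
  show "fmap (core_func m n) M L (Cmp (rep TYPE('k) m n) M N L \<theta> \<eta>) =
    Cmp (rep TYPE('k) (m - 1) (n - 1)) (fobj (core_func m n) M) (fobj (core_func m n) N) (fobj (core_func m n) L)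
      (fmap (core_func m n) N L \<theta>) (fmap (core_func m n) M N \<eta>)" (is "?l = ?r")
  proof (rule hom_eqI)
    show "?l \<in> Hom (rep TYPE('k) (m - 1) (n - 1)) (fobj (core_func m n) M) (fobj (core_func m n) L)"
      by (intro core_func_Hom M L category.Cmp_in[OF category_rep M N L \<eta> \<theta>])
    show "?r \<in> Hom (rep TYPE('k) (m - 1) (n - 1)) (fobj (core_func m n) M) (fobj (core_func m n) L)"
      by (intro category.Cmp_in[OF category_rep] core_func_Obj C M N L)
    fix p v assume p: "p \<in> grid (m - 1) (n - 1)" and v: "v \<in> fobj (fobj (core_func m n) M) p"
    have v': "v \<in> core m n M p" "v \<in> fobj M p" using v core_subset unfolding fobj_core_func[OF p] by blast+
    show "?l p v = ?r p v"
      unfolding fmap_core_func[OF p v'(1)] unfolding rep_Cmp mk_hom_apply[OF p v] mk_hom_apply[OF inner_grid[OF p] v'(2)]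
        fmap_core_func[OF p v'(1)] fmap_core_func[OF p core_hom[OF M N \<eta> inner_grid[OF p] v'(1)]] ..
  qed
qed

section \<open>Morphisms determined by their value at the minimal point\<close>

lemma hom_eq_corner:
  assumes M: "M \<in> Obj (rep_ee TYPE('k::field) m n)" and mn: "corner \<in> grid m n"
    and \<eta>: "\<eta> \<in> Hom (rep TYPE('k) m n) M N" and \<theta>: "\<theta> \<in> Hom (rep TYPE('k) m n) M N"
    and eq: "\<And>v. v \<in> fobj M corner \<Longrightarrow> \<eta> corner v = \<theta> corner v"
  shows "\<eta> = \<theta>"
proof (rule hom_eqI[OF \<eta> \<theta>])
  fix p v assume p: "p \<in> grid m n" and "v \<in> fobj M p"
  then obtain u where u: "u \<in> fobj M corner" "v = st M corner p u"
    using rep_ee_surj[OF M mn p corner_le[OF p]] by blast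
  show "\<eta> p v = \<theta> p v"
    unfolding u hom_natural[OF \<eta> mn p corner_le[OF p] u(1)] hom_natural[OF \<theta> mn p corner_le[OF p] u(1)]
    by (simp only: eq u)
qed

text \<open>An element of \<open>M p\<close> is lifted to \<open>M corner\<close>, mapped by
  \<open>f\<close> and pushed down to \<open>N p\<close>. The kernel condition makes the result
  independent of the lift; linearity and naturality are then checked on lifts.\<close>

lemma hom_induced:
  assumes M: "M \<in> Obj (rep_ee TYPE('k::field) m n)" and N: "N \<in> Obj (rep TYPE('k) m n)"
    and mn: "corner \<in> grid m n"
    and f: "lin_on (fobj M corner) (fobj N corner) f"
    and ker: "\<And>p v. p \<in> grid m n \<Longrightarrow> v \<in> ker M p \<Longrightarrow> st N corner p (f v) = 0"
  obtains \<eta> where "\<eta> \<in> Hom (rep TYPE('k) m n) M N"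
    "\<And>p v. p \<in> grid m n \<Longrightarrow> v \<in> fobj M corner \<Longrightarrow> \<eta> p (st M corner p v) = st N corner p (f v)"
proof -
  define s where "s p u = (SOME v. v \<in> fobj M corner \<and> st M corner p v = u)" for p u
  note M' = rep_ee_rep[OF M]
  have s: "s p u \<in> fobj M corner \<and> st M corner p (s p u) = u" if "p \<in> grid m n" "u \<in> fobj M p" for p u
  proof -
    have "u \<in> st M corner p ` fobj M corner"
      unfolding rep_ee_surj[OF M mn that(1) corner_le[OF that(1)]] by (rule that(2))
    then have "\<exists>v. v \<in> fobj M corner \<and> st M corner p v = u" by blast
    then show ?thesis unfolding s_def by (rule someI_ex)
  qed
  define h where "h p u = st N corner p (f (s p u))" for p u
  have stM: "lin_on (fobj M corner) (fobj M p) (st M corner p)"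
    and stN: "lin_on (fobj N corner) (fobj N p) (st N corner p)" if "p \<in> grid m n" for p
    by (rule rep_st_lin[OF M' mn that corner_le[OF that]] rep_st_lin[OF N mn that corner_le[OF that]])+
  note sM = rep_subspace[OF M' mn] and sN = rep_subspace[OF N mn]
  have h: "h p (st M corner p v) = st N corner p (f v)" if p: "p \<in> grid m n" and v: "v \<in> fobj M corner" for p v
  proof -
    let ?u = "s p (st M corner p v)"
    have u: "?u \<in> fobj M corner" "st M corner p ?u = st M corner p v"
      using s[OF p lin_on_in[OF stM[OF p] v]] by blast+
    \<comment> \<open>The chosen lift and \<open>v\<close> have the same image at \<open>p\<close>,
      so they differ by an element on which the hypothesis \<open>ker\<close> applies.\<close>
    have "?u - v \<in> ker M p"
      unfolding ker_def using u seqs.subspace_diff[OF sM u(1) v]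
      by (simp add: lin_on_diff[OF stM[OF p] sM u(1) v])
    then have "st N corner p (f (?u - v)) = 0" by (rule ker[OF p])
    then have "st N corner p (f ?u) - st N corner p (f v) = 0"
      by (simp only: lin_on_diff[OF f sM u(1) v]
          lin_on_diff[OF stN[OF p] sN lin_on_in[OF f u(1)] lin_on_in[OF f v]])
    then show ?thesis by (simp add: h_def)
  qed
  have comp: "lin_on (fobj M corner) (fobj N p) (\<lambda>v. st N corner p (f v))" if "p \<in> grid m n" for p
    by (rule lin_on_comp[OF f stN[OF that]])
  have ex: "\<exists>v\<in>fobj M corner. u = st M corner p v" if "p \<in> grid m n" "u \<in> fobj M p" for p u
    using s[OF that] by metis
  have "mk_hom m n M h \<in> Hom (rep TYPE('k) m n) M N"
  proof (rule mk_hom_Hom[OF M'])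
    fix p assume p: "p \<in> grid m n"
    show "lin_on (fobj M p) (fobj N p) (h p)"
    proof (rule lin_onI)
      fix u assume "u \<in> fobj M p"
      then obtain v where v: "v \<in> fobj M corner" "u = st M corner p v" using ex[OF p] by blast
      show "h p u \<in> fobj N p" unfolding v h[OF p v(1)] by (rule lin_on_in[OF comp[OF p] v(1)])
      fix c show "h p (scale c u) = scale c (h p u)"
        unfolding v lin_on_scale[OF stM[OF p] v(1), symmetric] h[OF p v(1)]
          h[OF p seqs.subspace_scale[OF sM v(1)]] by (rule lin_on_scale[OF comp[OF p] v(1)])
    next
      fix u u' assume "u \<in> fobj M p" "u' \<in> fobj M p"
      then obtain v v' where v: "v \<in> fobj M corner" "u = st M corner p v"
        "v' \<in> fobj M corner" "u' = st M corner p v'" using ex[OF p] by blast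
      show "h p (u + u') = h p u + h p u'"
        unfolding v lin_on_add[OF stM[OF p] v(1,3), symmetric] h[OF p v(1)] h[OF p v(3)]
          h[OF p seqs.subspace_add[OF sM v(1,3)]] by (rule lin_on_add[OF comp[OF p] v(1,3)])
    qed
  next
    fix p q u assume pq: "p \<in> grid m n" "q \<in> grid m n" "p \<le> q" and "u \<in> fobj M p"
    then obtain v where v: "v \<in> fobj M corner" "u = st M corner p v" using ex by blast
    show "h q (st M p q u) = st N p q (h p u)"
      unfolding v rep_st_st[OF M' mn pq(1,2) corner_le[OF pq(1)] pq(3) v(1)]
        h[OF pq(1) v(1)] h[OF pq(2) v(1)]
      by (rule rep_st_st[OF N mn pq(1,2) corner_le[OF pq(1)] pq(3) lin_on_in[OF f v(1)], symmetric])
  qed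
  moreover have "mk_hom m n M h p (st M corner p v) = st N corner p (f v)"
    if "p \<in> grid m n" "v \<in> fobj M corner" for p v
    unfolding mk_hom_apply[OF that(1) lin_on_in[OF stM[OF that(1)] that(2)]] by (rule h[OF that])
  ultimately show ?thesis using that by blast
qed

lemma hom_induced_corner:
  assumes M: "M \<in> Obj (rep_ee TYPE('k::field) m n)" and N: "N \<in> Obj (rep TYPE('k) m n)"
    and mn: "corner \<in> grid m n"
    and f: "lin_on (fobj M corner) (fobj N corner) f"
    and ker: "\<And>p v. p \<in> grid m n \<Longrightarrow> v \<in> ker M p \<Longrightarrow> f v \<in> ker N p"
  obtains \<eta> where "\<eta> \<in> Hom (rep TYPE('k) m n) M N" "\<And>v. v \<in> fobj M corner \<Longrightarrow> \<eta> corner v = f v"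
proof -
  obtain \<eta> where \<eta>: "\<eta> \<in> Hom (rep TYPE('k) m n) M N"
    "\<And>p v. p \<in> grid m n \<Longrightarrow> v \<in> fobj M corner \<Longrightarrow> \<eta> p (st M corner p v) = st N corner p (f v)"
    by (rule hom_induced[OF M N mn f]) (use ker in \<open>auto simp: ker_def\<close>)
  have "\<eta> corner v = f v" if "v \<in> fobj M corner" for v
    using \<eta>(2)[OF mn that] unfolding rep_st_id[OF rep_ee_rep[OF M] mn that]
      rep_st_id[OF N mn lin_on_in[OF f that]] .
  with \<eta>(1) show ?thesis by (rule that)
qed

section \<open>Kernels and the representation of a filtered vector space\<close>

lemma ker_subset: "ker M p \<subseteq> fobj M corner"
  by (auto simp: ker_def)

lemma ker_subspace:
  assumes "M \<in> Obj (rep TYPE('k::field) m n)" "corner \<in> grid m n" "p \<in> grid m n"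
  shows "seqs.subspace (ker M p)"
  unfolding ker_def
  by (rule lin_on_kernel[OF rep_st_lin[OF assms corner_le[OF assms(3)]] rep_subspace[OF assms(1,2)]])

lemma ker_corner:
  assumes "M \<in> Obj (rep TYPE('k::field) m n)" "corner \<in> grid m n"
  shows "ker M corner = {0}"
  using rep_st_id[OF assms] seqs.subspace_0[OF rep_subspace[OF assms]] unfolding ker_def by force

lemma ker_mono:
  assumes M: "M \<in> Obj (rep TYPE('k::field) m n)" and mn: "corner \<in> grid m n"
    and pq: "p \<in> grid m n" "q \<in> grid m n" "p \<le> q"
  shows "ker M p \<subseteq> ker M q"
proof
  fix v assume v: "v \<in> ker M p"
  then have v': "v \<in> fobj M corner" "st M corner p v = 0" by (auto simp: ker_def)
  have "st M corner q v = st M p q (st M corner p v)"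
    by (rule rep_st_st[OF M mn pq(1,2) corner_le[OF pq(1)] pq(3) v'(1), symmetric])
  also have "\<dots> = 0"
    unfolding v' by (rule lin_on_0[OF rep_st_lin[OF M pq] rep_subspace[OF M pq(1)]])
  finally show "v \<in> ker M q" using v' by (simp add: ker_def)
qed

text \<open>The representation with value \<open>V / K p\<close> at \<open>p\<close> and the
  canonical surjections as structure maps, each quotient being modelled by the image of
  \<open>proj\<close>. The family \<open>K\<close> may be nonzero at the corner, in which case the
  value there is a proper quotient of \<open>V\<close>.\<close>

definition filt_rep :: "nat \<Rightarrow> nat \<Rightarrow> (nat \<Rightarrow> 'k::field) set \<Rightarrow> (nat \<times> nat \<Rightarrow> (nat \<Rightarrow> 'k) set) \<Rightarrow> 'k grid_rep"
  where "filt_rep m n V K = mk_rep m n (\<lambda>p. proj (K p) ` V) (\<lambda>p q. proj (K q))"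

context
  fixes m n :: nat and V :: "(nat \<Rightarrow> 'k::field) set" and K
  assumes V: "fd V" and K: "\<And>p. p \<in> grid m n \<Longrightarrow> seqs.subspace (K p)"
    and KV: "\<And>p. p \<in> grid m n \<Longrightarrow> K p \<subseteq> V"
    and K_mono: "\<And>p q. p \<in> grid m n \<Longrightarrow> q \<in> grid m n \<Longrightarrow> p \<le> q \<Longrightarrow> K p \<subseteq> K q"
begin

lemma fobj_filt_rep: "p \<in> grid m n \<Longrightarrow> fobj (filt_rep m n V K) p = proj (K p) ` V"
  by (simp only: filt_rep_def fobj_mk_rep)

lemma st_filt_rep:
  "p \<in> grid m n \<Longrightarrow> q \<in> grid m n \<Longrightarrow> p \<le> q \<Longrightarrow> v \<in> proj (K p) ` V \<Longrightarrow> st (filt_rep m n V K) p q v = proj (K q) v"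
  unfolding filt_rep_def by (rule st_mk_rep)

lemma proj_image_subset: "p \<in> grid m n \<Longrightarrow> proj (K p) ` V \<subseteq> V"
  using proj_in[OF K fd_subspace[OF V] KV] by blast

lemma proj_in_filt: "p \<in> grid m n \<Longrightarrow> q \<in> grid m n \<Longrightarrow> v \<in> proj (K p) ` V \<Longrightarrow> proj (K q) v \<in> proj (K q) ` V"
  using proj_image_subset by blast

lemma filt_rep_Obj: "filt_rep m n V K \<in> Obj (rep_ee TYPE('k) m n)"
proof -
  have "filt_rep m n V K \<in> Obj (rep TYPE('k) m n)"
    unfolding filt_rep_def
  proof (rule mk_rep_Obj)
    show "fd (proj (K p) ` V)" if "p \<in> grid m n" for p
      by (rule fd_lin_image[OF lin_proj[OF K[OF that]] V])
    show "lin_on (proj (K p) ` V) (proj (K q) ` V) (proj (K q))" if "p \<in> grid m n" "q \<in> grid m n" for p q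
      by (rule lin_lin_on[OF lin_proj[OF K[OF that(2)]] proj_in_filt[OF that]])
    show "proj (K p) v = v" if "p \<in> grid m n" "v \<in> proj (K p) ` V" for p v
      using that proj_proj[OF K[OF that(1)] K[OF that(1)] order_refl] by auto
    show "proj (K r) (proj (K q) v) = proj (K r) v"
      if "q \<in> grid m n" "r \<in> grid m n" "q \<le> r" for q r v
      using that by (intro proj_proj K K_mono)
  qed
  moreover have "st (filt_rep m n V K) p q ` fobj (filt_rep m n V K) p = fobj (filt_rep m n V K) q"
    if pq: "p \<in> grid m n" "q \<in> grid m n" "p \<le> q" for p q
  proof -
    have "st (filt_rep m n V K) p q ` proj (K p) ` V = proj (K q) ` proj (K p) ` V"
      by (rule image_cong[OF refl st_filt_rep[OF pq]])
    also have "\<dots> = proj (K q) ` V"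
      unfolding image_image proj_proj[OF K[OF pq(1)] K[OF pq(2)] K_mono[OF pq]] ..
    finally show ?thesis unfolding fobj_filt_rep[OF pq(1)] fobj_filt_rep[OF pq(2)] .
  qed
  ultimately show ?thesis unfolding rep_ee_Obj_iff by blast
qed

context
  assumes mn: "corner \<in> grid m n" and K0: "K corner = {0}"
begin

text \<open>The projection along \<open>{0}\<close> must be the identity, because
  \<open>v - proj {0} v\<close> lies in \<open>{0}\<close>. Hence with \<open>K corner = {0}\<close>
  no identification of \<open>V\<close> with a quotient is needed.\<close>

lemma fobj_filt_corner: "fobj (filt_rep m n V K) corner = V"
proof -
  have "proj (K corner) v = v" for v
    using proj_diff[OF K[OF mn], of v] unfolding K0 by simp
  then show ?thesis using fobj_filt_rep[OF mn] by simp
qed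

lemma st_filt_corner: "p \<in> grid m n \<Longrightarrow> v \<in> V \<Longrightarrow> st (filt_rep m n V K) corner p v = proj (K p) v"
  using st_filt_rep[OF mn _ corner_le] fobj_filt_corner fobj_filt_rep[OF mn] by simp

lemma ker_filt: "p \<in> grid m n \<Longrightarrow> ker (filt_rep m n V K) p = K p"
  unfolding ker_def fobj_filt_corner using KV[of p] st_filt_corner[of p] proj_zero_iff[OF K[of p]] by auto

end

end


section \<open>The kernel of the core functor, and fullness\<close>

definition core_ker :: "nat \<Rightarrow> nat \<Rightarrow> 'k grid_rep \<Rightarrow> nat \<times> nat \<Rightarrow> (nat \<Rightarrow> 'k::field) set" where
  "core_ker m n M p = {v \<in> fobj M corner. st M corner p v \<in> core m n M p}"

text \<open>The maps from the corner to the two edge points factor through \<open>p\<close>. This is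
  the source of the two flags: \<open>x \<mapsto> ker M (x, n)\<close> and
  \<open>y \<mapsto> ker M (m, y)\<close>.\<close>

lemma core_ker_eq:
  assumes M: "M \<in> Obj (rep TYPE('k::field) m n)" and mn: "corner \<in> grid m n" and p: "p \<in> grid m n"
  shows "core_ker m n M p = ker M (fst p, n) \<inter> ker M (m, snd p)"
  using rep_st_st[OF M mn p edge_grid(1)[OF p] corner_le[OF p] edge_grid(3)[OF p]]
    rep_st_st[OF M mn p edge_grid(2)[OF p] corner_le[OF p] edge_grid(4)[OF p]]
    lin_on_in[OF rep_st_lin[OF M mn p corner_le[OF p]]]
  by (auto simp: core_ker_def core_def ker_def)

lemma core_ker_subset: "core_ker m n M p \<subseteq> fobj M corner"
  by (auto simp: core_ker_def)

lemma core_ker_subspace: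
  assumes M: "M \<in> Obj (rep TYPE('k::field) m n)" and mn: "corner \<in> grid m n" and p: "p \<in> grid m n"
  shows "seqs.subspace (core_ker m n M p)"
  unfolding core_ker_eq[OF assms]
  by (intro seqs.subspace_inter ker_subspace[OF M mn] edge_grid[OF p])

lemma ker_subset_core_ker:
  assumes M: "M \<in> Obj (rep TYPE('k::field) m n)" and mn: "corner \<in> grid m n" and p: "p \<in> grid m n"
  shows "ker M p \<subseteq> core_ker m n M p"
  using seqs.subspace_0[OF core_subspace[OF M p]] by (auto simp: ker_def core_ker_def)

lemma core_ker_mono:
  assumes M: "M \<in> Obj (rep TYPE('k::field) m n)" and mn: "corner \<in> grid m n"
    and pq: "p \<in> grid m n" "q \<in> grid m n" "p \<le> q"
  shows "core_ker m n M p \<subseteq> core_ker m n M q"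
proof -
  have "(fst p, n) \<le> (fst q, n)" "(m, snd p) \<le> (m, snd q)" using pq(3) by (auto simp: less_eq_prod_def)
  then show ?thesis
    unfolding core_ker_eq[OF M mn pq(1)] core_ker_eq[OF M mn pq(2)]
    by (intro Int_mono ker_mono[OF M mn] edge_grid pq)
qed

definition coreless :: "'k::field itself \<Rightarrow> nat \<Rightarrow> nat \<Rightarrow> 'k grid_rep set" where
  "coreless k m n = {M \<in> Obj (rep_ee k m n). \<forall>p\<in>grid m n. core m n M p = {0}}"

lemma rep_ee_lift:
  assumes "M \<in> Obj (rep_ee TYPE('k::field) m n)" "corner \<in> grid m n" "p \<in> grid m n" "u \<in> fobj M p"
  obtains v where "v \<in> fobj M corner" "u = st M corner p v"
proof -
  have "u \<in> st M corner p ` fobj M corner"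
    unfolding rep_ee_surj[OF assms(1-3) corner_le[OF assms(3)]] by (rule assms(4))
  then show ?thesis using that by blast
qed

lemma hom_0:
  assumes "M \<in> Obj (rep TYPE('k::field) m n)" "\<eta> \<in> Hom (rep TYPE('k) m n) M N" "p \<in> grid m n"
  shows "\<eta> p 0 = 0"
  by (rule lin_on_0[OF hom_lin[OF assms(2,3)] rep_subspace[OF assms(1,3)]])

lemma coreless_subsetI:
  assumes "M \<in> Obj (rep_ee TYPE('k::field) m n)" "\<And>p v. p \<in> grid m n \<Longrightarrow> v \<in> core m n M p \<Longrightarrow> v = 0"
  shows "M \<in> coreless TYPE('k) m n"
  using assms seqs.subspace_0[OF core_subspace[OF rep_ee_rep[OF assms(1)]]] unfolding coreless_def by blast

text \<open>The quotient of \<open>M\<close> by its core is \<open>V\<close> filtered by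
  \<open>core_ker\<close>, so both factors of \<open>d\<close> arise from linear maps at the corner
  by \<open>hom_induced\<close>.\<close>

lemma factors_through_coreless:
  assumes M: "M \<in> Obj (rep_ee TYPE('k::field) m n)" and N: "N \<in> Obj (rep_ee TYPE('k) m n)"
    and mn: "corner \<in> grid m n"
    and d: "d \<in> Hom (rep TYPE('k) m n) M N"
    and d0: "\<And>p v. p \<in> grid m n \<Longrightarrow> v \<in> core m n M p \<Longrightarrow> d p v = 0"
  shows "factors_through (rep_ee TYPE('k) m n) (coreless TYPE('k) m n) M N d"
proof -
  note M' = rep_ee_rep[OF M] and N' = rep_ee_rep[OF N]
  let ?V = "fobj M corner" and ?W = "core_ker m n M"
  define Q where "Q = filt_rep m n ?V ?W"
  note W = rep_fd[OF M' mn] core_ker_subspace[OF M' mn] core_ker_subset core_ker_mono[OF M' mn]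
  have Q: "Q \<in> Obj (rep_ee TYPE('k) m n)"
    and fobj_Q: "\<And>p. p \<in> grid m n \<Longrightarrow> fobj Q p = proj (?W p) ` ?V"
    and st_Q: "\<And>p q v. p \<in> grid m n \<Longrightarrow> q \<in> grid m n \<Longrightarrow> p \<le> q \<Longrightarrow> v \<in> proj (?W p) ` ?V \<Longrightarrow> st Q p q v = proj (?W q) v"
    and Q_sub: "\<And>p. p \<in> grid m n \<Longrightarrow> proj (?W p) ` ?V \<subseteq> ?V"
    unfolding Q_def
    by (rule filt_rep_Obj fobj_filt_rep st_filt_rep proj_image_subset; (rule W)?; assumption?)+
  have pp: "proj (?W q) (proj (?W p) v) = proj (?W q) v" if "p \<in> grid m n" "q \<in> grid m n" "p \<le> q" for p q v
    using that by (intro proj_proj W)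
  \<comment> \<open>On the edges, \<open>core_ker\<close> adds nothing to the kernels of
    \<open>M\<close>. Passing to the quotient thus leaves both flags unchanged, and an element of
    the core of \<open>Q\<close> is represented by a vector in both flags, that is, in
    \<open>?W p\<close>.\<close>
  have edge: "?W (m, snd p) \<subseteq> ker M (m, snd p)" "?W (fst p, n) \<subseteq> ker M (fst p, n)" if "p \<in> grid m n" for p
    using core_ker_eq[OF M' mn edge_grid(1)[OF that]] core_ker_eq[OF M' mn edge_grid(2)[OF that]] by auto
  have "Q \<in> coreless TYPE('k) m n"
  proof (rule coreless_subsetI[OF Q])
    fix p u assume p: "p \<in> grid m n" and u: "u \<in> core m n Q p"
    note e = edge_grid[OF p]
    obtain v where v: "v \<in> ?V" "u = proj (?W p) v" using u fobj_Q[OF p] by (auto simp: core_def)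
    have u': "u \<in> proj (?W p) ` ?V" using v by blast
    have "proj (?W (m, snd p)) v = 0" "proj (?W (fst p, n)) v = 0"
      using u st_Q[OF p e(1,3) u'] st_Q[OF p e(2,4) u'] pp[OF p e(1,3), of v] pp[OF p e(2,4), of v] v
      by (auto simp: core_def)
    then have "v \<in> ?W (m, snd p)" "v \<in> ?W (fst p, n)"
      using proj_zero_iff[OF W(2)[OF e(1)]] proj_zero_iff[OF W(2)[OF e(2)]] by blast+
    then have "v \<in> ?W p" using edge[OF p] unfolding core_ker_eq[OF M' mn p] by blast
    then show "u = 0" unfolding v by (rule proj_zero[OF W(2)[OF p]])
  qed
  moreover obtain k where k: "k \<in> Hom (rep TYPE('k) m n) M Q"
    "\<And>p v. p \<in> grid m n \<Longrightarrow> v \<in> ?V \<Longrightarrow> k p (st M corner p v) = st Q corner p (proj (?W corner) v)"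
  proof (rule hom_induced[OF M rep_ee_rep[OF Q] mn])
    show "lin_on ?V (fobj Q corner) (proj (?W corner))"
      unfolding fobj_Q[OF mn] by (rule lin_lin_on[OF lin_proj[OF W(2)[OF mn]]]) blast
    fix p v assume p: "p \<in> grid m n" and v: "v \<in> ker M p"
    then have v': "v \<in> ?V" "v \<in> ?W p" using ker_subset_core_ker[OF M' mn p] ker_subset by blast+
    have "st Q corner p (proj (?W corner) v) = proj (?W p) (proj (?W corner) v)"
      by (rule st_Q[OF mn p corner_le[OF p] imageI[OF v'(1)]])
    also have "\<dots> = 0" unfolding pp[OF mn p corner_le[OF p]] by (rule proj_zero[OF W(2)[OF p] v'(2)])
    finally show "st Q corner p (proj (?W corner) v) = 0" .
  qed blast
  moreover obtain h where h: "h \<in> Hom (rep TYPE('k) m n) Q N"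
    "\<And>p w. p \<in> grid m n \<Longrightarrow> w \<in> fobj Q corner \<Longrightarrow> h p (st Q corner p w) = st N corner p (d corner w)"
  proof (rule hom_induced[OF Q N' mn])
    have sub: "fobj Q corner \<subseteq> ?V" unfolding fobj_Q[OF mn] by (rule Q_sub[OF mn])
    \<comment> \<open>The value of \<open>Q\<close> at the corner is a complement of
      \<open>?W corner\<close> inside \<open>V\<close>, so \<open>d corner\<close> can be applied to
      it directly.\<close>
    show "lin_on (fobj Q corner) (fobj N corner) (d corner)"
      using sub lin_on_in[OF hom_lin[OF d mn]] by (intro lin_on_subset[OF hom_lin[OF d mn]]) auto
    fix p w assume p: "p \<in> grid m n" and w: "w \<in> ker Q p"
    then have w': "w \<in> fobj Q corner" "w \<in> ?V" "st Q corner p w = 0" using sub by (auto simp: ker_def)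
    have "proj (?W p) w = 0"
      using st_Q[OF mn p corner_le[OF p]] w' fobj_Q[OF mn] by auto
    then have "w \<in> ?W p" unfolding proj_zero_iff[OF W(2)[OF p]] .
    then have "d p (st M corner p w) = 0" by (intro d0 p) (simp add: core_ker_def)
    then show "st N corner p (d corner w) = 0"
      using hom_natural[OF d mn p corner_le[OF p] w'(2)] by simp
  qed blast
  moreover have "d = Cmp (rep TYPE('k) m n) M Q N h k"
  proof (rule hom_eq_corner[OF M mn d])
    show "Cmp (rep TYPE('k) m n) M Q N h k \<in> Hom (rep TYPE('k) m n) M N"
      by (rule category.Cmp_in[OF category_rep M' rep_ee_rep[OF Q] N' k(1) h(1)])
    fix v assume v: "v \<in> ?V"
    let ?w = "proj (?W corner) v"
    have w: "?w \<in> fobj Q corner" using v unfolding fobj_Q[OF mn] by blast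
    have wV: "?w \<in> ?V" using w Q_sub[OF mn] unfolding fobj_Q[OF mn] by blast
    \<comment> \<open>The core may be nonzero at the corner itself, so \<open>v\<close> and its
      representative \<open>?w\<close> can differ; their difference lies in the core and is killed
      by \<open>d\<close>.\<close>
    have "v - ?w \<in> ?W corner" by (rule proj_diff[OF W(2)[OF mn]])
    then have c: "v - ?w \<in> core m n M corner" using rep_st_id[OF M' mn] by (auto simp: core_ker_def)
    have "d corner v - d corner ?w = d corner (v - ?w)"
      by (rule lin_on_diff[OF hom_lin[OF d mn] rep_subspace[OF M' mn] v wV, symmetric])
    also have "\<dots> = 0" by (rule d0[OF mn c])
    finally have "d corner v = d corner ?w" by simp
    also have "\<dots> = h corner (k corner v)"
      using h(2)[OF mn w] k(2)[OF mn v] rep_st_id[OF rep_ee_rep[OF Q] mn w] rep_st_id[OF M' mn v]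
        rep_st_id[OF N' mn lin_on_in[OF hom_lin[OF d mn] wV]] by simp
    finally show "d corner v = Cmp (rep TYPE('k) m n) M Q N h k corner v"
      unfolding rep_Cmp mk_hom_apply[OF mn v] .
  qed
  ultimately show ?thesis unfolding factors_through_def rep_ee_simps by blast
qed

text \<open>Morphisms map cores into cores, so anything that factors through a coreless object
  vanishes on the core; \<open>factors_through_coreless\<close> is the converse. Vanishing on the
  whole grid and on the inner grid agree by \<open>core_edge\<close>.\<close>

lemma quotient_rel_coreless:
  assumes M: "M \<in> Obj (rep_ee TYPE('k::field) m n)" and N: "N \<in> Obj (rep_ee TYPE('k) m n)"
    and mn: "corner \<in> grid m n"
  shows "quotient_rel (rep_ee TYPE('k) m n) (coreless TYPE('k) m n) M N =
    {(f, g). f \<in> Hom (rep_ee TYPE('k) m n) M N \<and> g \<in> Hom (rep_ee TYPE('k) m n) M N \<and>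
      fmap (core_func m n) M N f = fmap (core_func m n) M N g}"
proof -
  note M' = rep_ee_rep[OF M] and N' = rep_ee_rep[OF N]
  have "factors_through (rep_ee TYPE('k) m n) (coreless TYPE('k) m n) M N
      (Add (rep TYPE('k) m n) M N f (Neg (rep TYPE('k) m n) M N g)) \<longleftrightarrow>
    fmap (core_func m n) M N f = fmap (core_func m n) M N g" (is "factors_through _ _ _ _ ?d \<longleftrightarrow> ?E")
    if f: "f \<in> Hom (rep TYPE('k) m n) M N" and g: "g \<in> Hom (rep TYPE('k) m n) M N" for f g
  proof -
    have d: "?d p v = f p v - g p v" if "p \<in> grid m n" "v \<in> fobj M p" for p v
      unfolding rep_Add rep_Neg mk_hom_apply[OF that] by simp
    have dH: "?d \<in> Hom (rep TYPE('k) m n) M N"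
    proof -
      have "mk_hom m n M (\<lambda>p v. f p v - g p v) \<in> Hom (rep TYPE('k) m n) M N"
      proof (rule mk_hom_Hom[OF M'])
        fix p assume p: "p \<in> grid m n"
        note l = hom_lin[OF f p] hom_lin[OF g p]
        show "lin_on (fobj M p) (fobj N p) (\<lambda>v. f p v - g p v)"
          using lin_on_in[OF l(1)] lin_on_in[OF l(2)] seqs.subspace_diff[OF rep_subspace[OF N' p]]
          by (intro lin_onI) (auto simp only: lin_on_add[OF l(1)] lin_on_add[OF l(2)] lin_on_scale[OF l(1)]
              lin_on_scale[OF l(2)] seqs.scale_right_diff_distrib add_diff_add)
      next
        fix p q v assume pq: "p \<in> grid m n" "q \<in> grid m n" "p \<le> q" and v: "v \<in> fobj M p"
        show "f q (st M p q v) - g q (st M p q v) = st N p q (f p v - g p v)"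
          unfolding hom_natural[OF f pq v] hom_natural[OF g pq v]
          by (rule lin_on_diff[OF rep_st_lin[OF N' pq] rep_subspace[OF N' pq(1)]
                lin_on_in[OF hom_lin[OF f pq(1)] v] lin_on_in[OF hom_lin[OF g pq(1)] v], symmetric])
      qed
      moreover have "?d = mk_hom m n M (\<lambda>p v. f p v - g p v)"
        unfolding rep_Add rep_Neg by (auto simp: mk_hom_def fun_eq_iff restrict_def)
      ultimately show ?thesis by simp
    qed
    have "?E \<longleftrightarrow> (\<forall>p\<in>grid m n. \<forall>v\<in>core m n M p. ?d p v = 0)"
    proof
      assume E: ?E
      show "\<forall>p\<in>grid m n. \<forall>v\<in>core m n M p. ?d p v = 0"
      proof (intro ballI)
        fix p v assume p: "p \<in> grid m n" and v: "v \<in> core m n M p"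
        then have v': "v \<in> fobj M p" using core_subset by blast
        show "?d p v = 0"
        proof (cases "p \<in> grid (m - 1) (n - 1)")
          case True
          show ?thesis
            unfolding d[OF p v'] using fmap_core_func[OF True v, of N] E by (metis right_minus_eq)
        next
          case False
          then have "v = 0" using core_edge[OF M' p] v p inner_grid_iff[of p m n] by blast
          then show ?thesis using hom_0[OF M' dH p] by simp
        qed
      qed
    next
      assume z: "\<forall>p\<in>grid m n. \<forall>v\<in>core m n M p. ?d p v = 0"
      show ?E
      proof (rule hom_eqI[OF core_func_Hom[OF M' N' f] core_func_Hom[OF M' N' g]])
        fix p v assume p: "p \<in> grid (m - 1) (n - 1)" and v: "v \<in> fobj (fobj (core_func m n) M) p"
        have v': "v \<in> core m n M p" "v \<in> fobj M p" using v core_subset unfolding fobj_core_func[OF p] by blast+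
        show "fmap (core_func m n) M N f p v = fmap (core_func m n) M N g p v"
          unfolding fmap_core_func[OF p v'(1)]
          using z inner_grid[OF p] v' d[OF inner_grid[OF p] v'(2)] by (metis right_minus_eq)
      qed
    qed
    moreover have "factors_through (rep_ee TYPE('k) m n) (coreless TYPE('k) m n) M N ?d \<longleftrightarrow>
      (\<forall>p\<in>grid m n. \<forall>v\<in>core m n M p. ?d p v = 0)"
    proof
      assume "factors_through (rep_ee TYPE('k) m n) (coreless TYPE('k) m n) M N ?d"
      then obtain Q k h where Q: "Q \<in> coreless TYPE('k) m n"
        and kh: "k \<in> Hom (rep TYPE('k) m n) M Q" "h \<in> Hom (rep TYPE('k) m n) Q N"
        and dhk: "?d = Cmp (rep TYPE('k) m n) M Q N h k"
        unfolding factors_through_def rep_ee_simps by blast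
      have Q': "Q \<in> Obj (rep TYPE('k) m n)" using Q by (simp add: coreless_def rep_ee_rep)
      show "\<forall>p\<in>grid m n. \<forall>v\<in>core m n M p. ?d p v = 0"
      proof (intro ballI)
        fix p v assume p: "p \<in> grid m n" and v: "v \<in> core m n M p"
        have "k p v \<in> {0}" using core_hom[OF M' Q' kh(1) p v] Q p by (auto simp: coreless_def)
        then have "h p (k p v) = 0" using hom_0[OF Q' kh(2) p] by simp
        then show "?d p v = 0"
          unfolding dhk rep_Cmp mk_hom_apply[OF p subsetD[OF core_subset v]] .
      qed
    next
      assume "\<forall>p\<in>grid m n. \<forall>v\<in>core m n M p. ?d p v = 0"
      then show "factors_through (rep_ee TYPE('k) m n) (coreless TYPE('k) m n) M N ?d"
        by (intro factors_through_coreless[OF M N mn dH]) blast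
    qed
    ultimately show ?thesis by blast
  qed
  then show ?thesis unfolding quotient_rel_def rep_ee_simps by blast
qed

section \<open>Bases adapted to the edge kernels, and fullness\<close>

lemma adapted_basis:
  assumes M: "M \<in> Obj (rep TYPE('k::field) m n)" and mn: "corner \<in> grid m n"
  obtains E where "finite E" "E \<subseteq> fobj M corner" "seqs.independent E" "fobj M corner \<subseteq> seqs.span E"
    "\<And>p. p \<in> grid m n \<Longrightarrow> core_ker m n M p \<subseteq> seqs.span (E \<inter> core_ker m n M p)"
    "\<And>b. b \<in> E \<Longrightarrow> \<exists>i j. 1 \<le> i \<and> i \<le> m + 1 \<and> 1 \<le> j \<and> j \<le> n + 1 \<and>
      (\<forall>p\<in>grid m n. b \<in> core_ker m n M p \<longleftrightarrow> i \<le> fst p \<and> j \<le> snd p)"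
proof -
  let ?V = "fobj M corner"
  \<comment> \<open>The kernels along an edge, completed by zero at index 0 and by the whole space
    beyond the grid. The completion gives every basis vector a least index, and this index lies
    between \<open>1\<close> and \<open>m + 1\<close>.\<close>
  define A where "A x = (if x = 0 then {0} else if x \<le> m then ker M (x, n) else ?V)" for x
  define B where "B y = (if y = 0 then {0} else if y \<le> n then ker M (m, y) else ?V)" for y
  have mn1: "1 \<le> m" "1 \<le> n" using mn by (auto simp: corner_def grid_def)
  have gA: "(x, n) \<in> grid m n" if "x \<noteq> 0" "x \<le> m" for x using that mn1 by (auto simp: grid_def)
  have gB: "(m, y) \<in> grid m n" if "y \<noteq> 0" "y \<le> n" for y using that mn1 by (auto simp: grid_def)
  have V: "seqs.subspace ?V" by (rule rep_subspace[OF M mn])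
  have sA: "seqs.subspace (A x)" for x
    using V ker_subspace[OF M mn gA] by (auto simp: A_def seqs.subspace_single_0)
  have sB: "seqs.subspace (B x)" for x
    using V ker_subspace[OF M mn gB] by (auto simp: B_def seqs.subspace_single_0)
  have AV: "A x \<subseteq> ?V" "B x \<subseteq> ?V" for x
    using seqs.subspace_0[OF V] ker_subset by (auto simp: A_def B_def)
  have mA: "A x \<subseteq> A y" if "x \<le> y" for x y
  proof (cases "x = 0 \<or> \<not> y \<le> m")
    case True
    then show ?thesis using seqs.subspace_0[OF sA[of y]] AV(1)[of x] that by (auto simp: A_def)
  next
    case False
    then show ?thesis using that ker_mono[OF M mn gA gA, of x y] by (simp add: A_def)
  qed
  have mB: "B x \<subseteq> B y" if "x \<le> y" for x y
  proof (cases "x = 0 \<or> \<not> y \<le> n")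
    case True
    then show ?thesis using seqs.subspace_0[OF sB[of y]] AV(2)[of x] that by (auto simp: B_def)
  next
    case False
    then show ?thesis using that ker_mono[OF M mn gB gB, of x y] by (simp add: B_def)
  qed
  have tA: "A (m + 1) = ?V" and tB: "B (n + 1) = ?V" by (simp_all add: A_def B_def)
  have AB: "A (fst p) \<inter> B (snd p) = core_ker m n M p" if "p \<in> grid m n" for p
    unfolding core_ker_eq[OF M mn that] using that by (auto simp: A_def B_def grid_def)
  obtain d where d: "rank_le ?V d" using fd_rank_le[OF rep_fd[OF M mn]] ..
  have "\<exists>E. finite E \<and> E \<subseteq> ?V \<and> seqs.independent E \<and> (\<forall>x y. A x \<inter> B y \<subseteq> seqs.span (E \<inter> A x \<inter> B y))"
    by (rule two_flags_adapted_basis[OF V d])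
      (rule sA sB AV monoI mA mB exI tA tB, assumption?)+
  then obtain E where E: "finite E" "E \<subseteq> ?V" "seqs.independent E"
    "\<And>x y. A x \<inter> B y \<subseteq> seqs.span (E \<inter> A x \<inter> B y)" by blast
  show ?thesis
  proof (rule that[OF E(1-3)])
    have "?V \<subseteq> seqs.span (E \<inter> ?V \<inter> ?V)" using E(4)[of "m + 1" "n + 1"] unfolding tA tB by simp
    then show "?V \<subseteq> seqs.span E" using seqs.span_mono[of "E \<inter> ?V \<inter> ?V" E] by blast
    show "core_ker m n M p \<subseteq> seqs.span (E \<inter> core_ker m n M p)" if "p \<in> grid m n" for p
      using E(4)[of "fst p" "snd p"] AB[OF that] by (simp add: Int_assoc)
    fix b assume b: "b \<in> E"
    \<comment> \<open>The indices at which \<open>b\<close> enters the flags. Membership in an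
      intersection is then the condition \<open>(i, j) \<le> p\<close>, and
      \<open>b \<noteq> 0\<close> excludes index 0.\<close>
    define i where "i = (LEAST x. b \<in> A x)"
    define j where "j = (LEAST y. b \<in> B y)"
    have b0: "b \<noteq> 0" using b E(3) seqs.dependent_zero by blast
    have bA: "b \<in> A (m + 1)" and bB: "b \<in> B (n + 1)" using b E(2) unfolding tA tB by blast+
    have bi: "b \<in> A i" unfolding i_def by (rule LeastI[of "\<lambda>x. b \<in> A x", OF bA])
    have bj: "b \<in> B j" unfolding j_def by (rule LeastI[of "\<lambda>x. b \<in> B x", OF bB])
    have i: "b \<in> A x \<longleftrightarrow> i \<le> x" for x using bi mA Least_le[of "\<lambda>x. b \<in> A x" x] unfolding i_def by blast
    have j: "b \<in> B x \<longleftrightarrow> j \<le> x" for x using bj mB Least_le[of "\<lambda>x. b \<in> B x" x] unfolding j_def by blast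
    have "b \<notin> A 0" "b \<notin> B 0" using b0 by (auto simp: A_def B_def)
    then have "1 \<le> i" "i \<le> m + 1" "1 \<le> j" "j \<le> n + 1" using i[of 0] j[of 0] i[of "m + 1"] j[of "n + 1"] bA bB by auto
    then show "\<exists>i j. 1 \<le> i \<and> i \<le> m + 1 \<and> 1 \<le> j \<and> j \<le> n + 1 \<and>
      (\<forall>p\<in>grid m n. b \<in> core_ker m n M p \<longleftrightarrow> i \<le> fst p \<and> j \<le> snd p)"
      using i j AB by blast
  qed
qed

text \<open>A vector \<open>b\<close> of the adapted basis contributes to the core exactly at the
  points \<open>p\<close> above its entry \<open>(i, j)\<close>. Lifting the prescribed value at
  \<open>(i, j)\<close> to \<open>N corner\<close> therefore settles all these points by naturality,
  and the choices for different \<open>b\<close> are independent. The resulting linear map carries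
  kernels of \<open>M\<close> to kernels of \<open>N\<close>, because these kernels lie in
  \<open>core_ker\<close>.\<close>

lemma core_func_full:
  assumes M: "M \<in> Obj (rep_ee TYPE('k::field) m n)" and N: "N \<in> Obj (rep_ee TYPE('k) m n)"
    and mn: "corner \<in> grid m n"
    and \<phi>: "\<phi> \<in> Hom (rep TYPE('k) (m - 1) (n - 1)) (fobj (core_func m n) M) (fobj (core_func m n) N)"
  shows "\<exists>\<eta>\<in>Hom (rep TYPE('k) m n) M N. fmap (core_func m n) M N \<eta> = \<phi>"
proof -
  note M' = rep_ee_rep[OF M] and N' = rep_ee_rep[OF N]
  let ?V = "fobj M corner" and ?W = "core_ker m n M"
  \<comment> \<open>The extension of \<open>\<phi>\<close> by zero to the edges, where both cores
    vanish; this avoids separate treatment of edge points below.\<close>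
  define ps where "ps p u = (if p \<in> grid (m - 1) (n - 1) then \<phi> p u else 0)" for p u
  have ps_lin: "lin_on (core m n M p) (core m n N p) (ps p)" if p: "p \<in> grid m n" for p
  proof (cases "p \<in> grid (m - 1) (n - 1)")
    case True
    then show ?thesis using hom_lin[OF \<phi> True] unfolding fobj_core_func[OF True] ps_def by simp
  next
    case False
    then show ?thesis
      using seqs.subspace_0[OF core_subspace[OF N' p]] by (auto simp: ps_def lin_on_def)
  qed
  have ps_nat: "ps q (st M p q u) = st N p q (ps p u)"
    if pq: "p \<in> grid m n" "q \<in> grid m n" "p \<le> q" and u: "u \<in> core m n M p" for p q u
  proof (cases "q \<in> grid (m - 1) (n - 1)")
    case True
    then have p: "p \<in> grid (m - 1) (n - 1)"
      using pq by (cases p, cases q) (auto simp: grid_def)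
    have "\<phi> p u \<in> core m n N p"
      using lin_on_in[OF hom_lin[OF \<phi> p]] u unfolding fobj_core_func[OF p] .
    then have "\<phi> q (st M p q u) = st N p q (\<phi> p u)"
      using hom_natural[OF \<phi> p True pq(3)] u st_core_func[OF p True pq(3)] unfolding fobj_core_func[OF p] by metis
    then show ?thesis using p True by (simp only: ps_def if_True)
  next
    case False
    have "st N p q (ps p u) \<in> core m n N q" by (rule core_st[OF N' pq lin_on_in[OF ps_lin[OF pq(1)] u]])
    then show ?thesis
      using False core_edge[OF N' pq(2)] pq(2) inner_grid_iff[of q m n] by (auto simp: ps_def)
  qed
  obtain E where E: "finite E" "E \<subseteq> ?V" "seqs.independent E" "?V \<subseteq> seqs.span E"
    "\<And>p. p \<in> grid m n \<Longrightarrow> ?W p \<subseteq> seqs.span (E \<inter> ?W p)"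
    "\<And>b. b \<in> E \<Longrightarrow> \<exists>i j. 1 \<le> i \<and> i \<le> m + 1 \<and> 1 \<le> j \<and> j \<le> n + 1 \<and>
      (\<forall>p\<in>grid m n. b \<in> ?W p \<longleftrightarrow> i \<le> fst p \<and> j \<le> snd p)"
    by (rule adapted_basis[OF M' mn]) blast
  have "\<exists>w. w \<in> fobj N corner \<and> (\<forall>p\<in>grid m n. b \<in> ?W p \<longrightarrow> st N corner p w = ps p (st M corner p b))"
    if b: "b \<in> E" for b
  proof -
    obtain i j where ij: "1 \<le> i" "1 \<le> j" "\<And>p. p \<in> grid m n \<Longrightarrow> b \<in> ?W p \<longleftrightarrow> i \<le> fst p \<and> j \<le> snd p"
      using E(6)[OF b] by blast
    show ?thesis
    proof (cases "(i, j) \<in> grid m n")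
      case True
      have c: "st M corner (i, j) b \<in> core m n M (i, j)" using ij(3)[OF True] by (simp add: core_ker_def)
      then have "ps (i, j) (st M corner (i, j) b) \<in> fobj N (i, j)"
        using lin_on_in[OF ps_lin[OF True]] core_subset by blast
      then obtain w where w: "w \<in> fobj N corner" "st N corner (i, j) w = ps (i, j) (st M corner (i, j) b)"
        by (rule rep_ee_lift[OF N mn True]) metis
      have "st N corner p w = ps p (st M corner p b)" if p: "p \<in> grid m n" and bp: "b \<in> ?W p" for p
      proof -
        have le: "(i, j) \<le> p" using ij(3)[OF p] bp by (simp add: less_eq_prod_def)
        have bV: "b \<in> ?V" using b E(2) by blast
        have "st N corner p w = st N (i, j) p (st N corner (i, j) w)"
          by (rule rep_st_st[OF N' mn True p corner_le[OF True] le w(1), symmetric])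
        also have "\<dots> = ps p (st M (i, j) p (st M corner (i, j) b))"
          unfolding w(2) by (rule ps_nat[OF True p le c, symmetric])
        also have "\<dots> = ps p (st M corner p b)"
          unfolding rep_st_st[OF M' mn True p corner_le[OF True] le bV] ..
        finally show ?thesis .
      qed
      with w(1) show ?thesis by blast
    next
      case False
      \<comment> \<open>Here \<open>i = m + 1\<close> or \<open>j = n + 1\<close>: the vector never
        reaches the core, nothing is prescribed for it, and zero is a valid image.\<close>
      then have "b \<notin> ?W p" if "p \<in> grid m n" for p
        using ij that by (cases p) (auto simp: grid_def)
      then show ?thesis using seqs.subspace_0[OF rep_subspace[OF N' mn]] by blast
    qed
  qed
  then obtain w where w: "\<And>b. b \<in> E \<Longrightarrow> w b \<in> fobj N corner"
    "\<And>b p. b \<in> E \<Longrightarrow> p \<in> grid m n \<Longrightarrow> b \<in> ?W p \<Longrightarrow> st N corner p (w b) = ps p (st M corner p b)" by metis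
  obtain f where f: "lin f" "\<forall>b\<in>E. f b = w b" using seqs2.linear_independent_extend[OF E(3)] by blast
  have "f ` seqs.span E \<subseteq> fobj N corner"
    unfolding seqs2.linear_span_image[OF f(1), symmetric]
    using w(1) f(2) by (intro seqs.span_minimal rep_subspace[OF N' mn]) auto
  then have f_lin: "lin_on ?V (fobj N corner) f" using E(4) by (intro lin_lin_on[OF f(1)]) blast
  have key: "st N corner p (f v) = ps p (st M corner p v)" if p: "p \<in> grid m n" and v: "v \<in> ?W p" for p v
  proof -
    have 1: "lin_on (?W p) (fobj N p) (\<lambda>v. st N corner p (f v))"
      by (rule lin_on_subset[OF lin_on_comp[OF f_lin rep_st_lin[OF N' mn p corner_le[OF p]]] core_ker_subset])
        (use core_ker_subset lin_on_in[OF lin_on_comp[OF f_lin rep_st_lin[OF N' mn p corner_le[OF p]]]] in blast)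
    have "lin_on (?W p) (core m n M p) (st M corner p)"
      by (rule lin_on_subset[OF rep_st_lin[OF M' mn p corner_le[OF p]] core_ker_subset]) (simp add: core_ker_def)
    then have c: "lin_on (?W p) (core m n N p) (\<lambda>v. ps p (st M corner p v))"
      by (rule lin_on_comp[OF _ ps_lin[OF p]])
    then have 2: "lin_on (?W p) (fobj N p) (\<lambda>v. ps p (st M corner p v))"
      by (rule lin_on_subset[OF _ order_refl subsetD[OF core_subset lin_on_in[OF c]]])
    \<comment> \<open>Both sides of the equation are linear on \<open>?W p\<close> and agree on the
      basis vectors it contains. These span it because the basis is adapted.\<close>
    have "E \<inter> ?W p \<subseteq> {v \<in> ?W p. st N corner p (f v) = ps p (st M corner p v)}"
      using w(2)[OF _ p] f(2) by auto
    then have "seqs.span (E \<inter> ?W p) \<subseteq> {v \<in> ?W p. st N corner p (f v) = ps p (st M corner p v)}"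
      by (rule seqs.span_minimal[OF _ lin_on_equalizer[OF 1 2 core_ker_subspace[OF M' mn p]]])
    then show ?thesis using E(5)[OF p] v by blast
  qed
  obtain \<eta> where \<eta>: "\<eta> \<in> Hom (rep TYPE('k) m n) M N"
    "\<And>p v. p \<in> grid m n \<Longrightarrow> v \<in> ?V \<Longrightarrow> \<eta> p (st M corner p v) = st N corner p (f v)"
  proof (rule hom_induced[OF M N' mn f_lin])
    fix p v assume p: "p \<in> grid m n" and v: "v \<in> ker M p"
    have "st N corner p (f v) = ps p (st M corner p v)"
      using ker_subset_core_ker[OF M' mn p] v by (intro key p) blast
    also have "\<dots> = 0" using v lin_on_0[OF ps_lin[OF p] core_subspace[OF M' p]] by (simp add: ker_def)
    finally show "st N corner p (f v) = 0" .
  qed blast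
  have "fmap (core_func m n) M N \<eta> = \<phi>"
  proof (rule hom_eqI[OF core_func_Hom[OF M' N' \<eta>(1)] \<phi>])
    fix p u assume p: "p \<in> grid (m - 1) (n - 1)" and "u \<in> fobj (fobj (core_func m n) M) p"
    then have u: "u \<in> core m n M p" "u \<in> fobj M p" using core_subset unfolding fobj_core_func[OF p] by blast+
    note p' = inner_grid[OF p]
    obtain v where v: "v \<in> ?V" "u = st M corner p v"
      by (rule rep_ee_lift[OF M mn p' u(2)]) blast
    then have "v \<in> ?W p" using u(1) by (simp add: core_ker_def)
    then have "\<eta> p u = ps p u" unfolding v(2) \<eta>(2)[OF p' v(1)] by (rule key[OF p'])
    then show "fmap (core_func m n) M N \<eta> p u = \<phi> p u"
      unfolding fmap_core_func[OF p u(1)] using p by (simp only: ps_def if_True)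
  qed
  then show ?thesis using \<eta>(1) by blast
qed


section \<open>The core functor is dense\<close>

text \<open>Splits a sequence into a family of sequences indexed by pairs of naturals, through the
  pairing of natural numbers. The map \<open>fill c\<close> below embeds a sequence as the component
  at \<open>c\<close>.\<close>

definition slot :: "nat \<times> nat \<Rightarrow> (nat \<Rightarrow> 'k) \<Rightarrow> nat \<Rightarrow> 'k" where
  "slot c w = (\<lambda>t. w (prod_encode (prod_encode c, t)))"

definition fill :: "nat \<times> nat \<Rightarrow> (nat \<Rightarrow> 'k) \<Rightarrow> nat \<Rightarrow> 'k::zero" where
  "fill c u = (\<lambda>i. let (a, t) = prod_decode i in if a = prod_encode c then u t else 0)"

lemma slot_eqI:
  assumes "\<And>c. slot c u = slot c v" shows "u = v"
proof
  fix i
  obtain a t where "prod_decode i = (a, t)" by fastforce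
  then have "i = prod_encode (prod_encode (prod_decode a), t)" by (metis prod_decode_inverse)
  then show "u i = v i" using fun_cong[OF assms[of "prod_decode a"], of t] by (simp add: slot_def)
qed

lemma slot_fill: "slot d (fill c u) = (if d = c then u else 0)"
  by (auto simp: slot_def fill_def fun_eq_iff)

lemma lin_slot: "lin (slot c)"
  by (rule linI) (auto simp: slot_def scale_def fun_eq_iff)

lemma lin_fill: "lin (fill c)"
  by (rule linI) (auto simp: fill_def scale_def fun_eq_iff split: prod.split)

text \<open>The direct sum of the spaces \<open>X c\<close> with \<open>c \<in> G\<close>, as a
  subspace of the same sequence space; for finite \<open>G\<close> it is again an object of
  \<open>fdVect\<close>.\<close>

definition slot_sum :: "(nat \<times> nat) set \<Rightarrow> (nat \<times> nat \<Rightarrow> (nat \<Rightarrow> 'k::field) set) \<Rightarrow> (nat \<Rightarrow> 'k) set" where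
  "slot_sum G X = {w. \<forall>c. if c \<in> G then slot c w \<in> X c else slot c w = 0}"

lemma slot_sum_subspace:
  assumes "\<And>c. c \<in> G \<Longrightarrow> seqs.subspace (X c)" shows "seqs.subspace (slot_sum G X)"
  unfolding slot_sum_def
proof (rule seqs.subspaceI; (simp only: mem_Collect_eq)?)
  show "\<forall>c. if c \<in> G then slot c 0 \<in> X c else slot c (0 :: nat \<Rightarrow> 'a) = 0"
    unfolding lin_0[OF lin_slot] using assms seqs.subspace_0 by metis
  show "\<forall>c. if c \<in> G then slot c (x + y) \<in> X c else slot c (x + y) = 0"
    if "\<forall>c. if c \<in> G then slot c x \<in> X c else slot c x = 0"
      "\<forall>c. if c \<in> G then slot c y \<in> X c else slot c y = 0" for x y
    using assms that seqs.subspace_add unfolding lin_add[OF lin_slot] by (metis add_0)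
  show "\<forall>c. if c \<in> G then slot c (scale a x) \<in> X c else slot c (scale a x) = 0"
    if "\<forall>c. if c \<in> G then slot c x \<in> X c else slot c x = 0" for x a
    using assms that seqs.subspace_scale unfolding lin_scale[OF lin_slot] by (metis seqs.scale_zero_right)
qed

lemma slot_sum_slot: "w \<in> slot_sum G X \<Longrightarrow> c \<in> G \<Longrightarrow> slot c w \<in> X c"
  and slot_sum_outside: "w \<in> slot_sum G X \<Longrightarrow> c \<notin> G \<Longrightarrow> slot c w = 0"
  unfolding slot_sum_def mem_Collect_eq by metis+

lemma fill_slot_sum:
  assumes "c \<in> G" "u \<in> X c" "\<And>c. c \<in> G \<Longrightarrow> seqs.subspace (X c)"
  shows "fill c u \<in> slot_sum G X"
  using assms by (auto simp: slot_sum_def slot_fill seqs.subspace_0)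

lemma slot_sum_expand:
  assumes "finite G" "w \<in> slot_sum G X" shows "w = (\<Sum>c\<in>G. fill c (slot c w))"
proof (rule slot_eqI)
  fix d
  have "slot d (\<Sum>c\<in>G. fill c (slot c w)) = (\<Sum>c\<in>G. slot d (fill c (slot c w)))"
    by (rule seqs2.linear_sum[OF lin_slot])
  also have "\<dots> = (\<Sum>c\<in>G. if d = c then slot c w else 0)" by (simp only: slot_fill)
  also have "\<dots> = slot d w" using assms slot_sum_outside[OF assms(2), of d] by (simp add: sum.delta')
  finally show "slot d w = slot d (\<Sum>c\<in>G. fill c (slot c w))" ..
qed

lemma slot_sum_fd:
  assumes "finite G" "\<And>c. c \<in> G \<Longrightarrow> fd (X c)" shows "fd (slot_sum G X)"
proof -
  have s: "seqs.subspace (slot_sum G X)" by (rule slot_sum_subspace[OF fd_subspace[OF assms(2)]])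
  have "\<forall>c\<in>G. \<exists>B. finite B \<and> X c = seqs.span B" using assms(2) by (simp add: fd_def)
  then obtain B where B: "\<And>c. c \<in> G \<Longrightarrow> finite (B c)" "\<And>c. c \<in> G \<Longrightarrow> X c = seqs.span (B c)"
    by metis
  define E where "E = (\<Union>c\<in>G. fill c ` B c)"
  have sub: "fill c ` X c \<subseteq> seqs.span E" if "c \<in> G" for c
    unfolding B(2)[OF that] seqs2.linear_span_image[OF lin_fill, symmetric]
    by (rule seqs.span_mono) (use that in \<open>auto simp: E_def\<close>)
  have "w \<in> seqs.span E" if w: "w \<in> slot_sum G X" for w
  proof -
    have "(\<Sum>c\<in>G. fill c (slot c w)) \<in> seqs.span E"
      by (rule seqs.span_sum) (use sub slot_sum_slot[OF w] in blast)
    then show ?thesis using slot_sum_expand[OF assms(1) w] by simp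
  qed
  moreover have "seqs.span E \<subseteq> slot_sum G X"
  proof (rule seqs.span_minimal[OF _ s])
    show "E \<subseteq> slot_sum G X"
      using fill_slot_sum[of _ G _ X, OF _ _ fd_subspace[OF assms(2)]] B(2) seqs.span_base
      unfolding E_def by fastforce
  qed
  ultimately have "slot_sum G X = seqs.span E" by blast
  moreover have "finite E" using assms(1) B(1) by (auto simp: E_def)
  ultimately show ?thesis using s unfolding fd_def by blast
qed

text \<open>
  With \<open>P c\<close> the representation \<open>k\<close> supported on the points above \<open>c\<close>, the preimage of \<open>X\<close> is the
  pushout of the sum of all \<open>P c \<otimes> X c \<rightarrow> X\<close> along the inclusions \<open>P c \<rightarrow> P (1, 1)\<close>, presented as a
  quotient of the constant representation on the direct sum \<open>V\<close> of all \<open>X c\<close>.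
\<close>

lemma core_func_dense:
  assumes X: "X \<in> Obj (rep TYPE('k::field) (m - 1) (n - 1))" and mn: "corner \<in> grid m n"
  shows "\<exists>M\<in>Obj (rep_ee TYPE('k) m n). isomorphic (rep TYPE('k) (m - 1) (n - 1)) (fobj (core_func m n) M) X"
proof -
  let ?G = "grid (m - 1) (n - 1)"
  define V where "V = slot_sum ?G (fobj X)"
  \<comment> \<open>The canonical map to \<open>X p\<close> that sums up all components sitting at
    points below \<open>p\<close>.\<close>
  define acc where "acc p w = (\<Sum>c\<in>{c \<in> ?G. c \<le> p}. st X c p (slot c w))" for p w
  \<comment> \<open>At an inner point this is the kernel of \<open>acc p\<close> on the part of
    \<open>V\<close> supported below \<open>p\<close>. On an edge it is all of that part, as if
    \<open>X\<close> were extended by zero.\<close>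
  define K where "K p = {w \<in> V. (\<forall>c. \<not> c \<le> p \<longrightarrow> slot c w = 0) \<and> (p \<in> ?G \<longrightarrow> acc p w = 0)}" for p
  have fin: "finite ?G" by (simp add: grid_def)
  have V: "fd V" unfolding V_def by (rule slot_sum_fd[OF fin rep_fd[OF X]])
  note Vs = fd_subspace[OF V]
  have slotV: "slot c w \<in> fobj X c" if "w \<in> V" "c \<in> ?G" for c w
    using that unfolding V_def by (rule slot_sum_slot)
  have slotV0: "slot c w = 0" if "w \<in> V" "c \<notin> ?G" for c w
    using that unfolding V_def by (rule slot_sum_outside)
  have acc_lin: "lin_on V (fobj X p) (acc p)" if p: "p \<in> ?G" for p
  proof (rule lin_onI)
    have stl: "lin_on (fobj X c) (fobj X p) (st X c p)" if "c \<in> {c \<in> ?G. c \<le> p}" for c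
      using rep_st_lin[OF X _ p] that by simp
    show "acc p w \<in> fobj X p" if "w \<in> V" for w
      unfolding acc_def
      by (rule seqs.subspace_sum[OF rep_subspace[OF X p]]) (use lin_on_in[OF stl] slotV[OF that] in auto)
    show "acc p (u + v) = acc p u + acc p v" if "u \<in> V" "v \<in> V" for u v
      unfolding acc_def sum.distrib[symmetric] lin_add[OF lin_slot]
      by (rule sum.cong[OF refl]) (use lin_on_add[OF stl] slotV that in auto)
    show "acc p (scale a v) = scale a (acc p v)" if "v \<in> V" for a v
      unfolding acc_def seqs.scale_sum_right lin_scale[OF lin_slot]
      by (rule sum.cong[OF refl]) (use lin_on_scale[OF stl] slotV that in auto)
  qed
  have acc_step: "acc q w = st X p q (acc p w)"
    if pq: "p \<in> ?G" "q \<in> ?G" "p \<le> q" and w: "w \<in> V" "\<And>c. \<not> c \<le> p \<Longrightarrow> slot c w = 0" for p q w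
  proof -
    have "acc q w = (\<Sum>c\<in>{c \<in> ?G. c \<le> p}. st X c q (slot c w))"
      unfolding acc_def
    proof (rule sum.mono_neutral_right)
      show "finite {c \<in> ?G. c \<le> q}" using fin by simp
      show "{c \<in> ?G. c \<le> p} \<subseteq> {c \<in> ?G. c \<le> q}" using pq(3) by (auto intro: order_trans)
      show "\<forall>c\<in>{c \<in> ?G. c \<le> q} - {c \<in> ?G. c \<le> p}. st X c q (slot c w) = 0"
      proof
        fix c assume c: "c \<in> {c \<in> ?G. c \<le> q} - {c \<in> ?G. c \<le> p}"
        then have "slot c w = 0" using w(2) by blast
        then show "st X c q (slot c w) = 0"
          using c lin_on_0[OF rep_st_lin[OF X _ pq(2)] rep_subspace[OF X]] by simp
      qed
    qed
    also have "\<dots> = (\<Sum>c\<in>{c \<in> ?G. c \<le> p}. st X p q (st X c p (slot c w)))"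
      using rep_st_st[OF X _ pq(1,2) _ pq(3) slotV[OF w(1)]] by (intro sum.cong) auto
    also have "\<dots> = st X p q (acc p w)"
      unfolding acc_def using lin_on_in[OF rep_st_lin[OF X _ pq(1)] slotV[OF w(1)]]
      by (intro lin_on_sum[OF rep_st_lin[OF X pq] rep_subspace[OF X pq(1)], symmetric]) auto
    finally show ?thesis .
  qed
  have K: "seqs.subspace (K p)" if "p \<in> grid m n" for p
  proof -
    have 1: "seqs.subspace {w. \<forall>c. \<not> c \<le> p \<longrightarrow> slot c w = 0}"
      by (rule seqs.subspaceI; unfold mem_Collect_eq lin_0[OF lin_slot] lin_add[OF lin_slot] lin_scale[OF lin_slot])
        (metis add_0_left seqs.scale_zero_right)+
    have 2: "seqs.subspace {w \<in> V. p \<in> ?G \<longrightarrow> acc p w = 0}"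
      using lin_on_kernel[OF acc_lin Vs, of p] Vs by (cases "p \<in> ?G") simp_all
    have "K p = {w. \<forall>c. \<not> c \<le> p \<longrightarrow> slot c w = 0} \<inter> {w \<in> V. p \<in> ?G \<longrightarrow> acc p w = 0}"
      by (auto simp: K_def)
    then show ?thesis using seqs.subspace_inter[OF 1 2] by (simp only:)
  qed
  have KV: "K p \<subseteq> V" for p by (auto simp: K_def)
  have K_mono: "K p \<subseteq> K q" if pq: "p \<in> grid m n" "q \<in> grid m n" "p \<le> q" for p q
  proof
    fix w assume w: "w \<in> K p"
    have s: "slot c w = 0" if "\<not> c \<le> q" for c
      using w that pq(3) order_trans[of c p q] by (auto simp only: K_def mem_Collect_eq)
    have "acc q w = 0" if q: "q \<in> ?G"
    proof -
      \<comment> \<open>The inner grid is closed downwards in the grid, so the condition on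
        \<open>acc\<close> is already in force at \<open>p\<close>.\<close>
      have p: "p \<in> ?G" using q pq by (cases p, cases q) (auto simp: grid_def)
      have "acc q w = st X p q (acc p w)" using w by (intro acc_step p q pq) (auto simp only: K_def mem_Collect_eq)
      also have "\<dots> = 0"
        using w p lin_on_0[OF rep_st_lin[OF X p q pq(3)] rep_subspace[OF X p]] by (auto simp only: K_def mem_Collect_eq)
      finally show ?thesis .
    qed
    then show "w \<in> K q" using w s by (auto simp only: K_def mem_Collect_eq)
  qed
  have K0: "K corner = {0}"
  proof -
    have "w = 0" if w: "w \<in> K corner" for w
    proof (rule slot_eqI)
      have wV: "w \<in> V" using w KV by blast
      have "slot c w = 0" for c
      \<comment> \<open>Only the slot at the corner lies below the corner, and there
        \<open>acc\<close> is the identity on \<open>X corner\<close>. If the inner grid is empty,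
        every slot vanishes.\<close>
      proof (cases "c = corner \<and> c \<in> ?G")
        case True
        then have cG: "corner \<in> ?G" by blast
        then have "{d \<in> ?G. d \<le> corner} = {corner}"
          using corner_le[of _ "m - 1" "n - 1"] by (auto intro: order_antisym)
        then have "acc corner w = st X corner corner (slot corner w)" by (simp add: acc_def)
        also have "\<dots> = slot corner w" by (rule rep_st_id[OF X cG slotV[OF wV cG]])
        finally have "acc corner w = slot corner w" .
        moreover have "acc corner w = 0" using w cG unfolding K_def by blast
        ultimately show ?thesis using True by metis
      next
        case False
        show ?thesis
        proof (cases "c \<in> ?G")
          case True
          then have "\<not> c \<le> corner" using False corner_le[OF True] by (auto dest: order_antisym)
          then show ?thesis using w unfolding K_def by blast
        qed (rule slotV0[OF wV])
      qed
      then show "slot c w = slot c 0" for c by (simp only: lin_0[OF lin_slot])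
    qed
    then show ?thesis using seqs.subspace_0[OF K[OF mn]] by blast
  qed
  define M where "M = filt_rep m n V K"
  have M: "M \<in> Obj (rep_ee TYPE('k) m n)"
    and fobj_M: "\<And>p. p \<in> grid m n \<Longrightarrow> fobj M p = proj (K p) ` V"
    and st_M: "\<And>p q v. p \<in> grid m n \<Longrightarrow> q \<in> grid m n \<Longrightarrow> p \<le> q \<Longrightarrow> v \<in> proj (K p) ` V \<Longrightarrow> st M p q v = proj (K q) v"
    and M_sub: "\<And>p. p \<in> grid m n \<Longrightarrow> proj (K p) ` V \<subseteq> V"
    unfolding M_def
    by (rule filt_rep_Obj fobj_filt_rep st_filt_rep proj_image_subset; (rule V K KV K_mono)?; assumption?)+
  note M' = rep_ee_rep[OF M]
  \<comment> \<open>Dying at both edge points means being supported below \<open>(m, snd p)\<close>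
    and below \<open>(fst p, n)\<close>, that is, below \<open>p\<close>. Hence the core at
    \<open>p\<close> is the part of \<open>V\<close> supported below \<open>p\<close> modulo the
    kernel of \<open>acc p\<close>, which \<open>acc p\<close> identifies with
    \<open>X p\<close>.\<close>
  have core: "core m n M p = {w \<in> proj (K p) ` V. \<forall>c. \<not> c \<le> p \<longrightarrow> slot c w = 0}" if p: "p \<in> ?G" for p
  proof -
    note p' = inner_grid[OF p]
    note e = edge_grid[OF p']
    have out: "(m, snd p) \<notin> ?G" "(fst p, n) \<notin> ?G" unfolding inner_grid_iff by auto
    have "w \<in> core m n M p \<longleftrightarrow> (\<forall>c. \<not> c \<le> p \<longrightarrow> slot c w = 0)" if w: "w \<in> proj (K p) ` V" for w
    proof -
      have wV: "w \<in> V" using w M_sub[OF p'] by blast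
      have "w \<in> core m n M p \<longleftrightarrow> w \<in> K (m, snd p) \<and> w \<in> K (fst p, n)"
        using w st_M[OF p' e(1,3) w] st_M[OF p' e(2,4) w] proj_zero_iff[OF K[OF e(1)]] proj_zero_iff[OF K[OF e(2)]]
        unfolding core_def fobj_M[OF p'] by auto
      also have "\<dots> \<longleftrightarrow> (\<forall>c\<in>?G. \<not> c \<le> (m, snd p) \<or> \<not> c \<le> (fst p, n) \<longrightarrow> slot c w = 0)"
        using wV slotV0[OF wV] out unfolding K_def by blast
      also have "\<dots> \<longleftrightarrow> (\<forall>c\<in>?G. \<not> c \<le> p \<longrightarrow> slot c w = 0)"
      proof -
        have "(\<not> c \<le> (m, snd p) \<or> \<not> c \<le> (fst p, n)) \<longleftrightarrow> \<not> c \<le> p" if "c \<in> ?G" for c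
          using that by (cases p) (auto simp: less_eq_prod_def grid_def)
        then show ?thesis by blast
      qed
      also have "\<dots> \<longleftrightarrow> (\<forall>c. \<not> c \<le> p \<longrightarrow> slot c w = 0)" using slotV0[OF wV] by blast
      finally show ?thesis .
    qed
    then show ?thesis using core_subset[of m n M p] unfolding fobj_M[OF p'] by blast
  qed
  have coreV: "core m n M p \<subseteq> V" if "p \<in> ?G" for p
    using core[OF that] M_sub[OF inner_grid[OF that]] by blast
  \<comment> \<open>Since \<open>acc p\<close> vanishes on \<open>K p\<close>, its value does not
    depend on the representative picked by \<open>proj\<close>.\<close>
  have acc_proj: "acc p (proj (K p) w) = acc p w" if p: "p \<in> ?G" and w: "w \<in> V" for p w
  proof -
    have d: "w - proj (K p) w \<in> K p" by (rule proj_diff[OF K[OF inner_grid[OF p]]])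
    have pw: "proj (K p) w \<in> V" by (rule proj_in[OF K[OF inner_grid[OF p]] Vs KV w])
    have "acc p w - acc p (proj (K p) w) = acc p (w - proj (K p) w)"
      by (rule lin_on_diff[OF acc_lin[OF p] Vs w pw, symmetric])
    also have "\<dots> = 0" using d p unfolding K_def by blast
    finally show ?thesis by simp
  qed
  have fobj_C: "\<And>p. p \<in> ?G \<Longrightarrow> fobj (fobj (core_func m n) M) p = core m n M p" by (rule fobj_core_func)
  have hom: "mk_hom (m - 1) (n - 1) (fobj (core_func m n) M) acc \<in> Hom (rep TYPE('k) (m - 1) (n - 1)) (fobj (core_func m n) M) X"
  proof (rule mk_hom_Hom[OF core_func_Obj[OF M']])
    show "lin_on (fobj (fobj (core_func m n) M) p) (fobj X p) (acc p)" if p: "p \<in> ?G" for p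
      unfolding fobj_C[OF p]
      by (rule lin_on_subset[OF acc_lin[OF p] coreV[OF p] lin_on_in[OF acc_lin[OF p] subsetD[OF coreV[OF p]]]])
    fix p q w assume pq: "p \<in> ?G" "q \<in> ?G" "p \<le> q" and "w \<in> fobj (fobj (core_func m n) M) p"
    then have w: "w \<in> core m n M p" "w \<in> V" using coreV[OF pq(1)] unfolding fobj_C[OF pq(1)] by blast+
    have wp: "w \<in> proj (K p) ` V" using w(1) unfolding core[OF pq(1)] by blast
    have "acc q (st M p q w) = acc q w"
      unfolding st_M[OF inner_grid[OF pq(1)] inner_grid[OF pq(2)] pq(3) wp] by (rule acc_proj[OF pq(2) w(2)])
    also have "\<dots> = st X p q (acc p w)"
      using w(1) unfolding core[OF pq(1)] by (intro acc_step pq w(2)) blast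
    finally show "acc q (st (fobj (core_func m n) M) p q w) = st X p q (acc p w)"
      unfolding st_core_func[OF pq w(1)] .
  qed
  have "isomorphic (rep TYPE('k) (m - 1) (n - 1)) (fobj (core_func m n) M) X"
  proof (rule isomorphic_rep[OF core_func_Obj[OF M'] X hom])
    fix p assume p: "p \<in> ?G"
    note p' = inner_grid[OF p]
    have "bij_betw (acc p) (core m n M p) (fobj X p)"
      unfolding bij_betw_def
    proof
      show "inj_on (acc p) (core m n M p)"
      proof (rule inj_onI)
        fix u v assume uv: "u \<in> core m n M p" "v \<in> core m n M p" "acc p u = acc p v"
        have uvV: "u \<in> V" "v \<in> V" using uv coreV[OF p] by blast+
        have "u - v \<in> core m n M p" by (rule seqs.subspace_diff[OF core_subspace[OF M' p'] uv(1,2)])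
        then have c: "u - v \<in> proj (K p) ` V" "\<forall>c. \<not> c \<le> p \<longrightarrow> slot c (u - v) = 0"
          unfolding core[OF p] by blast+
        have "acc p (u - v) = 0" unfolding lin_on_diff[OF acc_lin[OF p] Vs uvV] using uv(3) by simp
        \<comment> \<open>The difference lies both in \<open>K p\<close> and in the image of the
          idempotent \<open>proj (K p)\<close>, whose kernel is \<open>K p\<close>; so it is
          zero.\<close>
        then have "u - v \<in> K p" using c seqs.subspace_diff[OF Vs uvV] unfolding K_def by blast
        then have "proj (K p) (u - v) = 0" by (rule proj_zero[OF K[OF p']])
        moreover obtain x where "u - v = proj (K p) x" using c(1) by blast
        ultimately have "u - v = 0" using proj_proj[OF K[OF p'] K[OF p'] order_refl, of x] by simp
        then show "u = v" by simp
      qed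
      have "x \<in> acc p ` core m n M p" if x: "x \<in> fobj X p" for x
      proof -
        \<comment> \<open>The vector \<open>x\<close> placed in the slot of \<open>p\<close> itself,
          where the structure map into \<open>X p\<close> is the identity. Its representative modulo
          \<open>K p\<close> stays supported below \<open>p\<close>.\<close>
        let ?f = "fill p x"
        have f: "?f \<in> V" unfolding V_def by (rule fill_slot_sum[where X = "fobj X", OF p x rep_subspace[OF X]])
        have "acc p ?f = (\<Sum>c\<in>{c \<in> ?G. c \<le> p}. if c = p then x else 0)"
          unfolding acc_def
        proof (rule sum.cong[OF refl])
          fix c assume c: "c \<in> {c \<in> ?G. c \<le> p}"
          then show "st X c p (slot c ?f) = (if c = p then x else 0)"
            using lin_on_0[OF rep_st_lin[OF X _ p] rep_subspace[OF X], of c] rep_st_id[OF X p x] by (simp add: slot_fill)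
        qed
        also have "\<dots> = x" using p fin by (simp add: sum.delta)
        finally have a: "acc p (proj (K p) ?f) = x" using acc_proj[OF p f] by simp
        have "slot c (proj (K p) ?f) = 0" if "\<not> c \<le> p" for c
        proof -
          have "?f - proj (K p) ?f \<in> K p" by (rule proj_diff[OF K[OF p']])
          then have "slot c (?f - proj (K p) ?f) = 0" using that unfolding K_def by blast
          then have "slot c ?f - slot c (proj (K p) ?f) = 0" unfolding lin_diff[OF lin_slot] .
          moreover have "slot c ?f = 0" using that by (auto simp: slot_fill)
          ultimately show ?thesis by simp
        qed
        then have "proj (K p) ?f \<in> core m n M p" unfolding core[OF p] using f by blast
        then have "acc p (proj (K p) ?f) \<in> acc p ` core m n M p" by (rule imageI)
        then show ?thesis unfolding a .
      qed
      then show "acc p ` core m n M p = fobj X p"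
        using lin_on_in[OF acc_lin[OF p]] coreV[OF p] by blast
    qed
    moreover have "bij_betw (mk_hom (m - 1) (n - 1) (fobj (core_func m n) M) acc p) (core m n M p) (fobj X p) =
      bij_betw (acc p) (core m n M p) (fobj X p)"
      by (rule bij_betw_cong) (rule mk_hom_apply[OF p], simp only: fobj_C[OF p])
    ultimately show "bij_betw (mk_hom (m - 1) (n - 1) (fobj (core_func m n) M) acc p) (fobj (fobj (core_func m n) M) p) (fobj X p)"
      unfolding fobj_C[OF p] by blast
  qed
  then show ?thesis using M by blast
qed


section \<open>Indecomposable coreless representations\<close>

text \<open>For a zero object the identity and the zero endomorphism coincide. Conversely every
  value is the image of the value at the corner, so all of them vanish with it.\<close>

lemma zero_object_rep_ee_iff:
  assumes z: "z \<in> Obj (rep_ee TYPE('k::field) m n)" and mn: "corner \<in> grid m n"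
  shows "zero_object (rep_ee TYPE('k) m n) z \<longleftrightarrow> fobj z corner = {0}"
proof
  note z' = rep_ee_rep[OF z]
  assume "zero_object (rep_ee TYPE('k) m n) z"
  then have u: "\<exists>!f. f \<in> Hom (rep TYPE('k) m n) z z" using z by (simp add: zero_object_def rep_ee_simps)
  have i: "mk_hom m n z (\<lambda>p v. v) \<in> Hom (rep TYPE('k) m n) z z"
    by (rule mk_hom_Hom[OF z']) (simp_all add: lin_on_def)
  have 0: "mk_hom m n z (\<lambda>p v. 0) \<in> Hom (rep TYPE('k) m n) z z"
    by (rule mk_hom_Hom[OF z'])
      (simp_all add: lin_on_def seqs.subspace_0[OF rep_subspace[OF z']] lin_on_0[OF rep_st_lin[OF z'] rep_subspace[OF z']])
  have "v = 0" if "v \<in> fobj z corner" for v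
    using ex1E[OF u] i 0 mk_hom_apply[OF mn that] by metis
  then show "fobj z corner = {0}" using seqs.subspace_0[OF rep_subspace[OF z' mn]] by blast
next
  note z' = rep_ee_rep[OF z]
  assume c: "fobj z corner = {0}"
  have zp: "fobj z p = {0}" if p: "p \<in> grid m n" for p
  proof -
    have "v = 0" if "v \<in> fobj z p" for v
    proof -
      obtain u where u: "u \<in> fobj z corner" "v = st z corner p u" by (rule rep_ee_lift[OF z mn p \<open>v \<in> fobj z p\<close>])
      have "u = 0" using u(1) unfolding c by simp
      then show ?thesis
        unfolding u(2) using lin_on_0[OF rep_st_lin[OF z' mn p corner_le[OF p]] rep_subspace[OF z' mn]] by simp
    qed
    then show ?thesis using seqs.subspace_0[OF rep_subspace[OF z' p]] by blast
  qed
  show "zero_object (rep_ee TYPE('k) m n) z"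
    unfolding zero_object_def rep_ee_simps
  proof (intro conjI ballI ex1I)
    show "z \<in> Obj (rep_ee TYPE('k) m n)" by (rule z)
    fix a assume "a \<in> Obj (rep_ee TYPE('k) m n)"
    then have a: "a \<in> Obj (rep TYPE('k) m n)" by (rule rep_ee_rep)
    have 0: "st a p q 0 = 0" if "p \<in> grid m n" "q \<in> grid m n" "p \<le> q" for p q
      by (rule lin_on_0[OF rep_st_lin[OF a that] rep_subspace[OF a that(1)]])
    show 1: "mk_hom m n z (\<lambda>p v. 0) \<in> Hom (rep TYPE('k) m n) z a"
      by (rule mk_hom_Hom[OF z']) (simp_all add: lin_on_def seqs.subspace_0[OF rep_subspace[OF a]] 0)
    show 2: "mk_hom m n a (\<lambda>p v. 0) \<in> Hom (rep TYPE('k) m n) a z"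
      by (rule mk_hom_Hom[OF a])
        (simp_all add: lin_on_def zp lin_on_0[OF rep_st_lin[OF z'] rep_subspace[OF z']])
    show "f = mk_hom m n z (\<lambda>p v. 0)" if f: "f \<in> Hom (rep TYPE('k) m n) z a" for f
      by (rule hom_eqI[OF f 1]) (use hom_0[OF z' f] zp in \<open>auto simp: mk_hom_apply\<close>)
    show "f = mk_hom m n a (\<lambda>p v. 0)" if f: "f \<in> Hom (rep TYPE('k) m n) a z" for f
      by (rule hom_eqI[OF f 2]) (use lin_on_in[OF hom_lin[OF f]] zp in \<open>auto simp: mk_hom_apply\<close>)
  qed
qed

lemma direct_sum_rep_eeE:
  assumes "direct_sum (rep_ee TYPE('k::field) m n) s a b"
  obtains i j p q where
    "s \<in> Obj (rep_ee TYPE('k) m n)" "a \<in> Obj (rep_ee TYPE('k) m n)" "b \<in> Obj (rep_ee TYPE('k) m n)"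
    "i \<in> Hom (rep TYPE('k) m n) a s" "j \<in> Hom (rep TYPE('k) m n) b s"
    "p \<in> Hom (rep TYPE('k) m n) s a" "q \<in> Hom (rep TYPE('k) m n) s b"
    "\<And>x v. x \<in> grid m n \<Longrightarrow> v \<in> fobj a x \<Longrightarrow> p x (i x v) = v"
    "\<And>x v. x \<in> grid m n \<Longrightarrow> v \<in> fobj b x \<Longrightarrow> q x (j x v) = v"
    "\<And>x v. x \<in> grid m n \<Longrightarrow> v \<in> fobj a x \<Longrightarrow> q x (i x v) = 0"
    "\<And>x v. x \<in> grid m n \<Longrightarrow> v \<in> fobj s x \<Longrightarrow> i x (p x v) + j x (q x v) = v"
proof -
  obtain i j p q where *:
    "s \<in> Obj (rep_ee TYPE('k) m n)" "a \<in> Obj (rep_ee TYPE('k) m n)" "b \<in> Obj (rep_ee TYPE('k) m n)"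
    "i \<in> Hom (rep TYPE('k) m n) a s" "j \<in> Hom (rep TYPE('k) m n) b s"
    "p \<in> Hom (rep TYPE('k) m n) s a" "q \<in> Hom (rep TYPE('k) m n) s b"
    and e: "Cmp (rep TYPE('k) m n) a s a p i = Ide (rep TYPE('k) m n) a"
      "Cmp (rep TYPE('k) m n) b s b q j = Ide (rep TYPE('k) m n) b"
      "Cmp (rep TYPE('k) m n) a s b q i = Zero (rep TYPE('k) m n) a b"
      "Add (rep TYPE('k) m n) s s (Cmp (rep TYPE('k) m n) s a s i p) (Cmp (rep TYPE('k) m n) s b s j q)
        = Ide (rep TYPE('k) m n) s"
    using assms unfolding direct_sum_def rep_ee_simps by blast
  have *: "p x (i x v) = v" "q x (i x v) = 0" if "x \<in> grid m n" "v \<in> fobj a x" for x v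
    using fun_cong[OF fun_cong[OF e(1)], of x v] fun_cong[OF fun_cong[OF e(3)], of x v]
    unfolding rep_Cmp rep_Ide rep_Zero mk_hom_apply[OF that] by blast+
  moreover have "q x (j x v) = v" if "x \<in> grid m n" "v \<in> fobj b x" for x v
    using fun_cong[OF fun_cong[OF e(2)], of x v]
    unfolding rep_Cmp rep_Ide mk_hom_apply[OF that] by blast
  moreover have "i x (p x v) + j x (q x v) = v" if "x \<in> grid m n" "v \<in> fobj s x" for x v
    using fun_cong[OF fun_cong[OF e(4)], of x v]
    unfolding rep_Add rep_Cmp rep_Ide mk_hom_apply[OF that] by blast
  ultimately show ?thesis using that \<open>s \<in> _\<close> \<open>a \<in> _\<close> \<open>b \<in> _\<close> \<open>i \<in> _\<close> \<open>j \<in> _\<close> \<open>p \<in> _\<close> \<open>q \<in> _\<close> by blast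
qed

text \<open>The summands are the images of \<open>g\<close> and of
  \<open>v \<mapsto> v - g v\<close>, each filtered by the traces of the kernels of
  \<open>M\<close>. Inclusions and projections respect these filtrations and so induce morphisms,
  and the direct sum equations need only be tested at the corner.\<close>

lemma direct_sum_idempotent:
  assumes M: "M \<in> Obj (rep_ee TYPE('k::field) m n)" and mn: "corner \<in> grid m n"
    and g: "lin g" and gV: "\<And>v. v \<in> fobj M corner \<Longrightarrow> g v \<in> fobj M corner"
    and gg: "\<And>v. g (g v) = g v"
    and gK: "\<And>p v. p \<in> grid m n \<Longrightarrow> v \<in> ker M p \<Longrightarrow> g v \<in> ker M p"
  obtains a b where "direct_sum (rep_ee TYPE('k) m n) M a b"
    "fobj a corner = g ` fobj M corner" "fobj b corner = (\<lambda>v. v - g v) ` fobj M corner"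
proof -
  note M' = rep_ee_rep[OF M]
  let ?V = "fobj M corner"
  note Vs = rep_subspace[OF M' mn]
  \<comment> \<open>The construction common to both summands, to be applied to \<open>g\<close> and
    to its complement.\<close>
  have *: "\<exists>a i p. a \<in> Obj (rep_ee TYPE('k) m n) \<and> fobj a corner = e ` ?V \<and>
      i \<in> Hom (rep TYPE('k) m n) a M \<and> p \<in> Hom (rep TYPE('k) m n) M a \<and>
      (\<forall>v\<in>e ` ?V. i corner v = v) \<and> (\<forall>v\<in>?V. p corner v = e v)"
    if e: "lin e" "\<forall>v\<in>?V. e v \<in> ?V" "\<forall>p\<in>grid m n. \<forall>v\<in>ker M p. e v \<in> ker M p" for e
  proof -
    let ?U = "e ` ?V" and ?K = "\<lambda>p. ker M p \<inter> e ` ?V"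
    have U: "fd ?U" by (rule fd_lin_image[OF e(1) rep_fd[OF M' mn]])
    have UV: "?U \<subseteq> ?V" using e(2) by blast
    have K: "seqs.subspace (?K p)" if "p \<in> grid m n" for p
      by (rule seqs.subspace_inter[OF ker_subspace[OF M' mn that] fd_subspace[OF U]])
    have K_mono: "?K p \<subseteq> ?K q" if "p \<in> grid m n" "q \<in> grid m n" "p \<le> q" for p q
      using ker_mono[OF M' mn that] by blast
    have K0: "?K corner = {0}"
      using ker_corner[OF M' mn] seqs.subspace_0[OF fd_subspace[OF U]] by blast
    define a where "a = filt_rep m n ?U ?K"
    have a: "a \<in> Obj (rep_ee TYPE('k) m n)" "fobj a corner = ?U"
      "\<And>p. p \<in> grid m n \<Longrightarrow> ker a p = ?K p"
      unfolding a_def by (rule filt_rep_Obj fobj_filt_corner ker_filt; (rule U K Int_lower2 K_mono mn K0)?; assumption?)+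
    obtain i where i: "i \<in> Hom (rep TYPE('k) m n) a M" "\<And>v. v \<in> fobj a corner \<Longrightarrow> i corner v = v"
    proof (rule hom_induced_corner[OF a(1) M' mn, of "\<lambda>v. v"])
      show "lin_on (fobj a corner) (fobj M corner) (\<lambda>v. v)" using UV by (auto simp: lin_on_def a(2))
    qed (auto simp: a(3))
    obtain p where p: "p \<in> Hom (rep TYPE('k) m n) M a" "\<And>v. v \<in> ?V \<Longrightarrow> p corner v = e v"
    proof (rule hom_induced_corner[OF M rep_ee_rep[OF a(1)] mn, of e])
      show "lin_on ?V (fobj a corner) e" unfolding a(2) by (rule lin_lin_on[OF e(1)]) blast
      show "e v \<in> ker a x" if "x \<in> grid m n" "v \<in> ker M x" for x v
        unfolding a(3)[OF that(1)] using e(3) that ker_subset by blast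
    qed blast
    show ?thesis using a i p by blast
  qed
  let ?h = "\<lambda>v. v - g v"
  have h: "lin ?h"
    by (rule linI) (simp_all only: lin_add[OF g] lin_scale[OF g] seqs.scale_right_diff_distrib add_diff_add)
  have hV: "v - g v \<in> ?V" if "v \<in> ?V" for v by (rule seqs.subspace_diff[OF Vs that gV[OF that]])
  have gh: "g (v - g v) = 0" for v by (simp add: lin_diff[OF g] gg)
  have hh: "(v - g v) - g (v - g v) = v - g v" for v by (simp add: gh)
  have hK: "v - g v \<in> ker M p" if "p \<in> grid m n" "v \<in> ker M p" for p v
    by (rule seqs.subspace_diff[OF ker_subspace[OF M' mn that(1)] that(2) gK[OF that]])
  obtain a i p where a: "a \<in> Obj (rep_ee TYPE('k) m n)" "fobj a corner = g ` ?V"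
      "i \<in> Hom (rep TYPE('k) m n) a M" "p \<in> Hom (rep TYPE('k) m n) M a"
      "\<And>v. v \<in> g ` ?V \<Longrightarrow> i corner v = v" "\<And>v. v \<in> ?V \<Longrightarrow> p corner v = g v"
    using *[OF g] gV gK by - (drule meta_mp, blast, drule meta_mp, blast, elim exE conjE, rule that; (assumption | (erule bspec, assumption)))
  obtain b j q where b: "b \<in> Obj (rep_ee TYPE('k) m n)" "fobj b corner = ?h ` ?V"
      "j \<in> Hom (rep TYPE('k) m n) b M" "q \<in> Hom (rep TYPE('k) m n) M b"
      "\<And>v. v \<in> ?h ` ?V \<Longrightarrow> j corner v = v" "\<And>v. v \<in> ?V \<Longrightarrow> q corner v = v - g v"
    using *[OF h] hV hK by - (drule meta_mp, blast, drule meta_mp, blast, elim exE conjE, rule that; (assumption | (erule bspec, assumption)))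
  note a' = rep_ee_rep[OF a(1)] and b' = rep_ee_rep[OF b(1)]
  have sub: "g ` ?V \<subseteq> ?V" "?h ` ?V \<subseteq> ?V" using gV hV by blast+
  have homs: "Zero (rep TYPE('k) m n) x y \<in> Hom (rep TYPE('k) m n) x y"
    if "x \<in> Obj (rep TYPE('k) m n)" "y \<in> Obj (rep TYPE('k) m n)" for x y
    unfolding rep_Zero
    by (rule mk_hom_Hom[OF that(1)])
      (simp_all add: lin_on_def seqs.subspace_0[OF rep_subspace[OF that(2)]] lin_on_0[OF rep_st_lin[OF that(2)] rep_subspace[OF that(2)]])
  note I = category.Ide_in[OF category_rep] and C = category.Cmp_in[OF category_rep]
  have "Cmp (rep TYPE('k) m n) a M a p i = Ide (rep TYPE('k) m n) a"
  proof (rule hom_eq_corner[OF a(1) mn C[OF a' M' a' a(3,4)] I[OF a']])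
    fix v assume v: "v \<in> fobj a corner"
    then have "v \<in> g ` ?V" "v \<in> ?V" using sub unfolding a(2) by blast+
    then show "Cmp (rep TYPE('k) m n) a M a p i corner v = Ide (rep TYPE('k) m n) a corner v"
      unfolding rep_Cmp rep_Ide mk_hom_apply[OF mn v] using a(5,6) gg by auto
  qed
  moreover have "Cmp (rep TYPE('k) m n) b M b q j = Ide (rep TYPE('k) m n) b"
  proof (rule hom_eq_corner[OF b(1) mn C[OF b' M' b' b(3,4)] I[OF b']])
    fix v assume v: "v \<in> fobj b corner"
    then have "v \<in> ?h ` ?V" "v \<in> ?V" using sub unfolding b(2) by blast+
    then show "Cmp (rep TYPE('k) m n) b M b q j corner v = Ide (rep TYPE('k) m n) b corner v"
      unfolding rep_Cmp rep_Ide mk_hom_apply[OF mn v] using b(5,6) hh by auto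
  qed
  moreover have "Cmp (rep TYPE('k) m n) b M a p j = Zero (rep TYPE('k) m n) b a"
  proof (rule hom_eq_corner[OF b(1) mn C[OF b' M' a' b(3) a(4)] homs[OF b' a']])
    fix v assume v: "v \<in> fobj b corner"
    then have "v \<in> ?h ` ?V" "v \<in> ?V" using sub unfolding b(2) by blast+
    then show "Cmp (rep TYPE('k) m n) b M a p j corner v = Zero (rep TYPE('k) m n) b a corner v"
      unfolding rep_Cmp rep_Zero mk_hom_apply[OF mn v] using b(5) a(6) gh by auto
  qed
  moreover have "Cmp (rep TYPE('k) m n) a M b q i = Zero (rep TYPE('k) m n) a b"
  proof (rule hom_eq_corner[OF a(1) mn C[OF a' M' b' a(3) b(4)] homs[OF a' b']])
    fix v assume v: "v \<in> fobj a corner"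
    then have "v \<in> g ` ?V" "v \<in> ?V" using sub unfolding a(2) by blast+
    then show "Cmp (rep TYPE('k) m n) a M b q i corner v = Zero (rep TYPE('k) m n) a b corner v"
      unfolding rep_Cmp rep_Zero mk_hom_apply[OF mn v] using a(5) b(6) gg by auto
  qed
  moreover have "Add (rep TYPE('k) m n) M M (Cmp (rep TYPE('k) m n) M a M i p) (Cmp (rep TYPE('k) m n) M b M j q)
    = Ide (rep TYPE('k) m n) M"
  proof (rule hom_eq_corner[OF M mn _ I[OF M']])
    note ip = C[OF M' a' M' a(4,3)] and jq = C[OF M' b' M' b(4,3)]
    show "Add (rep TYPE('k) m n) M M (Cmp (rep TYPE('k) m n) M a M i p) (Cmp (rep TYPE('k) m n) M b M j q)
      \<in> Hom (rep TYPE('k) m n) M M"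
      unfolding rep_Add
    proof (rule mk_hom_Hom[OF M'])
      fix x assume x: "x \<in> grid m n"
      note l = hom_lin[OF ip x] hom_lin[OF jq x]
      show "lin_on (fobj M x) (fobj M x) (\<lambda>v. Cmp (rep TYPE('k) m n) M a M i p x v + Cmp (rep TYPE('k) m n) M b M j q x v)"
      proof (rule lin_onI)
        show "Cmp (rep TYPE('k) m n) M a M i p x v + Cmp (rep TYPE('k) m n) M b M j q x v \<in> fobj M x"
          if "v \<in> fobj M x" for v
          by (rule seqs.subspace_add[OF rep_subspace[OF M' x] lin_on_in[OF l(1) that] lin_on_in[OF l(2) that]])
      qed (simp_all only: lin_on_add[OF l(1)] lin_on_add[OF l(2)] lin_on_scale[OF l(1)] lin_on_scale[OF l(2)]
          seqs.scale_right_distrib ac_simps)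
    next
      fix x y v assume xy: "x \<in> grid m n" "y \<in> grid m n" "x \<le> y" and v: "v \<in> fobj M x"
      show "Cmp (rep TYPE('k) m n) M a M i p y (st M x y v) + Cmp (rep TYPE('k) m n) M b M j q y (st M x y v) =
        st M x y (Cmp (rep TYPE('k) m n) M a M i p x v + Cmp (rep TYPE('k) m n) M b M j q x v)"
        unfolding hom_natural[OF ip xy v] hom_natural[OF jq xy v]
        by (rule lin_on_add[OF rep_st_lin[OF M' xy] lin_on_in[OF hom_lin[OF ip xy(1)] v]
              lin_on_in[OF hom_lin[OF jq xy(1)] v], symmetric])
    qed
    fix v assume v: "v \<in> fobj M corner"
    then show "Add (rep TYPE('k) m n) M M (Cmp (rep TYPE('k) m n) M a M i p) (Cmp (rep TYPE('k) m n) M b M j q) corner v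
      = Ide (rep TYPE('k) m n) M corner v"
      unfolding rep_Add rep_Cmp rep_Ide mk_hom_apply[OF mn v] using a(5,6) b(5,6) by auto
  qed
  ultimately have "direct_sum (rep_ee TYPE('k) m n) M a b"
    unfolding direct_sum_def rep_ee_simps using M a(1,3,4) b(1,3,4) by blast
  then show ?thesis using that a(2) b(2) by blast
qed

section \<open>The generators and their indecomposability\<close>

definition e0 :: "nat \<Rightarrow> 'k::field" where "e0 = (\<lambda>i. if i = 0 then 1 else 0)"

lemma line_eq_scale: "v \<in> line \<Longrightarrow> v = scale (v 0) e0"
  by (auto simp: line_def e0_def scale_def fun_eq_iff)

lemma e0_line: "e0 \<in> line" and e0_nonzero: "e0 \<noteq> (0 :: nat \<Rightarrow> 'k::field)"
  by (auto simp: e0_def line_def fun_eq_iff)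

lemma fd_line: "fd (line :: (nat \<Rightarrow> 'k::field) set)"
proof -
  have "(line :: (nat \<Rightarrow> 'k) set) = seqs.span {e0}"
  proof
    show "line \<subseteq> seqs.span {e0 :: nat \<Rightarrow> 'k}"
      using line_eq_scale by (metis seqs.span_base seqs.span_scale singletonI subsetI)
    show "seqs.span {e0} \<subseteq> (line :: (nat \<Rightarrow> 'k) set)"
      by (rule seqs.span_minimal)
        (use e0_line in \<open>auto intro!: seqs.subspaceI simp: line_def scale_def\<close>)
  qed
  then show ?thesis unfolding fd_def by (metis finite.emptyI finite.insertI seqs.subspace_span)
qed

abbreviation generator :: "'k::field itself \<Rightarrow> nat \<Rightarrow> nat \<Rightarrow> nat \<Rightarrow> nat \<Rightarrow> 'k grid_rep" where
  "generator k m n i j \<equiv> indicator_rep k m n {(x, y) \<in> grid m n. x < i \<or> y < j}"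

lemma fobj_generator:
  "p \<in> grid m n \<Longrightarrow> fobj (generator TYPE('k::field) m n i j) p = (if fst p < i \<or> snd p < j then line else {0})"
  by (cases p) (simp add: indicator_rep_def indicator_space_def)

lemma st_generator:
  assumes "p \<in> grid m n" "q \<in> grid m n" "p \<le> q" "v \<in> fobj (generator TYPE('k::field) m n i j) p"
  shows "st (generator TYPE('k::field) m n i j) p q v = (if fst q < i \<or> snd q < j then v else 0)"
  using assms by (cases p, cases q) (auto simp: indicator_rep_def indicator_space_def)

text \<open>The support is closed downwards: a nonzero target forces a nonzero source, so each
  structure map is the identity of the line or a map onto zero, and these compose.\<close>

lemma generator_Obj: "generator TYPE('k::field) m n i j \<in> Obj (rep_ee TYPE('k) m n)"
proof -
  let ?g = "generator TYPE('k) m n i j"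
  let ?t = "\<lambda>p q v. if fst q < i \<or> snd q < j then v else 0"
  let ?S = "\<lambda>p. if fst p < i \<or> snd p < j then line else {0 :: nat \<Rightarrow> 'k}"
  have "?g = mk_rep m n ?S ?t"
    unfolding indicator_rep_def mk_rep_def
    by (auto simp: fun_eq_iff indicator_space_def restrict_def)
  moreover have "mk_rep m n ?S ?t \<in> Obj (rep TYPE('k) m n)"
  proof (rule mk_rep_Obj)
    have "fd {0 :: nat \<Rightarrow> 'k}"
      unfolding fd_def by (metis finite.emptyI seqs.span_empty seqs.subspace_single_0)
    then show "fd (?S p)" for p using fd_line[where 'k = 'k] by simp
    show "lin_on (?S p) (?S q) (?t p q)" for p q
      using seqs.subspace_0[OF fd_subspace[OF fd_line]] by (auto simp: lin_on_def)
    show "?t p p v = v" if "v \<in> ?S p" for p v using that by (auto split: if_splits)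
    show "?t q r (?t p q v) = ?t p r v" if "q \<le> r" for p q r :: "nat \<times> nat" and v :: "nat \<Rightarrow> 'k"
      using that by (auto simp: less_eq_prod_def)
  qed
  ultimately have "?g \<in> Obj (rep TYPE('k) m n)" by simp
  moreover have "st ?g p q ` fobj ?g p = fobj ?g q"
    if pq: "p \<in> grid m n" "q \<in> grid m n" "p \<le> q" for p q
  proof -
    have "st ?g p q ` fobj ?g p = ?t p q ` fobj ?g p"
      by (rule image_cong[OF refl st_generator[OF pq]])
    also have "\<dots> = fobj ?g q"
      unfolding fobj_generator[OF pq(1)] fobj_generator[OF pq(2)] using pq(3) e0_line
      by (auto simp: less_eq_prod_def)
    finally show ?thesis .
  qed
  ultimately show ?thesis unfolding rep_ee_Obj_iff by blast
qed

lemma ee_generatorsE: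
  assumes "s \<in> ee_generators TYPE('k::field) m n"
  obtains i j where "s = generator TYPE('k) m n i j" "1 \<le> i" "i \<le> m + 1" "1 \<le> j" "j \<le> n + 1" "(i, j) \<noteq> (1, 1)"
  using assms unfolding ee_generators_def by blast

text \<open>If \<open>x < i\<close>, the support contains the end \<open>(x, n)\<close> of the
  column through \<open>p = (x, y)\<close>; if \<open>y < j\<close>, it contains the end
  \<open>(m, y)\<close> of the row. So one of the two maps that kill a core element is the
  identity.\<close>

lemma generator_coreless: "generator TYPE('k::field) m n i j \<in> coreless TYPE('k) m n"
proof (rule coreless_subsetI[OF generator_Obj])
  fix p v assume p: "p \<in> grid m n" and v: "v \<in> core m n (generator TYPE('k) m n i j) p"
  note e = edge_grid[OF p]
  from v have v': "v \<in> fobj (generator TYPE('k) m n i j) p"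
    "st (generator TYPE('k) m n i j) p (m, snd p) v = 0" "st (generator TYPE('k) m n i j) p (fst p, n) v = 0"
    unfolding core_def by blast+
  show "v = 0"
    using v'(2,3) v'(1)[unfolded fobj_generator[OF p]]
    unfolding st_generator[OF p e(1,3) v'(1)] st_generator[OF p e(2,4) v'(1)] by (auto split: if_splits)
qed

text \<open>Corelessness is transported because isomorphisms preserve cores. The value at the corner
  is one-dimensional, so in any decomposition one summand vanishes at the corner and is a zero
  object.\<close>

lemma isomorphic_generator:
  assumes e: "e \<in> Obj (rep_ee TYPE('k::field) m n)" and mn: "corner \<in> grid m n"
    and s: "s \<in> ee_generators TYPE('k) m n" and iso: "isomorphic (rep_ee TYPE('k) m n) e s"
  shows "e \<in> coreless TYPE('k) m n" "indecomposable (rep_ee TYPE('k) m n) e"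
proof -
  note e' = rep_ee_rep[OF e]
  obtain i j where ij: "s = generator TYPE('k) m n i j" "1 \<le> i" "1 \<le> j" "(i, j) \<noteq> (1, 1)"
    using s by (rule ee_generatorsE)
  have s_core: "s \<in> coreless TYPE('k) m n" unfolding ij(1) by (rule generator_coreless)
  have s': "s \<in> Obj (rep TYPE('k) m n)" unfolding ij(1) by (rule rep_ee_rep[OF generator_Obj])
  \<comment> \<open>Excluding \<open>(1, 1)\<close> is exactly what keeps the corner in the
    support.\<close>
  have sc: "fobj s corner = line"
    unfolding ij(1) fobj_generator[OF mn] using ij(2-) by (auto simp: corner_def)
  obtain f g where fg: "f \<in> Hom (rep TYPE('k) m n) e s" "g \<in> Hom (rep TYPE('k) m n) s e"
    "Cmp (rep TYPE('k) m n) e s e g f = Ide (rep TYPE('k) m n) e"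
    "Cmp (rep TYPE('k) m n) s e s f g = Ide (rep TYPE('k) m n) s"
    using iso unfolding isomorphic_def iso_def rep_ee_simps by blast
  have gf: "g x (f x v) = v" if "x \<in> grid m n" "v \<in> fobj e x" for x v
    using fun_cong[OF fun_cong[OF fg(3)], of x v] unfolding rep_Cmp rep_Ide mk_hom_apply[OF that] .
  have fg': "f x (g x v) = v" if "x \<in> grid m n" "v \<in> fobj s x" for x v
    using fun_cong[OF fun_cong[OF fg(4)], of x v] unfolding rep_Cmp rep_Ide mk_hom_apply[OF that] .
  show "e \<in> coreless TYPE('k) m n"
  proof (rule coreless_subsetI[OF e])
    fix p v assume p: "p \<in> grid m n" and v: "v \<in> core m n e p"
    have "f p v = 0" using core_hom[OF e' s' fg(1) p v] s_core p by (auto simp: coreless_def)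
    then have "v = g p 0" using gf[OF p subsetD[OF core_subset v]] by simp
    then show "v = 0" using hom_0[OF s' fg(2) p] by simp
  qed
  define u where "u = g corner e0"
  have e0s: "e0 \<in> fobj s corner" unfolding sc by (rule e0_line)
  have u: "u \<in> fobj e corner" unfolding u_def by (rule lin_on_in[OF hom_lin[OF fg(2) mn] e0s])
  have u0: "u \<noteq> 0" using fg'[OF mn e0s] hom_0[OF e' fg(1) mn] e0_nonzero unfolding u_def by metis
  have multiple: "\<exists>c. w = scale c u" if w: "w \<in> fobj e corner" for w
  proof -
    have "f corner w \<in> line" using lin_on_in[OF hom_lin[OF fg(1) mn] w] unfolding sc .
    then have "f corner w = scale (f corner w 0) e0" by (rule line_eq_scale)
    then have "g corner (f corner w) = scale (f corner w 0) u"
      unfolding u_def lin_on_scale[OF hom_lin[OF fg(2) mn] e0s, symmetric] by simp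
    then show ?thesis using gf[OF mn w] by metis
  qed
  show "indecomposable (rep_ee TYPE('k) m n) e"
    unfolding indecomposable_def
  proof (intro conjI allI impI)
    show "\<not> zero_object (rep_ee TYPE('k) m n) e"
      unfolding zero_object_rep_ee_iff[OF e mn] using u u0 by blast
    fix a b assume "direct_sum (rep_ee TYPE('k) m n) e a b"
    then obtain i j p q where ab: "a \<in> Obj (rep_ee TYPE('k) m n)" "b \<in> Obj (rep_ee TYPE('k) m n)"
      and h: "i \<in> Hom (rep TYPE('k) m n) a e" "j \<in> Hom (rep TYPE('k) m n) b e"
        "p \<in> Hom (rep TYPE('k) m n) e a" "q \<in> Hom (rep TYPE('k) m n) e b"
      and pi: "\<And>x v. x \<in> grid m n \<Longrightarrow> v \<in> fobj a x \<Longrightarrow> p x (i x v) = v"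
      and qj: "\<And>x v. x \<in> grid m n \<Longrightarrow> v \<in> fobj b x \<Longrightarrow> q x (j x v) = v"
      and qi: "\<And>x v. x \<in> grid m n \<Longrightarrow> v \<in> fobj a x \<Longrightarrow> q x (i x v) = 0"
      by (rule direct_sum_rep_eeE) blast
    have zero: "fobj c corner = {0}"
      if c: "c \<in> Obj (rep_ee TYPE('k) m n)" and r: "r \<in> Hom (rep TYPE('k) m n) e c"
        and l: "l \<in> Hom (rep TYPE('k) m n) c e" and rl: "\<And>v. v \<in> fobj c corner \<Longrightarrow> r corner (l corner v) = v"
        and ru: "r corner u = 0" for c r l
    proof -
      have "v = 0" if v: "v \<in> fobj c corner" for v
      proof -
        obtain d where d: "l corner v = scale d u"
          using multiple[OF lin_on_in[OF hom_lin[OF l mn] v]] by blast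
        have "v = r corner (scale d u)" using rl[OF v] d by simp
        also have "\<dots> = 0" using lin_on_scale[OF hom_lin[OF r mn] u, of d] ru by simp
        finally show ?thesis .
      qed
      then show ?thesis using seqs.subspace_0[OF rep_subspace[OF rep_ee_rep[OF c] mn]] by blast
    qed
    have pu: "p corner u \<in> fobj a corner" by (rule lin_on_in[OF hom_lin[OF h(3) mn] u])
    obtain c where c: "i corner (p corner u) = scale c u"
      using multiple[OF lin_on_in[OF hom_lin[OF h(1) mn] pu]] by blast
    \<comment> \<open>The idempotent composite of \<open>p\<close> and \<open>i\<close> acts on the
      line of \<open>u\<close> by a scalar \<open>c\<close>. If \<open>c = 0\<close>, then
      \<open>p\<close> kills \<open>u\<close>, because \<open>i\<close> has \<open>p\<close> as left
      inverse; otherwise \<open>q\<close> kills \<open>u\<close>, because it kills the image of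
      \<open>i\<close>.\<close>
    have "p corner u = 0 \<or> q corner u = 0"
    proof (cases "c = 0")
      case True
      then have "p corner u = p corner 0" using pi[OF mn pu] c by simp
      then show ?thesis using hom_0[OF e' h(3) mn] by simp
    next
      case False
      have "scale c (q corner u) = 0"
        using qi[OF mn pu] lin_on_scale[OF hom_lin[OF h(4) mn] u, of c] c by simp
      then show ?thesis using False by simp
    qed
    then have "fobj a corner = {0} \<or> fobj b corner = {0}"
      using zero[OF ab(1) h(3,1) pi[OF mn]] zero[OF ab(2) h(4,2) qj[OF mn]] by blast
    then show "zero_object (rep_ee TYPE('k) m n) a \<or> zero_object (rep_ee TYPE('k) m n) b"
      unfolding zero_object_rep_ee_iff[OF ab(1) mn] zero_object_rep_ee_iff[OF ab(2) mn] .
  qed (rule e)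
qed

text \<open>A one-dimensional filtered space is determined by the set of points whose kernel is
  everything. Exchanging \<open>b\<close> with the basis vector \<open>e0\<close> of the line
  respects the kernels in both directions.\<close>

lemma isomorphic_generatorI:
  assumes M: "M \<in> Obj (rep_ee TYPE('k::field) m n)" and mn: "corner \<in> grid m n"
    and b: "b \<noteq> 0" "b \<in> fobj M corner" "\<And>v. v \<in> fobj M corner \<Longrightarrow> \<exists>c. v = scale c b"
    and ij: "\<And>p. p \<in> grid m n \<Longrightarrow> b \<in> ker M p \<longleftrightarrow> i \<le> fst p \<and> j \<le> snd p"
  shows "isomorphic (rep_ee TYPE('k) m n) M (generator TYPE('k) m n i j)"
proof -
  let ?g = "generator TYPE('k) m n i j"
  note M' = rep_ee_rep[OF M] and g = generator_Obj[where 'k = 'k, of m n i j]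
  note g' = rep_ee_rep[OF g]
  have "b \<notin> ker M corner" using b(1) ker_corner[OF M' mn] by blast
  then have gc: "fobj ?g corner = line"
    unfolding fobj_generator[OF mn] using ij[OF mn] by auto
  \<comment> \<open>In a one-dimensional space a kernel that misses \<open>b\<close> is
    zero.\<close>
  have kerM: "v = 0" if p: "p \<in> grid m n" "\<not> (i \<le> fst p \<and> j \<le> snd p)" and v: "v \<in> ker M p" for p v
  proof -
    obtain c where c: "v = scale c b" using b(3) v ker_subset by blast
    have "c = 0"
    proof (rule ccontr)
      assume "c \<noteq> 0"
      then have "b = scale (inverse c) v" using c by simp
      then have "b \<in> ker M p" using seqs.subspace_scale[OF ker_subspace[OF M' mn p(1)] v] by simp
      then show False using ij[OF p(1)] p(2) by blast
    qed
    then show ?thesis using c by simp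
  qed
  have kerg: "ker ?g p = (if i \<le> fst p \<and> j \<le> snd p then line else {0})" if p: "p \<in> grid m n" for p
  proof -
    have "ker ?g p = {v \<in> line. (if fst p < i \<or> snd p < j then v else 0) = 0}"
      unfolding ker_def gc using st_generator[where 'k = 'k, OF mn p corner_le[OF p], of _ i j, unfolded gc] by (intro Collect_cong) auto
    then show ?thesis using seqs.subspace_0[OF fd_subspace[OF fd_line]] by auto
  qed
  obtain f where f: "lin f" "f b = e0"
    using seqs2.linear_independent_extend[of "{b}" "\<lambda>_. e0"] b(1) by auto
  obtain h where h: "lin h" "h (e0 :: nat \<Rightarrow> 'k) = b"
    using seqs2.linear_independent_extend[of "{e0}" "\<lambda>_. b"] e0_nonzero by auto
  have fV: "f v \<in> line" if "v \<in> fobj M corner" for v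
    using b(3)[OF that] lin_scale[OF f(1)] f(2) seqs.subspace_scale[OF fd_subspace[OF fd_line] e0_line] by auto
  have hV: "h v \<in> fobj M corner" if "v \<in> line" for v
  proof -
    have "h v = scale (v 0) b" using line_eq_scale[OF that] lin_scale[OF h(1)] h(2) by metis
    then show ?thesis using seqs.subspace_scale[OF rep_subspace[OF M' mn] b(2)] by simp
  qed
  obtain \<eta> where \<eta>: "\<eta> \<in> Hom (rep TYPE('k) m n) M ?g" "\<And>v. v \<in> fobj M corner \<Longrightarrow> \<eta> corner v = f v"
  proof (rule hom_induced_corner[OF M g' mn, of f])
    show "lin_on (fobj M corner) (fobj ?g corner) f" unfolding gc by (rule lin_lin_on[OF f(1) fV])
    fix p v assume p: "p \<in> grid m n" and v: "v \<in> ker M p"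
    show "f v \<in> ker ?g p"
    proof (cases "i \<le> fst p \<and> j \<le> snd p")
      case True
      then show ?thesis using fV[OF subsetD[OF ker_subset v]] unfolding kerg[OF p] by simp
    next
      case False
      then show ?thesis using kerM[OF p False v] lin_0[OF f(1)] unfolding kerg[OF p] by auto
    qed
  qed blast
  obtain \<theta> where \<theta>: "\<theta> \<in> Hom (rep TYPE('k) m n) ?g M" "\<And>v. v \<in> fobj ?g corner \<Longrightarrow> \<theta> corner v = h v"
  proof (rule hom_induced_corner[OF g M' mn, of h])
    show "lin_on (fobj ?g corner) (fobj M corner) h" unfolding gc by (rule lin_lin_on[OF h(1) hV])
    fix p v assume p: "p \<in> grid m n" and v: "v \<in> ker ?g p"
    show "h v \<in> ker M p"
    proof (cases "i \<le> fst p \<and> j \<le> snd p")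
      case True
      then have vl: "v \<in> line" using v unfolding kerg[OF p] by simp
      have "h v = scale (v 0) b" using line_eq_scale[OF vl] lin_scale[OF h(1)] h(2) by metis
      then show ?thesis using ij[OF p] True seqs.subspace_scale[OF ker_subspace[OF M' mn p]] by simp
    next
      case False
      then have "h v = 0" using v lin_0[OF h(1)] unfolding kerg[OF p] by (auto split: if_splits)
      then show ?thesis using seqs.subspace_0[OF ker_subspace[OF M' mn p]] by simp
    qed
  qed blast
  note I = category.Ide_in[OF category_rep] and C = category.Cmp_in[OF category_rep]
  have "Cmp (rep TYPE('k) m n) M ?g M \<theta> \<eta> = Ide (rep TYPE('k) m n) M"
  proof (rule hom_eq_corner[OF M mn C[OF M' g' M' \<eta>(1) \<theta>(1)] I[OF M']])
    fix v assume v: "v \<in> fobj M corner"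
    obtain c where c: "v = scale c b" using b(3)[OF v] by blast
    have "\<theta> corner (\<eta> corner v) = h (f v)" unfolding \<eta>(2)[OF v] by (rule \<theta>(2)) (simp only: gc fV[OF v])
    also have "\<dots> = v" unfolding c lin_scale[OF f(1)] lin_scale[OF h(1)] f(2) h(2) ..
    finally show "Cmp (rep TYPE('k) m n) M ?g M \<theta> \<eta> corner v = Ide (rep TYPE('k) m n) M corner v"
      unfolding rep_Cmp rep_Ide mk_hom_apply[OF mn v] .
  qed
  moreover have "Cmp (rep TYPE('k) m n) ?g M ?g \<eta> \<theta> = Ide (rep TYPE('k) m n) ?g"
  proof (rule hom_eq_corner[OF g mn C[OF g' M' g' \<theta>(1) \<eta>(1)] I[OF g']])
    fix v assume v: "v \<in> fobj ?g corner"
    have vl: "v \<in> line" using v unfolding gc .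
    have "\<eta> corner (\<theta> corner v) = f (h v)" unfolding \<theta>(2)[OF v] by (rule \<eta>(2)[OF hV[OF vl]])
    also have "\<dots> = f (h (scale (v 0) e0))" using line_eq_scale[OF vl] by simp
    also have "\<dots> = scale (v 0) e0" unfolding lin_scale[OF h(1)] lin_scale[OF f(1)] f(2) h(2) ..
    also have "\<dots> = v" using line_eq_scale[OF vl] by simp
    finally show "Cmp (rep TYPE('k) m n) ?g M ?g \<eta> \<theta> corner v = Ide (rep TYPE('k) m n) ?g corner v"
      unfolding rep_Cmp rep_Ide mk_hom_apply[OF mn v] .
  qed
  ultimately show ?thesis
    unfolding isomorphic_def iso_def rep_ee_simps using \<eta>(1) \<theta>(1) by blast
qed

text \<open>
  For coreless \<open>M\<close> the kernels are the intersections of two flags, so the projection onto a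
  vector of a basis adapted to both flags is an idempotent endomorphism of \<open>M\<close>.
\<close>

lemma coreless_indecomposable:
  assumes M: "M \<in> coreless TYPE('k::field) m n" and mn: "corner \<in> grid m n"
    and ind: "indecomposable (rep_ee TYPE('k) m n) M"
  shows "\<exists>s\<in>ee_generators TYPE('k) m n. isomorphic (rep_ee TYPE('k) m n) M s"
proof -
  have M1: "M \<in> Obj (rep_ee TYPE('k) m n)" using M by (simp add: coreless_def)
  note M' = rep_ee_rep[OF M1]
  let ?V = "fobj M corner"
  \<comment> \<open>Without a core, the kernels of \<open>M\<close> themselves are the intersections
    of the two flags.\<close>
  have kW: "core_ker m n M p = ker M p" if "p \<in> grid m n" for p
    using M that by (auto simp: core_ker_def ker_def coreless_def)
  obtain E where E: "E \<subseteq> ?V" "seqs.independent E" "?V \<subseteq> seqs.span E"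
    "\<And>p. p \<in> grid m n \<Longrightarrow> core_ker m n M p \<subseteq> seqs.span (E \<inter> core_ker m n M p)"
    "\<And>b. b \<in> E \<Longrightarrow> \<exists>i j. 1 \<le> i \<and> i \<le> m + 1 \<and> 1 \<le> j \<and> j \<le> n + 1 \<and>
      (\<forall>p\<in>grid m n. b \<in> core_ker m n M p \<longleftrightarrow> i \<le> fst p \<and> j \<le> snd p)"
    by (rule adapted_basis[OF M' mn]) blast
  have V0: "?V \<noteq> {0}"
    using ind zero_object_rep_ee_iff[OF M1 mn] unfolding indecomposable_def by blast
  have "E \<noteq> {}"
    using E(3) V0 seqs.subspace_0[OF rep_subspace[OF M' mn]] by auto
  then obtain b where b: "b \<in> E" by blast
  have b0: "b \<noteq> 0" using b E(2) seqs.dependent_zero by blast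
  have bV: "b \<in> ?V" using b E(1) by blast
  obtain i j where ij: "1 \<le> i" "i \<le> m + 1" "1 \<le> j" "j \<le> n + 1"
    "\<And>p. p \<in> grid m n \<Longrightarrow> b \<in> ker M p \<longleftrightarrow> i \<le> fst p \<and> j \<le> snd p"
    using E(5)[OF b] kW by metis
  \<comment> \<open>The coordinate projection to \<open>b\<close> with respect to the adapted
    basis.\<close>
  obtain g where g: "lin g" "\<And>x. x \<in> E \<Longrightarrow> g x = (if x = b then b else 0)"
      "range g = seqs.span ((\<lambda>x. if x = b then b else 0) ` E)"
    using seqs2.linear_independent_extend_subspace[OF E(2), of "\<lambda>x. if x = b then b else 0"] by blast
  have "range g \<subseteq> seqs.span {b}"
    unfolding g(3) by (intro seqs.span_minimal) (auto intro: seqs.span_base seqs.span_zero)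
  then have g_mult: "\<exists>c. g v = scale c b" for v by (auto simp: seqs.span_singleton)
  have gb: "g b = b" using g(2)[OF b] by simp
  have gg: "g (g v) = g v" for v using g_mult[of v] lin_scale[OF g(1)] gb by auto
  have gV: "g v \<in> ?V" for v
    using g_mult[of v] seqs.subspace_scale[OF rep_subspace[OF M' mn] bV] by auto
  have gK: "g v \<in> ker M p" if p: "p \<in> grid m n" and v: "v \<in> ker M p" for p v
  proof -
    \<comment> \<open>Each kernel is spanned by the basis vectors it contains, and \<open>g\<close>
      sends a basis vector to itself or to zero.\<close>
    have "g ` (E \<inter> ker M p) \<subseteq> ker M p"
      using g(2) seqs.subspace_0[OF ker_subspace[OF M' mn p]] by auto
    then have "seqs.span (g ` (E \<inter> ker M p)) \<subseteq> ker M p"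
      by (rule seqs.span_minimal[OF _ ker_subspace[OF M' mn p]])
    then show ?thesis
      using E(4)[OF p] v unfolding kW[OF p] seqs2.linear_span_image[OF g(1)] by blast
  qed
  obtain x y where xy: "direct_sum (rep_ee TYPE('k) m n) M x y"
    "fobj x corner = g ` ?V" "fobj y corner = (\<lambda>v. v - g v) ` ?V"
    by (rule direct_sum_idempotent[OF M1 mn g(1) gV gg gK])
  have xy_Obj: "x \<in> Obj (rep_ee TYPE('k) m n)" "y \<in> Obj (rep_ee TYPE('k) m n)"
    using xy(1) by (simp_all add: direct_sum_def)
  have "zero_object (rep_ee TYPE('k) m n) x \<or> zero_object (rep_ee TYPE('k) m n) y"
    using ind xy(1) unfolding indecomposable_def by blast
  \<comment> \<open>The summand \<open>x\<close> contains \<open>b\<close> and is not zero, so the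
    complement \<open>y\<close> is zero and \<open>g\<close> is the identity: the line of
    \<open>b\<close> is the whole value at the corner.\<close>
  moreover have "b \<in> fobj x corner" unfolding xy(2) using bV gb by (metis imageI)
  ultimately have "fobj y corner = {0}"
    using b0 unfolding zero_object_rep_ee_iff[OF xy_Obj(1) mn] zero_object_rep_ee_iff[OF xy_Obj(2) mn] by blast
  then have "v - g v = 0" if "v \<in> ?V" for v using that unfolding xy(3) by blast
  then have "\<exists>c. v = scale c b" if "v \<in> ?V" for v using g_mult[of v] that by auto
  then have "isomorphic (rep_ee TYPE('k) m n) M (generator TYPE('k) m n i j)"
    by (rule isomorphic_generatorI[OF M1 mn b0 bV _ ij(5)])
  moreover have "(i, j) \<noteq> (1, 1)"
    using ij(5)[OF mn] b0 ker_corner[OF M' mn] by (auto simp: corner_def)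
  ultimately show ?thesis using ij(1-4) unfolding ee_generators_def by blast
qed

text \<open>Closure under sums and summands holds because morphisms map cores into cores: core
  elements of a sum have zero components, and core elements of a summand map to zero in the
  sum.\<close>

lemma is_C_ee_coreless:
  assumes mn: "corner \<in> grid m n"
  shows "is_C_ee TYPE('k::field) m n (coreless TYPE('k) m n)"
  unfolding is_C_ee_def subcategory_with_indecomposables_def
proof (intro conjI)
  show "coreless TYPE('k) m n \<subseteq> Obj (rep_ee TYPE('k) m n)" by (auto simp: coreless_def)
  show "closed_under_direct_sums (rep_ee TYPE('k) m n) (coreless TYPE('k) m n)"
    unfolding closed_under_direct_sums_def
  proof (intro conjI allI impI ballI)
    fix z assume zz: "zero_object (rep_ee TYPE('k) m n) z"
    then have z: "z \<in> Obj (rep_ee TYPE('k) m n)" by (simp add: zero_object_def)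
    then have c: "fobj z corner = {0}" using zz zero_object_rep_ee_iff[OF _ mn] by blast
    show "z \<in> coreless TYPE('k) m n"
    proof (rule coreless_subsetI[OF z])
      fix p v assume p: "p \<in> grid m n" and "v \<in> core m n z p"
      then have "v \<in> fobj z p" using core_subset by blast
      then obtain u where "u \<in> fobj z corner" "v = st z corner p u" by (rule rep_ee_lift[OF z mn p])
      then show "v = 0"
        using c lin_on_0[OF rep_st_lin[OF rep_ee_rep[OF z] mn p corner_le[OF p]] rep_subspace[OF rep_ee_rep[OF z] mn]] by simp
    qed
  next
    fix s a b assume ab: "a \<in> coreless TYPE('k) m n" "b \<in> coreless TYPE('k) m n"
      and "direct_sum (rep_ee TYPE('k) m n) s a b"
    then obtain i j p q where s: "s \<in> Obj (rep_ee TYPE('k) m n)"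
      and h: "i \<in> Hom (rep TYPE('k) m n) a s" "j \<in> Hom (rep TYPE('k) m n) b s"
        "p \<in> Hom (rep TYPE('k) m n) s a" "q \<in> Hom (rep TYPE('k) m n) s b"
      and sum: "\<And>x v. x \<in> grid m n \<Longrightarrow> v \<in> fobj s x \<Longrightarrow> i x (p x v) + j x (q x v) = v"
      by - (erule direct_sum_rep_eeE, blast)
    have ab': "a \<in> Obj (rep TYPE('k) m n)" "b \<in> Obj (rep TYPE('k) m n)"
      using ab by (simp_all add: coreless_def rep_ee_rep)
    show "s \<in> coreless TYPE('k) m n"
    proof (rule coreless_subsetI[OF s])
      fix x v assume x: "x \<in> grid m n" and v: "v \<in> core m n s x"
      have "p x v = 0" "q x v = 0"
        using core_hom[OF rep_ee_rep[OF s] ab'(1) h(3) x v] core_hom[OF rep_ee_rep[OF s] ab'(2) h(4) x v] ab x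
        by (auto simp: coreless_def)
      then show "v = 0"
        using sum[OF x subsetD[OF core_subset v]] hom_0[OF ab'(1) h(1) x] hom_0[OF ab'(2) h(2) x] by simp
    qed
  qed
  show "closed_under_summands (rep_ee TYPE('k) m n) (coreless TYPE('k) m n)"
    unfolding closed_under_summands_def
  proof (intro ballI allI impI)
    fix s a b assume s: "s \<in> coreless TYPE('k) m n" and "direct_sum (rep_ee TYPE('k) m n) s a b"
    then obtain i j p q where ab: "a \<in> Obj (rep_ee TYPE('k) m n)" "b \<in> Obj (rep_ee TYPE('k) m n)"
      and h: "i \<in> Hom (rep TYPE('k) m n) a s" "j \<in> Hom (rep TYPE('k) m n) b s"
        "p \<in> Hom (rep TYPE('k) m n) s a" "q \<in> Hom (rep TYPE('k) m n) s b"
      and pi: "\<And>x v. x \<in> grid m n \<Longrightarrow> v \<in> fobj a x \<Longrightarrow> p x (i x v) = v"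
      and qj: "\<And>x v. x \<in> grid m n \<Longrightarrow> v \<in> fobj b x \<Longrightarrow> q x (j x v) = v"
      by - (erule direct_sum_rep_eeE, blast)
    have s': "s \<in> Obj (rep TYPE('k) m n)" using s by (simp add: coreless_def rep_ee_rep)
    have "c \<in> coreless TYPE('k) m n"
      if c: "c \<in> Obj (rep_ee TYPE('k) m n)" and l: "l \<in> Hom (rep TYPE('k) m n) c s"
        and r: "r \<in> Hom (rep TYPE('k) m n) s c"
        and rl: "\<And>x v. x \<in> grid m n \<Longrightarrow> v \<in> fobj c x \<Longrightarrow> r x (l x v) = v" for c l r
    proof (rule coreless_subsetI[OF c])
      fix x v assume x: "x \<in> grid m n" and v: "v \<in> core m n c x"
      have "l x v = 0" using core_hom[OF rep_ee_rep[OF c] s' l x v] s x by (auto simp: coreless_def)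
      then show "v = 0" using rl[OF x subsetD[OF core_subset v]] hom_0[OF s' r x] by simp
    qed
    from this[OF ab(1) h(1,3) pi] this[OF ab(2) h(2,4) qj]
    show "a \<in> coreless TYPE('k) m n \<and> b \<in> coreless TYPE('k) m n" by blast
  qed
  show "{e \<in> coreless TYPE('k) m n. indecomposable (rep_ee TYPE('k) m n) e} =
    {e \<in> Obj (rep_ee TYPE('k) m n). \<exists>s\<in>ee_generators TYPE('k) m n. isomorphic (rep_ee TYPE('k) m n) e s}"
  proof -
    have "coreless TYPE('k) m n \<subseteq> Obj (rep_ee TYPE('k) m n)" by (auto simp: coreless_def)
    then show ?thesis
      using isomorphic_generator[where 'k = 'k, OF _ mn] coreless_indecomposable[where 'k = 'k, OF _ mn] by blast
  qed
qed

text \<open>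
  Every object is a finite direct sum of indecomposables, by induction on the rank of the value at
  \<open>(1, 1)\<close>; so a subcategory closed under sums and summands is determined by its indecomposables.
\<close>

lemma subcategory_subset:
  assumes mn: "corner \<in> grid m n"
    and X: "subcategory_with_indecomposables (rep_ee TYPE('k::field) m n) S X"
    and Y: "subcategory_with_indecomposables (rep_ee TYPE('k) m n) S Y"
  shows "X \<subseteq> Y"
proof -
  have "M \<in> Y" if "M \<in> X" "rank_le (fobj M corner) d" for M d
    using that
  proof (induction d arbitrary: M)
    case 0
    have M: "M \<in> Obj (rep_ee TYPE('k) m n)"
      using 0(1) X unfolding subcategory_with_indecomposables_def by blast
    have "fobj M corner = {0}"
      using rank_le_0[OF 0(2)] seqs.subspace_0[OF rep_subspace[OF rep_ee_rep[OF M] mn]] by blast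
    then have "zero_object (rep_ee TYPE('k) m n) M" unfolding zero_object_rep_ee_iff[OF M mn] .
    then show ?case using Y unfolding subcategory_with_indecomposables_def closed_under_direct_sums_def by blast
  next
    case (Suc d)
    have M: "M \<in> Obj (rep_ee TYPE('k) m n)"
      using Suc(2) X unfolding subcategory_with_indecomposables_def by blast
    consider "zero_object (rep_ee TYPE('k) m n) M" | "indecomposable (rep_ee TYPE('k) m n) M"
      | a b where "direct_sum (rep_ee TYPE('k) m n) M a b"
        "\<not> zero_object (rep_ee TYPE('k) m n) a" "\<not> zero_object (rep_ee TYPE('k) m n) b"
      using M unfolding indecomposable_def by blast
    then show ?case
    proof cases
      case 1
      then show ?thesis using Y unfolding subcategory_with_indecomposables_def closed_under_direct_sums_def by blast
    next
      case 2
      then have "M \<in> {e \<in> X. indecomposable (rep_ee TYPE('k) m n) e}" using Suc(2) by blast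
      also have "\<dots> = {e \<in> Y. indecomposable (rep_ee TYPE('k) m n) e}"
        using X Y unfolding subcategory_with_indecomposables_def by (elim conjE) (rule trans, assumption, rule sym)
      finally show ?thesis by blast
    next
      case 3
      obtain i j p q where ab: "a \<in> Obj (rep_ee TYPE('k) m n)" "b \<in> Obj (rep_ee TYPE('k) m n)"
        and h: "i \<in> Hom (rep TYPE('k) m n) a M" "j \<in> Hom (rep TYPE('k) m n) b M"
          "p \<in> Hom (rep TYPE('k) m n) M a" "q \<in> Hom (rep TYPE('k) m n) M b"
        and pi: "\<And>x v. x \<in> grid m n \<Longrightarrow> v \<in> fobj a x \<Longrightarrow> p x (i x v) = v"
        and qj: "\<And>x v. x \<in> grid m n \<Longrightarrow> v \<in> fobj b x \<Longrightarrow> q x (j x v) = v"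
        and qi: "\<And>x v. x \<in> grid m n \<Longrightarrow> v \<in> fobj a x \<Longrightarrow> q x (i x v) = 0"
        using 3(1) by (rule direct_sum_rep_eeE) blast
      note M' = rep_ee_rep[OF M] and a' = rep_ee_rep[OF ab(1)] and b' = rep_ee_rep[OF ab(2)]
      \<comment> \<open>A summand embeds by \<open>l\<close> into the value of \<open>M\<close> at
        the corner as a proper subspace, which lowers the rank. The missed vector \<open>w\<close>
        comes from the other, nonzero summand.\<close>
      have drop: "rank_le (fobj c corner) d"
        if c: "c \<in> Obj (rep TYPE('k) m n)" and l: "l \<in> Hom (rep TYPE('k) m n) c M"
          and inj: "\<And>v. v \<in> fobj c corner \<Longrightarrow> l corner v = 0 \<Longrightarrow> v = 0"
          and w: "w \<in> fobj M corner" "w \<notin> l corner ` fobj c corner" for c l w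
      proof -
        note L = hom_lin[OF l mn]
        have "rank_le (l corner ` fobj c corner) d"
          by (rule rank_le_drop[OF lin_on_image_subspace[OF L rep_subspace[OF c mn]] _ w Suc(3)])
            (use lin_on_in[OF L] in blast)
        moreover have "lin_on (fobj c corner) (l corner ` fobj c corner) (l corner)"
          by (rule lin_on_subset[OF L order_refl]) (rule imageI)
        ultimately show ?thesis
          using rank_le_inj[OF _ rep_subspace[OF c mn] inj] by blast
      qed
      obtain u where u: "u \<in> fobj a corner" "u \<noteq> 0"
        using 3(2) seqs.subspace_0[OF rep_subspace[OF a' mn]] unfolding zero_object_rep_ee_iff[OF ab(1) mn] by blast
      obtain v where v: "v \<in> fobj b corner" "v \<noteq> 0"
        using 3(3) seqs.subspace_0[OF rep_subspace[OF b' mn]] unfolding zero_object_rep_ee_iff[OF ab(2) mn] by blast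
      have iu: "i corner u \<in> fobj M corner" and jv: "j corner v \<in> fobj M corner"
        using lin_on_in[OF hom_lin[OF h(1) mn] u(1)] lin_on_in[OF hom_lin[OF h(2) mn] v(1)] by blast+
      \<comment> \<open>The images of the two summands meet only in zero: \<open>x\<close> is
        recovered by \<open>q\<close> from the common image, while \<open>q\<close> kills the image
        of \<open>i\<close>.\<close>
      have disj: "x = 0" if "x \<in> fobj b corner" "y \<in> fobj a corner" "j corner x = i corner y" for x y
        using qj[OF mn that(1)] qi[OF mn that(2)] that(3) by simp
      have "rank_le (fobj a corner) d"
      proof (rule drop[OF a' h(1) _ jv])
        show "x = 0" if "x \<in> fobj a corner" "i corner x = 0" for x
          using pi[OF mn that(1)] that(2) hom_0[OF M' h(3) mn] by simp
        show "j corner v \<notin> i corner ` fobj a corner" using disj[OF v(1)] v(2) by blast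
      qed
      moreover have "rank_le (fobj b corner) d"
      proof (rule drop[OF b' h(2) _ iu])
        show j0: "x = 0" if "x \<in> fobj b corner" "j corner x = 0" for x
          using qj[OF mn that(1)] that(2) hom_0[OF M' h(4) mn] by simp
        show "i corner u \<notin> j corner ` fobj b corner"
        proof
          assume "i corner u \<in> j corner ` fobj b corner"
          then obtain x where x: "x \<in> fobj b corner" "i corner u = j corner x" by blast
          then have "x = 0" using disj[OF x(1) u(1)] by simp
          then have "i corner u = 0" using x(2) hom_0[OF b' h(2) mn] by simp
          then have "u = 0" using pi[OF mn u(1)] hom_0[OF M' h(3) mn] by simp
          then show False using u(2) by simp
        qed
      qed
      moreover have "a \<in> X" "b \<in> X"
        using X Suc(2) 3(1) unfolding subcategory_with_indecomposables_def closed_under_summands_def by blast+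
      ultimately have "a \<in> Y" "b \<in> Y" using Suc(1) by blast+
      then show ?thesis
        using Y 3(1) unfolding subcategory_with_indecomposables_def closed_under_direct_sums_def by blast
    qed
  qed
  moreover have "\<exists>d. rank_le (fobj M corner) d" if "M \<in> X" for M
  proof -
    have "M \<in> Obj (rep_ee TYPE('k) m n)"
      using that X unfolding subcategory_with_indecomposables_def by blast
    then show ?thesis by (intro fd_rank_le rep_fd[OF rep_ee_rep mn])
  qed
  ultimately show ?thesis by blast
qed

theorem theorem1p7:
  fixes m n :: nat
  assumes "m \<ge> 1" and "n \<ge> 1"
  shows "(\<exists>!\<C>. is_C_ee TYPE('k::field) m n \<C>) \<and>
    (\<forall>\<C>. is_C_ee TYPE('k) m n \<C> \<longrightarrow>
      equivalent_categories (quotient_cat (rep_ee TYPE('k) m n) \<C>)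
        (rep TYPE('k) (m - 1) (n - 1)))"
proof -
  have mn: "corner \<in> grid m n" using assms by (simp add: corner_def grid_def)
  note C = is_C_ee_coreless[OF mn, where 'k = 'k]
  \<comment> \<open>Both subcategories have the same indecomposables, so each contains the other.
    The equivalence then has to be shown for \<open>coreless\<close> only.\<close>
  have unique: "\<C> = coreless TYPE('k) m n" if "is_C_ee TYPE('k) m n \<C>" for \<C>
    using subcategory_subset[OF mn] that C unfolding is_C_ee_def by (metis subset_antisym)
  have "equivalent_categories (quotient_cat (rep_ee TYPE('k) m n) (coreless TYPE('k) m n))
      (rep TYPE('k) (m - 1) (n - 1))"
  proof (rule category_quotient_equiv[OF category_rep_ee category_rep is_functor_core_func])
    show "\<exists>f\<in>Hom (rep_ee TYPE('k) m n) M N. fmap (core_func m n) M N f = g"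
      if "M \<in> Obj (rep_ee TYPE('k) m n)" "N \<in> Obj (rep_ee TYPE('k) m n)"
        "g \<in> Hom (rep TYPE('k) (m - 1) (n - 1)) (fobj (core_func m n) M) (fobj (core_func m n) N)" for M N g
      unfolding rep_ee_simps by (rule core_func_full[OF that(1,2) mn that(3)])
    show "\<exists>M\<in>Obj (rep_ee TYPE('k) m n). isomorphic (rep TYPE('k) (m - 1) (n - 1)) (fobj (core_func m n) M) X"
      if "X \<in> Obj (rep TYPE('k) (m - 1) (n - 1))" for X
      by (rule core_func_dense[OF that mn])
  qed (rule quotient_rel_coreless[OF _ _ mn])
  then show ?thesis using C unique by blast
qed

end
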